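(* Assume that $0<T<T_0$. Then the Hamilton--Jacobi--Bellman equation $$z_t(\varsigma,t)+H\big(\varsigma,t,\partial z(\varsigma,t),\partial^2 z(\varsigma,t)\big)=0,\quad t\in[0,T],\qquad z(\varsigma,T)=\varpi x^{\gamma},\qquad \varsigma=(x,s),\ x>0,\ s\in\mathbb R,$$ has the (classical) solution $$z(x,s,t)=\varpi x^{\gamma}U(s,t),\qquad U(s,t)=\exp\Big\{\tfrac{s^2}{2}g(t)+Y(s,t)\Big\},$$ where $Y$ is the unique solution in $\mathcal X$ of $$Y_t(s,t)+\tfrac12\sigma^2Y_{ss}(s,t)+s\,g_1(t)Y_s(s,t)+\Psi_Y(s,t)=0,\qquad Y(s,T)=0,$$ and $Y$ is a fixed point of the Feynman--Kac mapping, i.e. $Y=\mathcal L_Y$.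
   Context: Parameters. Fix constants $0<\gamma<1$, $\kappa>0$, $\sigma>0$, $\varpi>0$, $T>0$ and $r\in\mathbb R$ with $r\le\kappa$ and $\kappa_1:=\kappa+r>0$. Put $\gamma_1=\frac{\sigma^2}{1-\gamma}$, $\gamma_2=\frac{\gamma\kappa_1}{1-\gamma}+\kappa$, $\gamma_3=\frac{\gamma\kappa_1^2}{(1-\gamma)\sigma^2}$, $\check\gamma_2=\gamma_2/\gamma_1$, $\check\gamma_3=\gamma_3/\gamma_1$, $\vartheta=\sqrt{\check\gamma_2^2-\check\gamma_3}$, $\omega=2\vartheta\gamma_1$, and $$g(t)=\check\gamma_2-\vartheta-\frac{2\vartheta(\check\gamma_2-\vartheta)}{e^{\omega(T-t)}(\check\gamma_2+\vartheta)-\check\gamma_2+\vartheta},\qquad 0\le t\le T,$$ which solves $g'(t)-2\gamma_2g(t)+\gamma_1g^2(t)+\gamma_3=0$, $g(T)=0$. Put $g_1(t)=\gamma_1g(t)-\gamma_2$, $$\mathbf B_1=\frac1{\gamma_1}\left(\sqrt{\frac{\pi}{2T}}+\sqrt{\frac{|\pi-4T\sigma^2\varpi^{1/(\gamma-1)}|}{2T}}\right),\qquad \mathbf B_0=\Big(q_1+\frac{\gamma_1}{2}\mathbf B_1^2\Big)T,\qquad q_1=\frac{g(0)\sigma^2}{2}+r\gamma+(1-\gamma)\varpi^{1/(\gamma-1)},$$ $$T_0=\min\left(\frac{\kappa(1-\gamma)}{2(3+\gamma)\kappa_2},\ \frac{\gamma(1-\gamma)}{(3+\gamma)(\gamma+1)\sigma^2g(0)},\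 \frac{\pi}{4\sigma^2}\right),\qquad \kappa_2=\kappa_1^2\Big(\frac1{\sigma^2}+\frac12+\frac{g(0)}{\kappa_1}\Big).$$ Function space. $\mathcal X$ is the set of functions $h:\mathbb R\times[0,T]\to\mathbb R_+=[0,\infty)$, $(s,t)\mapsto h(s,t)$, of class $C^{1,0}$ ($h$ and $h_s=\partial h/\partial s$ are continuous on $\mathbb R\times[0,T]$), with $\sup_{s,t}h(s,t)\le\mathbf B_0$ and $\sup_{s,t}|h_s(s,t)|\le\mathbf B_1$. Feynman--Kac mapping. For $0\le t\le T$, $s\in\mathbb R$ let $(\eta^{s,t}_u)_{t\le u\le T}$ solve $d\eta^{s,t}_u=g_1(u)\eta^{s,t}_u\,du+\sigma\,d\check W_u$, $\eta^{s,t}_t=s$, where $\check W$ is a standard Brownian motion. For $h\in\mathcal X$ set $$\mathcal L_h(s,t)=\int_t^T\mathbf E\,\Psi_h(\eta^{s,t}_u,u)\,du,$$ $$\Psi_h(s,t)=\frac{\sigma^2h_s(s,t)^2}{2(1-\gamma)}+\frac{\sigma^2g(t)}2+r\gamma+(1-\gamma)\varpi^{-1/(1-\gamma)}G(s,t,h(s,t)),\qquad G(s,t,y)=\exp\Big\{-\frac1{1-\gamma}\Big(\frac{s^2}2g(t)+y\Big)\Big\}.$$ Hamiltonian. $\partial z=(z_x,z_s)'$ is the gradient and $\partial^2z$ the Hessian of $z$ in $\varsigma=(x,s)$. For $q=(q_1,q_2)'\in\mathbb R^2$ and a symmetric $2\times2$ matrix $M=(M_{ij})$, $$H(\varsigma,t,q,M)=\sup_{\alpha\in\mathbb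 R,\ c\ge0}\Big\{\tfrac{\alpha^2\sigma^2}{2}M_{11}+(\sigma^2M_{12}-\kappa_1sq_1)\alpha+\tfrac12\sigma^2M_{22}+rxq_1-\kappa sq_2-cq_1+c^\gamma\Big\}$$ (here $q_1$ denotes the first component of $q$, not the constant in $\mathbf B_0$).
   Formalization: The hypothesis r ≥ 0 is added: for every r < 0 the claim fails, since Y = L_Y would give limsup of Y(s,t) as s→∞ at most rγ(T−t)+C(T−t)² < 0 for t near T, contradicting Y ≥ 0 in the function space X. *)

theory Defs
  imports "HOL-Probability.Probability"
begin

section \<open>Parameters\<close>

text \<open>
  The record bundles the free constants: \<open>rate\<close> is the interest rate \<open>r\<close> and \<open>horizon\<close> is \<open>T\<close>.

  The theorem assumes \<open>0 \<le> rate p\<close>.  For \<open>rate p < 0\<close> the equation has no solution in the space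
  \<open>\<X>\<close> of nonnegative functions: by the Feynman--Kac representation, \<open>Y(s,t)\<close> is at most
  \<open>r \<gamma> (T - t) + O((T - t)^2)\<close> in the limit of large \<open>s\<close>, which is negative for \<open>t\<close> near \<open>T\<close>.
\<close>

record spread_params =
  \<gamma> :: real
  \<kappa> :: real
  \<sigma> :: real
  varpi :: real
  rate :: real
  horizon :: real

definition \<kappa>\<^sub>1 :: "spread_params \<Rightarrow> real" where
  "\<kappa>\<^sub>1 p = \<kappa> p + rate p"

definition \<gamma>\<^sub>1 :: "spread_params \<Rightarrow> real" where
  "\<gamma>\<^sub>1 p = (\<sigma> p)\<^sup>2 / (1 - \<gamma> p)"

definition \<gamma>\<^sub>2 :: "spread_params \<Rightarrow> real" where
  "\<gamma>\<^sub>2 p = \<gamma> p * \<kappa>\<^sub>1 p / (1 - \<gamma> p) + \<kappa> p"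

definition \<gamma>\<^sub>3 :: "spread_params \<Rightarrow> real" where
  "\<gamma>\<^sub>3 p = \<gamma> p * (\<kappa>\<^sub>1 p)\<^sup>2 / ((1 - \<gamma> p) * (\<sigma> p)\<^sup>2)"

definition \<gamma>check\<^sub>2 :: "spread_params \<Rightarrow> real" where
  "\<gamma>check\<^sub>2 p = \<gamma>\<^sub>2 p / \<gamma>\<^sub>1 p"

definition \<gamma>check\<^sub>3 :: "spread_params \<Rightarrow> real" where
  "\<gamma>check\<^sub>3 p = \<gamma>\<^sub>3 p / \<gamma>\<^sub>1 p"

definition \<theta>par :: "spread_params \<Rightarrow> real" where
  "\<theta>par p = sqrt ((\<gamma>check\<^sub>2 p)\<^sup>2 - \<gamma>check\<^sub>3 p)"

definition \<omega>par :: "spread_params \<Rightarrow> real" where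
  "\<omega>par p = 2 * \<theta>par p * \<gamma>\<^sub>1 p"

definition g_fn :: "spread_params \<Rightarrow> real \<Rightarrow> real" where
  "g_fn p t = \<gamma>check\<^sub>2 p - \<theta>par p -
     2 * \<theta>par p * (\<gamma>check\<^sub>2 p - \<theta>par p) /
       (exp (\<omega>par p * (horizon p - t)) * (\<gamma>check\<^sub>2 p + \<theta>par p) - \<gamma>check\<^sub>2 p + \<theta>par p)"

definition g1_fn :: "spread_params \<Rightarrow> real \<Rightarrow> real" where
  "g1_fn p t = \<gamma>\<^sub>1 p * g_fn p t - \<gamma>\<^sub>2 p"

definition q1_const :: "spread_params \<Rightarrow> real" where
  "q1_const p = g_fn p 0 * (\<sigma> p)\<^sup>2 / 2 + rate p * \<gamma> p
     + (1 - \<gamma> p) * varpi p powr (1 / (\<gamma> p - 1))"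

definition B1_bound :: "spread_params \<Rightarrow> real" where
  "B1_bound p = 1 / \<gamma>\<^sub>1 p *
     (sqrt (pi / (2 * horizon p)) +
      sqrt (\<bar>pi - 4 * horizon p * (\<sigma> p)\<^sup>2 * varpi p powr (1 / (\<gamma> p - 1))\<bar> / (2 * horizon p)))"

definition B0_bound :: "spread_params \<Rightarrow> real" where
  "B0_bound p = (q1_const p + \<gamma>\<^sub>1 p / 2 * (B1_bound p)\<^sup>2) * horizon p"

definition \<kappa>\<^sub>2 :: "spread_params \<Rightarrow> real" where
  "\<kappa>\<^sub>2 p = (\<kappa>\<^sub>1 p)\<^sup>2 * (1 / (\<sigma> p)\<^sup>2 + 1 / 2 + g_fn p 0 / \<kappa>\<^sub>1 p)"

text \<open>The threshold depends on the horizon through \<open>g(0)\<close>.\<close>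

definition T0_bound :: "spread_params \<Rightarrow> real" where
  "T0_bound p = Min {
     \<kappa> p * (1 - \<gamma> p) / (2 * (3 + \<gamma> p) * \<kappa>\<^sub>2 p),
     \<gamma> p * (1 - \<gamma> p) / ((3 + \<gamma> p) * (\<gamma> p + 1) * (\<sigma> p)\<^sup>2 * g_fn p 0),
     pi / (4 * (\<sigma> p)\<^sup>2)}"


section \<open>The function space\<close>

text \<open>
  A function on \<open>\<real> \<times> [0,T]\<close> is represented by a total function whose values at times outside
  \<open>[0,T]\<close> are irrelevant; uniqueness is therefore stated as agreement on \<open>\<real> \<times> [0,T]\<close>.
\<close>

definition ds :: "(real \<Rightarrow> real \<Rightarrow> real) \<Rightarrow> real \<Rightarrow> real \<Rightarrow> real" where
  "ds h s t = deriv (\<lambda>x. h x t) s"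

definition \<X> :: "spread_params \<Rightarrow> (real \<Rightarrow> real \<Rightarrow> real) set" where
  "\<X> p = {h.
     (\<forall>s. \<forall>t\<in>{0..horizon p}. (\<lambda>x. h x t) differentiable (at s)) \<and>
     continuous_on (UNIV \<times> {0..horizon p}) (\<lambda>(s, t). h s t) \<and>
     continuous_on (UNIV \<times> {0..horizon p}) (\<lambda>(s, t). ds h s t) \<and>
     (\<forall>s. \<forall>t\<in>{0..horizon p}. 0 \<le> h s t \<and> h s t \<le> B0_bound p) \<and>
     (\<forall>s. \<forall>t\<in>{0..horizon p}. \<bar>ds h s t\<bar> \<le> B1_bound p)}"


section \<open>Brownian motion and the Feynman--Kac mapping\<close>

definition standard_brownian_motion :: "'a measure \<Rightarrow> (real \<Rightarrow> 'a \<Rightarrow> real) \<Rightarrow> bool" where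
  "standard_brownian_motion M W \<longleftrightarrow>
     prob_space M \<and>
     (\<forall>t\<ge>0. W t \<in> borel_measurable M) \<and>
     (AE x in M. W 0 x = 0) \<and>
     (\<forall>(n::nat) (\<tau>::nat \<Rightarrow> real). 0 \<le> \<tau> 0 \<and> (\<forall>i<n. \<tau> i < \<tau> (Suc i)) \<longrightarrow>
        prob_space.indep_vars M (\<lambda>_. borel) (\<lambda>i x. W (\<tau> (Suc i)) x - W (\<tau> i) x) {..<n}) \<and>
     (\<forall>s t. 0 \<le> s \<and> s < t \<longrightarrow>
        distributed M lborel (\<lambda>x. W t x - W s x) (normal_density 0 (sqrt (t - s)))) \<and>
     (AE x in M. continuous_on {0..} (\<lambda>t. W t x))"

text \<open>
  \<open>\<eta> s t u\<close> is the value at time \<open>u\<close> of the process started from \<open>s\<close> at time \<open>t\<close>.  The diffusion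
  coefficient is constant, so the integral form of the equation needs no stochastic integral.
\<close>

definition solves_eta_sde ::
  "spread_params \<Rightarrow> 'a measure \<Rightarrow> (real \<Rightarrow> 'a \<Rightarrow> real) \<Rightarrow>
   (real \<Rightarrow> real \<Rightarrow> real \<Rightarrow> 'a \<Rightarrow> real) \<Rightarrow> bool" where
  "solves_eta_sde p M W \<eta> \<longleftrightarrow>
     (\<forall>s. \<forall>t\<in>{0..horizon p}.
        (\<forall>u\<in>{t..horizon p}. \<eta> s t u \<in> borel_measurable M) \<and>
        (AE x in M.
           continuous_on {t..horizon p} (\<lambda>u. \<eta> s t u x) \<and>
           (\<forall>u\<in>{t..horizon p}.
              \<eta> s t u x = s + integral {t..u} (\<lambda>v. g1_fn p v * \<eta> s t v x)
                          + \<sigma> p * (W u x - W t x))))"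

definition G_fn :: "spread_params \<Rightarrow> real \<Rightarrow> real \<Rightarrow> real \<Rightarrow> real" where
  "G_fn p s t y = exp (- (1 / (1 - \<gamma> p)) * (s\<^sup>2 / 2 * g_fn p t + y))"

definition \<Psi> :: "spread_params \<Rightarrow> (real \<Rightarrow> real \<Rightarrow> real) \<Rightarrow> real \<Rightarrow> real \<Rightarrow> real" where
  "\<Psi> p h s t =
     (\<sigma> p)\<^sup>2 * (ds h s t)\<^sup>2 / (2 * (1 - \<gamma> p)) + (\<sigma> p)\<^sup>2 * g_fn p t / 2 + rate p * \<gamma> p
     + (1 - \<gamma> p) * varpi p powr (- 1 / (1 - \<gamma> p)) * G_fn p s t (h s t)"

definition FK_map ::
  "spread_params \<Rightarrow> 'a measure \<Rightarrow> (real \<Rightarrow> real \<Rightarrow> real \<Rightarrow> 'a \<Rightarrow> real) \<Rightarrow>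
   (real \<Rightarrow> real \<Rightarrow> real) \<Rightarrow> real \<Rightarrow> real \<Rightarrow> real" where
  "FK_map p M \<eta> h s t =
     (LINT u:{t..horizon p}|lborel. (LINT x|M. \<Psi> p h (\<eta> s t u x) u))"


section \<open>The Cauchy problem for \<open>Y\<close>\<close>

text \<open>Classical solutions are of class \<open>C^{2,1}\<close>; time derivatives at \<open>0\<close> and \<open>T\<close> are one-sided.\<close>

definition solves_Y_pde :: "spread_params \<Rightarrow> (real \<Rightarrow> real \<Rightarrow> real) \<Rightarrow> bool" where
  "solves_Y_pde p Y \<longleftrightarrow>
     (\<exists>Yt Yss.
        continuous_on (UNIV \<times> {0..horizon p}) (\<lambda>(s, t). Y s t) \<and>
        continuous_on (UNIV \<times> {0..horizon p}) (\<lambda>(s, t). ds Y s t) \<and>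
        continuous_on (UNIV \<times> {0..horizon p}) (\<lambda>(s, t). Yt s t) \<and>
        continuous_on (UNIV \<times> {0..horizon p}) (\<lambda>(s, t). Yss s t) \<and>
        (\<forall>s. \<forall>t\<in>{0..horizon p}.
           ((\<lambda>u. Y s u) has_real_derivative Yt s t) (at t within {0..horizon p}) \<and>
           ((\<lambda>x. Y x t) has_real_derivative ds Y s t) (at s) \<and>
           ((\<lambda>x. ds Y x t) has_real_derivative Yss s t) (at s) \<and>
           Yt s t + 1 / 2 * (\<sigma> p)\<^sup>2 * Yss s t + s * g1_fn p t * ds Y s t + \<Psi> p Y s t = 0)) \<and>
     (\<forall>s. Y s (horizon p) = 0)"


section \<open>The Hamilton--Jacobi--Bellman equation\<close>

text \<open>
  The state is \<open>\<xi> = (x, s)\<close>, that is \<open>\<xi> $ 1 = x\<close> and \<open>\<xi> $ 2 = s\<close>.  The supremum is taken in the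
  extended reals because it is infinite for some \<open>q\<close> and \<open>A\<close>.
\<close>

definition Hamiltonian ::
  "spread_params \<Rightarrow> real ^ 2 \<Rightarrow> real \<Rightarrow> real ^ 2 \<Rightarrow> real ^ 2 ^ 2 \<Rightarrow> ereal" where
  "Hamiltonian p \<xi> t q A =
     (SUP (\<alpha>, c) \<in> UNIV \<times> {0..}.
        ereal (\<alpha>\<^sup>2 * (\<sigma> p)\<^sup>2 / 2 * A $ 1 $ 1
               + ((\<sigma> p)\<^sup>2 * A $ 1 $ 2 - \<kappa>\<^sub>1 p * \<xi> $ 2 * q $ 1) * \<alpha>
               + 1 / 2 * (\<sigma> p)\<^sup>2 * A $ 2 $ 2
               + rate p * \<xi> $ 1 * q $ 1 - \<kappa> p * \<xi> $ 2 * q $ 2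
               - c * q $ 1 + c powr \<gamma> p))"

definition classical_HJB_solution ::
  "spread_params \<Rightarrow> (real ^ 2 \<Rightarrow> real \<Rightarrow> real) \<Rightarrow> bool" where
  "classical_HJB_solution p z \<longleftrightarrow>
     (\<exists>zt (Dz :: real ^ 2 \<Rightarrow> real \<Rightarrow> real ^ 2) (D2z :: real ^ 2 \<Rightarrow> real \<Rightarrow> real ^ 2 ^ 2).
        continuous_on ({\<xi>. 0 < \<xi> $ 1} \<times> {0..horizon p}) (\<lambda>(\<xi>, t). z \<xi> t) \<and>
        continuous_on ({\<xi>. 0 < \<xi> $ 1} \<times> {0..horizon p}) (\<lambda>(\<xi>, t). zt \<xi> t) \<and>
        continuous_on ({\<xi>. 0 < \<xi> $ 1} \<times> {0..horizon p}) (\<lambda>(\<xi>, t). Dz \<xi> t) \<and>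
        continuous_on ({\<xi>. 0 < \<xi> $ 1} \<times> {0..horizon p}) (\<lambda>(\<xi>, t). D2z \<xi> t) \<and>
        (\<forall>\<xi> t. 0 < \<xi> $ 1 \<and> t \<in> {0..horizon p} \<longrightarrow>
           ((\<lambda>u. z \<xi> u) has_real_derivative zt \<xi> t) (at t within {0..horizon p}) \<and>
           (GDERIV (\<lambda>\<zeta>. z \<zeta> t) \<xi> :> Dz \<xi> t) \<and>
           ((\<lambda>\<zeta>. Dz \<zeta> t) has_derivative (\<lambda>v. D2z \<xi> t *v v)) (at \<xi>) \<and>
           ereal (zt \<xi> t) + Hamiltonian p \<xi> t (Dz \<xi> t) (D2z \<xi> t) = 0)) \<and>
     (\<forall>\<xi>. 0 < \<xi> $ 1 \<longrightarrow> z \<xi> (horizon p) = varpi p * (\<xi> $ 1) powr \<gamma> p)"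

definition U_fn :: "spread_params \<Rightarrow> (real \<Rightarrow> real \<Rightarrow> real) \<Rightarrow> real \<Rightarrow> real \<Rightarrow> real" where
  "U_fn p Y s t = exp (s\<^sup>2 / 2 * g_fn p t + Y s t)"

end

theory Submission
  imports Defs
begin

text \<open>
  The logarithmic transform \<open>v = exp (Y / (1 - \<gamma>))\<close> removes the quadratic gradient term: the reduced
  equation for \<open>Y\<close> becomes the linear equation
  \<open>v_t + \<sigma>^2/2 v_ss + s g_1 v_s + a v + b exp (- l s^2 / 2) = 0\<close> with \<open>v = 1\<close> at the horizon, where
  \<open>a = (\<sigma>^2 g / 2 + r \<gamma>) / (1 - \<gamma>)\<close>, \<open>b = varpi^(-1/(1-\<gamma>))\<close> and \<open>l = g / (1 - \<gamma>)\<close>.  The nonlinear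
  exponential term turns into a source that does not contain \<open>v\<close>, because
  \<open>exp (- Y / (1 - \<gamma>)) = 1 / v\<close>.

  The source is a Gaussian in \<open>s\<close>, and the equation propagates a Gaussian into a Gaussian.  By
  Duhamel's principle \<open>v\<close> is therefore an explicit one-dimensional integral of functions
  \<open>kern s t u\<close>, and existence is a computation (\<open>v_deriv_s\<close>, \<open>v_deriv_ss\<close>, \<open>v_deriv_t\<close>).
  The smallness of the horizon gives the bound of the denominator in
  \<open>kern\<close> from below, and the bound of \<open>Y_s\<close> by \<open>B1_bound\<close>.  That bound follows from
  \<open>\<bar>v_s\<bar> \<le> sqrt L * sqrt (b T / 2) * v\<close>, an arithmetic-geometric mean estimate under the integral.

  Uniqueness is the maximum principle for the difference of two solutions, penalized by
  \<open>\<epsilon> exp (K (T - t)) (1 + s^2)\<close> so that a maximum exists (\<open>comparison\<close>).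

  For the fixed point property, \<open>\<eta>\<close> is Gaussian, since by variation of constants it is a limit of
  weighted sums of independent Brownian increments (\<open>ou_law\<close>).  Hence the expectation of a function of
  \<open>\<eta>\<close> is an integral against the standard normal density.  Differentiating the mean of \<open>Y\<close> along the
  process in time and integrating by parts against the normal density (\<open>feynman_kac_gaussian\<close>) replaces
  Ito's formula.

  Finally \<open>z = varpi x^\<gamma> U\<close> is differentiated explicitly, the supremum in the Hamiltonian splits into a
  concave quadratic in \<open>\<alpha>\<close> and a concave function of \<open>c\<close>, and the coefficients of \<open>s^2\<close>, \<open>s Y_s\<close> and
  \<open>Y_s^2\<close> that remain vanish by the Riccati equation for \<open>g\<close> and the reduced equation for \<open>Y\<close>
  (\<open>hjb_reduced_identity\<close>, \<open>z_hjb\<close>).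
\<close>

section \<open>Integrals depending on a parameter\<close>

text \<open>
  Substituting \<open>u = c x + \<theta> (b - c x)\<close> moves the dependence on \<open>x\<close> from the domain into the integrand,
  where continuity in a parameter is standard.
\<close>
lemma continuous_on_integral_lower_limit:
  fixes f :: "'a::topological_space \<Rightarrow> real \<Rightarrow> real"
  assumes f: "continuous_on (U \<times> {a..b}) (\<lambda>(x, u). f x u)"
    and c: "continuous_on U c" "\<And>x. x \<in> U \<Longrightarrow> c x \<in> {a..b}"
  shows "continuous_on U (\<lambda>x. integral {c x..b} (f x))"
proof -
  have eq: "integral {c x..b} (f x) = (b - c x) * integral {0..1} (\<lambda>\<theta>. f x (c x + \<theta> * (b - c x)))"
    if x: "x \<in> U" for x
  proof (cases "c x = b")
    case True then show ?thesis by simp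
  next
    case False
    then have lt: "c x < b" using c(2)[OF x] by simp
    have cont: "continuous_on {c x..b} (f x)"
      using c(2)[OF x] x by (intro continuous_on_compose2[OF f, of _ "\<lambda>u. (x, u)", simplified] continuous_intros) auto
    have "(f x has_integral integral {c x..b} (f x)) (cbox (c x) b)"
      using integrable_integral[OF integrable_continuous_real[OF cont]] by simp
    from has_integral_affinity[OF this, of "b - c x" "c x"] lt
    have "((\<lambda>\<theta>. f x ((b - c x) * \<theta> + c x)) has_integral (1 / (b - c x)) * integral {c x..b} (f x))
       ((\<lambda>y. (1 / (b - c x)) * y + - ((1 / (b - c x)) * c x)) ` {c x..b})"
      by simp
    moreover have "(\<lambda>y. (1 / (b - c x)) * y + - ((1 / (b - c x)) * c x)) ` {c x..b} = {0..1}"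
      using lt by (subst image_affinity_atLeastAtMost) (simp add: diff_divide_distrib[symmetric])
    ultimately have "((\<lambda>\<theta>. f x (c x + \<theta> * (b - c x))) has_integral (1 / (b - c x)) * integral {c x..b} (f x)) {0..1}"
      by (simp add: algebra_simps)
    then show ?thesis using lt by (auto dest!: integral_unique)
  qed
  have "continuous_on (U \<times> cbox 0 1) (\<lambda>(x, \<theta>). f x (c x + \<theta> * (b - c x)))"
  proof -
    have h: "continuous_on (U \<times> cbox 0 1) (\<lambda>z. (fst z, c (fst z) + snd z * (b - c (fst z))))"
      by (intro continuous_intros continuous_on_compose2[OF c(1)]) auto
    have im: "(\<lambda>z. (fst z, c (fst z) + snd z * (b - c (fst z)))) ` (U \<times> cbox 0 1) \<subseteq> U \<times> {a..b}"
    proof (clarsimp)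
      fix y :: real and z :: 'a assume z: "z \<in> U" and y: "0 \<le> y" "y \<le> 1"
      have "0 \<le> y * (b - c z)" "y * (b - c z) \<le> 1 * (b - c z)"
        using c(2)[OF z] y by (auto intro: mult_nonneg_nonneg mult_right_le_one_le mult_left_le_one_le)
      then show "a \<le> c z + y * (b - c z) \<and> c z + y * (b - c z) \<le> b"
        using c(2)[OF z] by auto
    qed
    from continuous_on_compose2[OF f h im] show ?thesis by (simp add: split_beta)
  qed
  from integral_continuous_on_param[OF this]
  have "continuous_on U (\<lambda>x. (b - c x) * integral {0..1} (\<lambda>\<theta>. f x (c x + \<theta> * (b - c x))))"
    by (intro continuous_intros c(1)) simp
  then show ?thesis
    by (rule continuous_on_eq) (simp add: eq)
qed

text \<open>
  The function \<open>(x, y) \<mapsto> integral {x..b} (f y)\<close> has a partial derivative in \<open>x\<close> by the fundamental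
  theorem and in \<open>y\<close> by differentiation under the integral.  The second is continuous, so the chain rule
  applies along the diagonal \<open>x = y = t\<close>.
\<close>
lemma leibniz_rule_lower_limit:
  fixes f :: "real \<Rightarrow> real \<Rightarrow> real"
  assumes f: "continuous_on ({a..b} \<times> {a..b}) (\<lambda>(t, u). f t u)"
    and ft: "\<And>t u. t \<in> {a..b} \<Longrightarrow> u \<in> {a..b} \<Longrightarrow>
      ((\<lambda>t. f t u) has_real_derivative f' t u) (at t within {a..b})"
    and f': "continuous_on ({a..b} \<times> {a..b}) (\<lambda>(t, u). f' t u)"
    and t: "t \<in> {a..b}"
  shows "((\<lambda>t. integral {t..b} (f t)) has_real_derivative
            (integral {t..b} (f' t) - f t t)) (at t within {a..b})"
proof -
  let ?I = "{a..b}"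
  have cf: "continuous_on {x..b} (f y)" if "x \<in> ?I" "y \<in> ?I" for x y
    using that by (intro continuous_on_compose2[OF f, of _ "\<lambda>u. (y, u)", simplified] continuous_intros) auto
  have cf': "continuous_on {x..b} (f' y)" if "x \<in> ?I" "y \<in> ?I" for x y
    using that by (intro continuous_on_compose2[OF f', of _ "\<lambda>u. (y, u)", simplified] continuous_intros) auto
  have "((\<lambda>(x, y). integral {x..b} (f y)) has_derivative
        (\<lambda>(tx, ty). - f t t * tx + blinfun_apply (blinfun_mult_right (integral {t..b} (f' t))) ty))
        (at (t, t) within ?I \<times> ?I)"
  proof (rule has_derivative_partialsI[where fy="\<lambda>x y. blinfun_mult_right (integral {x..b} (f' y))"
        and f="\<lambda>x y. integral {x..b} (f y)"])
    show "((\<lambda>x. integral {x..b} (f t)) has_derivative (*) (- f t t)) (at t within ?I)"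
      using integral_has_real_derivative'[of a b "f t" t] cf[of a t] t
      by (simp add: has_field_derivative_def)
  next
    fix x y assume xy: "x \<in> ?I" "y \<in> ?I"
    have "((\<lambda>y. integral (cbox x b) (f y)) has_field_derivative integral (cbox x b) (f' y)) (at y within ?I)"
    proof (rule leibniz_rule_field_derivative)
      show "continuous_on (?I \<times> cbox x b) (\<lambda>(x, t). f' x t)"
        using xy by (intro continuous_on_subset[OF f']) auto
      show "f z integrable_on cbox x b" if "z \<in> ?I" for z
        using cf[of x z] xy that by (auto intro: integrable_continuous_real)
      show "((\<lambda>t. f t u) has_field_derivative f' z u) (at z within ?I)" if "z \<in> ?I" "u \<in> cbox x b" for z u
        using ft[of z u] xy that by auto
    qed (use xy in auto)
    then show "((\<lambda>y. integral {x..b} (f y)) has_derivative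
         blinfun_apply (blinfun_mult_right (integral {x..b} (f' y)))) (at y within ?I)"
      by (simp add: has_field_derivative_def)
  next
    have "continuous_on (?I \<times> ?I) (\<lambda>z. integral {fst z..b} (\<lambda>u. f' (snd z) u))"
      by (rule continuous_on_integral_lower_limit[where a=a])
        (auto simp: split_beta intro!: continuous_intros 
           continuous_on_compose2[OF f', of _ "\<lambda>z. (snd (fst z), snd z)", simplified])
    then have "continuous_on (?I \<times> ?I) (\<lambda>(x, y). blinfun_mult_right (integral {x..b} (f' y)))"
      unfolding split_beta by (rule bounded_linear.continuous_on[OF bounded_linear_blinfun_mult_right])
    then show "continuous (at (t, t) within ?I \<times> ?I) (\<lambda>(x, y). blinfun_mult_right (integral {x..b} (f' y)))"
      using t by (auto simp: continuous_on_eq_continuous_within)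
  qed (use t in auto)
  then have "((\<lambda>(x, y). integral {x..b} (f y)) has_derivative
        (\<lambda>(tx, ty). - f t t * tx + integral {t..b} (f' t) * ty))
        (at (t, t) within (\<lambda>t. (t, t)) ` ?I)"
    by (auto elim!: has_derivative_subset simp: split_beta)
  then have "(((\<lambda>(x, y). integral {x..b} (f y)) \<circ> (\<lambda>t. (t, t))) has_derivative
        ((\<lambda>(tx, ty). - f t t * tx + integral {t..b} (f' t) * ty) \<circ> (\<lambda>t. (t, t)))) (at t within ?I)"
    by (intro diff_chain_within has_derivative_Pair has_derivative_ident) auto
  moreover have "((\<lambda>(tx, ty). - f t t * tx + integral {t..b} (f' t) * ty) \<circ> (\<lambda>t. (t, t)))
       = (*) (integral {t..b} (f' t) - f t t)"
    by (auto simp: algebra_simps)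
  ultimately show ?thesis
    by (simp add: has_field_derivative_def o_def)
qed

text \<open>
  By the mean value inequality the dominating function of the derivatives also dominates the difference
  quotients.
\<close>
lemma has_real_derivative_integral_dominated:
  fixes f f' :: "real \<Rightarrow> 'a \<Rightarrow> real"
  assumes S: "open S" "x0 \<in> S" "convex S"
    and int: "\<And>x. x \<in> S \<Longrightarrow> integrable M (f x)"
    and der: "\<And>x z. x \<in> S \<Longrightarrow> z \<in> space M \<Longrightarrow> ((\<lambda>x. f x z) has_real_derivative f' x z) (at x)"
    and meas: "f' x0 \<in> borel_measurable M"
    and bound: "\<And>x z. x \<in> S \<Longrightarrow> z \<in> space M \<Longrightarrow> \<bar>f' x z\<bar> \<le> w z" and w: "integrable M w"
  shows "((\<lambda>x. integral\<^sup>L M (f x)) has_real_derivative integral\<^sup>L M (f' x0)) (at x0)"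
proof -
  have "((\<lambda>x. (integral\<^sup>L M (f x) - integral\<^sup>L M (f x0)) / (x - x0)) \<longlongrightarrow> integral\<^sup>L M (f' x0)) (at x0 within S)"
  proof (subst tendsto_at_iff_sequentially, intro allI impI)
    fix X :: "nat \<Rightarrow> real" assume X: "\<forall>i. X i \<in> S - {x0}" "X \<longlonglongrightarrow> x0"
    have "(\<lambda>i. integral\<^sup>L M (\<lambda>z. (f (X i) z - f x0 z) / (X i - x0))) \<longlonglongrightarrow> integral\<^sup>L M (f' x0)"
    proof (rule integral_dominated_convergence[OF meas _ w])
      show "(\<lambda>z. (f (X i) z - f x0 z) / (X i - x0)) \<in> borel_measurable M" for i
        using int[of "X i"] int[OF S(2)] X by (intro borel_measurable_divide borel_measurable_diff) auto
      show "AE z in M. (\<lambda>i. (f (X i) z - f x0 z) / (X i - x0)) \<longlonglongrightarrow> f' x0 z"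
      proof (rule AE_I2)
        fix z assume z: "z \<in> space M"
        have "((\<lambda>x. (f x z - f x0 z) / (x - x0)) \<longlongrightarrow> f' x0 z) (at x0)"
          using der[OF S(2) z] by (simp add: has_field_derivative_iff)
        then show "(\<lambda>i. (f (X i) z - f x0 z) / (X i - x0)) \<longlonglongrightarrow> f' x0 z"
          using X unfolding tendsto_at_iff_sequentially by (auto simp: o_def)
      qed
      show "AE z in M. norm ((f (X i) z - f x0 z) / (X i - x0)) \<le> w z" for i
      proof (rule AE_I2)
        fix z assume z: "z \<in> space M"
        have "norm (f (X i) z - f x0 z) \<le> w z * norm (X i - x0)"
        proof (rule field_differentiable_bound[OF S(3)])
          show "\<And>x. x \<in> S \<Longrightarrow> ((\<lambda>x. f x z) has_field_derivative f' x z) (at x within S)"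
            using der z by (auto intro: has_field_derivative_at_within)
        qed (use bound z X S in auto)
        then show "norm ((f (X i) z - f x0 z) / (X i - x0)) \<le> w z"
          using X by (auto simp: abs_divide divide_le_eq)
      qed
    qed
    moreover have "integral\<^sup>L M (\<lambda>z. (f (X i) z - f x0 z) / (X i - x0)) 
        = (integral\<^sup>L M (f (X i)) - integral\<^sup>L M (f x0)) / (X i - x0)" for i
      using int[of "X i"] int[OF S(2)] X by simp
    ultimately show "((\<lambda>x. (integral\<^sup>L M (f x) - integral\<^sup>L M (f x0)) / (x - x0)) \<circ> X) \<longlonglongrightarrow> integral\<^sup>L M (f' x0)"
      by (simp only: o_def)
  qed
  then show ?thesis
    unfolding has_field_derivative_iff at_within_open[OF S(2) S(1)] .
qed

section \<open>Riemann--Stieltjes sums\<close>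

text \<open>
  Summation by parts, one interval at a time: on each interval the increment of the error equals the
  integral of \<open>d\<close> times the oscillation of \<open>N\<close>.  The weight is taken at the right endpoint, so that
  \<open>N\<close> is frozen at the left one.  Only \<open>e\<close> is differentiated; \<open>N\<close> is going to be a Brownian path.
\<close>
lemma riemann_stieltjes_error:
  fixes e d N :: "real \<Rightarrow> real" and \<tau> :: "nat \<Rightarrow> real"
  assumes e: "\<And>v. v \<in> {t..u} \<Longrightarrow> (e has_real_derivative d v) (at v within {t..u})"
    and d: "continuous_on {t..u} d" "\<And>v. v \<in> {t..u} \<Longrightarrow> \<bar>d v\<bar> \<le> K"
    and N: "continuous_on {t..u} N"
    and \<tau>: "\<tau> 0 = t" "\<And>i. i < n \<Longrightarrow> \<tau> i \<le> \<tau> (Suc i)" "\<tau> n = u"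
    and osc: "\<And>i v. i < n \<Longrightarrow> v \<in> {\<tau> i..\<tau> (Suc i)} \<Longrightarrow> \<bar>N (\<tau> i) - N v\<bar> \<le> \<epsilon>"
    and k: "k \<le> n"
  shows "\<bar>(\<Sum>i<k. e (\<tau> (Suc i)) * (N (\<tau> (Suc i)) - N (\<tau> i)))
          - (e (\<tau> k) * N (\<tau> k) - e t * N t - integral {t..\<tau> k} (\<lambda>v. d v * N v))\<bar> \<le> K * \<epsilon> * (\<tau> k - t)"
  using k
proof (induction k)
  case 0 then show ?case using \<tau> by simp
next
  case (Suc k)
  have mono: "\<tau> i \<le> \<tau> j" if "i \<le> j" "j \<le> n" for i j
    using that
  proof (induction j rule: dec_induct)
    case (step j)
    then show ?case using \<tau>(2)[of j] by simp
  qed simp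
  have k: "t \<le> \<tau> k" "\<tau> k \<le> \<tau> (Suc k)" "\<tau> (Suc k) \<le> u" 
    using mono[of 0 k] mono[of k "Suc k"] mono[of "Suc k" n] \<tau> Suc.prems by auto
  let ?S = "{\<tau> k..\<tau> (Suc k)}"
  have sub: "?S \<subseteq> {t..u}" using k by auto
  have cd: "continuous_on ?S d" "continuous_on ?S N"
    using d(1) N continuous_on_subset sub by blast+
  have "(d has_integral (e (\<tau> (Suc k)) - e (\<tau> k))) ?S"
    using k sub has_field_derivative_subset[OF e sub]
    by (intro fundamental_theorem_of_calculus)
       (auto simp: has_real_derivative_iff_has_vector_derivative[symmetric])
  then have "((\<lambda>v. d v * N (\<tau> k)) has_integral (e (\<tau> (Suc k)) - e (\<tau> k)) * N (\<tau> k)) ?S"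
    by (rule has_integral_mult_left)
  moreover have "((\<lambda>v. d v * N v) has_integral integral ?S (\<lambda>v. d v * N v)) ?S"
    by (intro integrable_integral integrable_continuous_real continuous_intros cd)
  ultimately have hi: "((\<lambda>v. d v * N (\<tau> k) - d v * N v) has_integral
      ((e (\<tau> (Suc k)) - e (\<tau> k)) * N (\<tau> k) - integral ?S (\<lambda>v. d v * N v))) ?S"
    by (rule has_integral_diff)
  have nn: "0 \<le> K" using d(2)[of t] k by force
  have "0 \<le> \<epsilon>" using osc[of k "\<tau> k"] Suc.prems k by force
  have "norm ((e (\<tau> (Suc k)) - e (\<tau> k)) * N (\<tau> k) - integral ?S (\<lambda>v. d v * N v))
     \<le> (K * \<epsilon>) * Henstock_Kurzweil_Integration.content (cbox (\<tau> k) (\<tau> (Suc k)))"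
  proof (rule has_integral_bound)
    fix v assume v: "v \<in> cbox (\<tau> k) (\<tau> (Suc k))"
    have "\<bar>d v\<bar> * \<bar>N (\<tau> k) - N v\<bar> \<le> K * \<epsilon>"
      using v sub osc[of k v] d(2)[of v] Suc.prems nn by (intro mult_mono) auto
    then show "norm (d v * N (\<tau> k) - d v * N v) \<le> K * \<epsilon>"
      by (simp add: abs_mult[symmetric] algebra_simps)
  qed (use hi nn \<open>0 \<le> \<epsilon>\<close> in auto)
  then have A: "\<bar>(e (\<tau> (Suc k)) - e (\<tau> k)) * N (\<tau> k) - integral ?S (\<lambda>v. d v * N v)\<bar> \<le> K * \<epsilon> * (\<tau> (Suc k) - \<tau> k)"
    using k by simp
  have B: "integral {t..\<tau> (Suc k)} (\<lambda>v. d v * N v) = integral {t..\<tau> k} (\<lambda>v. d v * N v) + integral ?S (\<lambda>v. d v * N v)"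
    using k by (intro Henstock_Kurzweil_Integration.integral_combine[OF k(1,2), symmetric] integrable_continuous_real continuous_intros
        continuous_on_subset[OF d(1)] continuous_on_subset[OF N]) auto
  have C: "K * \<epsilon> * (\<tau> (Suc k) - t) = K * \<epsilon> * (\<tau> k - t) + K * \<epsilon> * (\<tau> (Suc k) - \<tau> k)"
    by (simp add: algebra_simps)
  show ?case
    using Suc.IH Suc.prems A unfolding B C by (simp add: algebra_simps abs_le_iff)
qed

lemma riemann_stieltjes_sums_tendsto:
  fixes e d N :: "real \<Rightarrow> real"
  assumes tu: "t < u"
    and e: "\<And>v. v \<in> {t..u} \<Longrightarrow> (e has_real_derivative d v) (at v within {t..u})"
    and d: "continuous_on {t..u} d"
    and N: "continuous_on {t..u} N"
  defines "\<tau> \<equiv> \<lambda>(n::nat) (i::nat). t + (u - t) * (real i / real (Suc n))"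
  shows "(\<lambda>n. \<Sum>i<Suc n. e (\<tau> n (Suc i)) * (N (\<tau> n (Suc i)) - N (\<tau> n i)))
          \<longlonglongrightarrow> e u * N u - e t * N t - integral {t..u} (\<lambda>v. d v * N v)"
proof (rule LIMSEQ_I)
  fix r :: real assume r: "0 < r"
  have "bounded (d ` {t..u})" by (intro compact_imp_bounded compact_continuous_image d) auto
  then obtain K where K: "0 < K" "\<And>v. v \<in> {t..u} \<Longrightarrow> \<bar>d v\<bar> \<le> K"
    by (auto simp: bounded_pos)
  define \<epsilon> where "\<epsilon> = r / (2 * K * (u - t))"
  have \<epsilon>: "0 < \<epsilon>" using r K tu by (simp add: \<epsilon>_def)
  have "uniformly_continuous_on {t..u} N"
    using N by (intro compact_uniformly_continuous) auto
  then obtain \<delta> where \<delta>: "0 < \<delta>" 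
    "\<And>x y. x \<in> {t..u} \<Longrightarrow> y \<in> {t..u} \<Longrightarrow> dist y x < \<delta> \<Longrightarrow> dist (N y) (N x) < \<epsilon>"
    using \<epsilon> unfolding uniformly_continuous_on_def by metis
  obtain n0 :: nat where n0: "(u - t) / \<delta> < real n0" using reals_Archimedean2 by blast
  show "\<exists>n0. \<forall>n\<ge>n0. norm ((\<Sum>i<Suc n. e (\<tau> n (Suc i)) * (N (\<tau> n (Suc i)) - N (\<tau> n i)))
       - (e u * N u - e t * N t - integral {t..u} (\<lambda>v. d v * N v))) < r"
  proof (intro exI[of _ n0] allI impI)
    fix n assume n: "n0 \<le> n"
    have step: "\<tau> n (Suc i) - \<tau> n i = (u - t) / real (Suc n)" for i
    proof -
      have "\<tau> n (Suc i) - \<tau> n i = (u - t) * (real (Suc i) / real (Suc n) - real i / real (Suc n))"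
        by (simp only: \<tau>_def right_diff_distrib add_diff_cancel_left)
      also have "real (Suc i) / real (Suc n) - real i / real (Suc n) = 1 / real (Suc n)"
        unfolding diff_divide_distrib[symmetric] by simp
      finally show ?thesis by simp
    qed
    have "(u - t) / \<delta> < real (Suc n)" using n0 n by linarith
    then have small: "(u - t) / real (Suc n) < \<delta>" using \<delta>(1) by (simp add: field_simps)
    have pos: "0 < (u - t) / real (Suc n)" using tu by simp
    have range: "\<tau> n i \<in> {t..u}" if "i \<le> Suc n" for i
    proof -
      have "(u - t) * (real i / real (Suc n)) \<le> (u - t) * 1"
        using that tu by (intro mult_left_mono) auto
      moreover have "0 \<le> (u - t) * (real i / real (Suc n))" using tu by auto
      ultimately show ?thesis by (auto simp: \<tau>_def)
    qed
    have "real (Suc n) / real (Suc n) = 1" by (rule divide_self) simp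
    then have "\<tau> n (Suc n) = t + (u - t) * 1" by (simp only: \<tau>_def)
    then have top: "\<tau> n (Suc n) = u" by simp
    have "\<bar>(\<Sum>i<Suc n. e (\<tau> n (Suc i)) * (N (\<tau> n (Suc i)) - N (\<tau> n i)))
          - (e (\<tau> n (Suc n)) * N (\<tau> n (Suc n)) - e t * N t - integral {t..\<tau> n (Suc n)} (\<lambda>v. d v * N v))\<bar>
          \<le> K * \<epsilon> * (\<tau> n (Suc n) - t)"
    proof (rule riemann_stieltjes_error[OF e d K(2) N])
      fix i v assume i: "i < Suc n" and v: "v \<in> {\<tau> n i..\<tau> n (Suc i)}"
      have "v \<in> {t..u}" "\<tau> n i \<in> {t..u}" using range[of i] range[of "Suc i"] v i by auto
      moreover have "\<bar>\<tau> n i - v\<bar> < \<delta>" using step[of i] small v by auto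
      ultimately have "dist (N (\<tau> n i)) (N v) < \<epsilon>" by (intro \<delta>) (auto simp: dist_real_def)
      then show "\<bar>N (\<tau> n i) - N v\<bar> \<le> \<epsilon>" by (simp add: dist_real_def)
    next
      show "\<tau> n i \<le> \<tau> n (Suc i)" for i using step[of i] pos by linarith
    qed (use top in \<open>auto simp: \<tau>_def\<close>)
    also have "K * \<epsilon> * (\<tau> n (Suc n) - t) = r / 2"
      using K tu unfolding top \<epsilon>_def by (simp add: field_simps)
    also have "\<dots> < r" using r by simp
    finally show "norm ((\<Sum>i<Suc n. e (\<tau> n (Suc i)) * (N (\<tau> n (Suc i)) - N (\<tau> n i)))
       - (e u * N u - e t * N t - integral {t..u} (\<lambda>v. d v * N v))) < r"
      unfolding top by simp
  qed
qed

section \<open>Integrals against the standard normal density\<close>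

lemma integral_normal_density_scale:
  fixes f :: "real \<Rightarrow> real"
  assumes s: "0 < s"
  shows "(LINT x|lborel. normal_density 0 s x * f x) = (LINT z|lborel. std_normal_density z * f (s * z))"
proof -
  have eq: "s * normal_density 0 s (s * z) = std_normal_density z" for z
    using s by (simp add: normal_density_def real_sqrt_mult power_mult_distrib)
  have "(LINT x|lborel. normal_density 0 s x * f x) 
      = \<bar>s\<bar> *\<^sub>R (LINT z|lborel. normal_density 0 s (0 + s * z) * f (0 + s * z))"
    using s by (intro lborel_integral_real_affine) auto
  also have "\<dots> = (LINT z|lborel. s * (normal_density 0 s (s * z) * f (s * z)))"
    using s by simp
  also have "\<dots> = (LINT z|lborel. std_normal_density z * f (s * z))"
    by (simp add: mult.assoc[symmetric] eq)
  finally show ?thesis .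
qed

lemma integrable_std_normal_bounded:
  fixes f :: "real \<Rightarrow> real"
  assumes f[measurable]: "f \<in> borel_measurable borel" and b: "\<And>z. \<bar>f z\<bar> \<le> A + B * \<bar>z\<bar>"
  shows "integrable lborel (\<lambda>z. std_normal_density z * f z)"
proof (rule Bochner_Integration.integrable_bound)
  have "integrable lborel (\<lambda>z. A * std_normal_density z + B * (std_normal_density z * \<bar>z\<bar> ^ 1))"
    by (intro Bochner_Integration.integrable_add integrable_mult_right
      integrable_std_normal_moment_abs integrable_normal_density) auto
  then show "integrable lborel (\<lambda>z. std_normal_density z * (A + B * \<bar>z\<bar>))"
    by (simp add: algebra_simps)
  show "AE z in lborel. norm (std_normal_density z * f z) \<le> norm (std_normal_density z * (A + B * \<bar>z\<bar>))"
  proof (rule AE_I2)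
    fix z :: real
    have "std_normal_density z * \<bar>f z\<bar> \<le> std_normal_density z * (A + B * \<bar>z\<bar>)"
      using b[of z] by (intro mult_left_mono) auto
    then show "norm (std_normal_density z * f z) \<le> norm (std_normal_density z * (A + B * \<bar>z\<bar>))"
      using abs_ge_zero[of "f z"] b[of z] by (simp add: abs_mult)
  qed
qed simp

lemma std_normal_density_derivative:
  "(std_normal_density has_real_derivative - z * std_normal_density z) (at z)"
proof -
  have *: "std_normal_density = (\<lambda>z. 1 / sqrt (2 * pi) * exp (- (z\<^sup>2 / 2)))"
    by (simp add: normal_density_def fun_eq_iff)
  show ?thesis unfolding * by (auto intro!: derivative_eq_intros simp: field_simps)
qed

lemma std_normal_density_tendsto_0:
  "(std_normal_density \<longlongrightarrow> 0) at_top" "(std_normal_density \<longlongrightarrow> 0) at_bot"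
proof -
  have *: "std_normal_density = (\<lambda>z. 1 / sqrt (2 * pi) * exp (- (z\<^sup>2 / 2)))"
    by (simp add: normal_density_def fun_eq_iff)
  have lim: "((\<lambda>z::real. exp (- (z\<^sup>2 / 2))) \<longlongrightarrow> 0) F" if "filterlim (\<lambda>z. z\<^sup>2) at_top F" for F
  proof -
    have "filterlim (\<lambda>z::real. (1 / 2) * z\<^sup>2) at_top F"
      using that by (intro filterlim_tendsto_pos_mult_at_top[OF tendsto_const]) auto
    then have "filterlim (\<lambda>z::real. - (z\<^sup>2 / 2)) at_bot F"
      by (simp add: filterlim_uminus_at_bot)
    from filterlim_compose[OF exp_at_bot this] show ?thesis .
  qed
  have "((\<lambda>z::real. exp (- (z\<^sup>2 / 2))) \<longlongrightarrow> 0) at_top" "((\<lambda>z::real. exp (- (z\<^sup>2 / 2))) \<longlongrightarrow> 0) at_bot"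
    by (intro lim filterlim_pow_at_top filterlim_pow_at_bot_even filterlim_ident; simp)+
  from this[THEN tendsto_mult_right_zero, of "1 / sqrt (2 * pi)"]
  show "(std_normal_density \<longlongrightarrow> 0) at_top" "(std_normal_density \<longlongrightarrow> 0) at_bot" unfolding * by auto
qed

text \<open>
  The derivative of \<open>- \<phi> f\<close> is \<open>z \<phi> f - \<phi> f'\<close>, where \<open>\<phi>\<close> is the density, and \<open>\<phi> f\<close> vanishes at
  both ends.
\<close>
lemma gaussian_integration_by_parts:
  fixes f f' :: "real \<Rightarrow> real"
  assumes der: "\<And>z. (f has_real_derivative f' z) (at z)"
    and cont: "continuous_on UNIV f'"
    and bnd: "\<And>z. \<bar>f z\<bar> \<le> C" "\<And>z. \<bar>f' z\<bar> \<le> C"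
  shows "(LINT z|lborel. std_normal_density z * (z * f z)) = (LINT z|lborel. std_normal_density z * f' z)"
proof -
  have cf: "continuous_on UNIV f"
    using der by (meson DERIV_isCont continuous_at_imp_continuous_on)
  have [measurable]: "f \<in> borel_measurable borel" "f' \<in> borel_measurable borel"
    using cf cont by (auto intro: borel_measurable_continuous_onI)
  have C: "0 \<le> C" using bnd(1)[of 0] by linarith
  have i1: "integrable lborel (\<lambda>z. std_normal_density z * (z * f z))"
    by (rule integrable_std_normal_bounded[where A=0 and B=C])
       (use bnd in \<open>auto simp: abs_mult mult.commute[of C] intro: mult_left_mono\<close>)
  have i2: "integrable lborel (\<lambda>z. std_normal_density z * f' z)"
    by (rule integrable_std_normal_bounded[where A=C and B=0]) (use bnd in auto)
  define h where "h z = std_normal_density z * (z * f z) - std_normal_density z * f' z" for z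
  have ih: "integrable lborel h" unfolding h_def using i1 i2 by (rule Bochner_Integration.integrable_diff)
  have ein: "einterval (-\<infinity>) \<infinity> = UNIV" by (auto simp: einterval_def)
  have lim: "((\<lambda>z. - std_normal_density z * f z) \<longlongrightarrow> 0) F" if "(std_normal_density \<longlongrightarrow> 0) F" for F
  proof -
    have "((\<lambda>z. - std_normal_density z * f z) \<longlongrightarrow> 0) F"
    proof (rule Lim_null_comparison)
      show "\<forall>\<^sub>F z in F. norm (- std_normal_density z * f z) \<le> std_normal_density z * C"
        using bnd(1) by (auto simp: abs_mult intro!: always_eventually mult_left_mono)
      show "((\<lambda>z. std_normal_density z * C) \<longlongrightarrow> 0) F"
        using that by (rule tendsto_mult_left_zero)
    qed
    then show ?thesis .
  qed
  have contn: "isCont std_normal_density z" for z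
    using std_normal_density_derivative DERIV_isCont by blast
  have "(LBINT z=-\<infinity>..\<infinity>. h z) = 0 - 0"
  proof (rule interval_integral_FTC_integrable[where F="\<lambda>z. - std_normal_density z * f z"])
    show "((\<lambda>z. - std_normal_density z * f z) has_vector_derivative h z) (at z)" for z
      unfolding has_real_derivative_iff_has_vector_derivative[symmetric] h_def
      by (auto intro!: derivative_eq_intros std_normal_density_derivative der simp: algebra_simps)
    show "isCont h z" for z
      unfolding h_def using cf cont contn
      by (intro continuous_intros) (auto simp: continuous_on_eq_continuous_at)
    show "set_integrable lborel (einterval (- \<infinity>) \<infinity>) h"
      using ih by (simp add: ein set_integrable_def)
    show "(((\<lambda>z. - std_normal_density z * f z) \<circ> real_of_ereal) \<longlongrightarrow> 0) (at_right (- \<infinity>))"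
      unfolding ereal_tendsto_simps1 by (rule lim[OF std_normal_density_tendsto_0(2)])
    show "(((\<lambda>z. - std_normal_density z * f z) \<circ> real_of_ereal) \<longlongrightarrow> 0) (at_left \<infinity>)"
      unfolding ereal_tendsto_simps1 by (rule lim[OF std_normal_density_tendsto_0(1)])
  qed simp
  then have "integral\<^sup>L lborel h = 0"
    by (simp add: interval_lebesgue_integral_def ein set_lebesgue_integral_def)
  then show ?thesis
    unfolding h_def using i1 i2 by simp
qed

lemma gaussian_mean_tendsto:
  fixes F :: "nat \<Rightarrow> real \<Rightarrow> real" and G :: "real \<Rightarrow> real"
  assumes meas: "\<And>n. F n \<in> borel_measurable borel" "G \<in> borel_measurable borel"
    and bound: "\<And>n z. \<bar>F n z\<bar> \<le> C" and lim: "\<And>z. (\<lambda>n. F n z) \<longlonglongrightarrow> G z"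
  shows "(\<lambda>n. LINT z|lborel. std_normal_density z * F n z) \<longlonglongrightarrow> (LINT z|lborel. std_normal_density z * G z)"
proof (rule integral_dominated_convergence)
  show "integrable lborel (\<lambda>z. std_normal_density z * C)" by (intro integrable_mult_left integrable_normal_density) auto
  show "AE z in lborel. (\<lambda>n. std_normal_density z * F n z) \<longlonglongrightarrow> std_normal_density z * G z"
    using lim by (intro AE_I2 tendsto_intros) auto
  show "AE z in lborel. norm (std_normal_density z * F n z) \<le> std_normal_density z * C" for n
    using bound by (intro AE_I2) (auto simp: abs_mult intro: mult_left_mono)
qed (use meas in measurable)

section \<open>Derivatives at a maximum\<close>

text \<open>
  If the second derivative were positive, the first derivative would be positive to the right of \<open>x0\<close>,
  and \<open>f\<close> would increase there.
\<close>
lemma second_derivative_at_max: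
  fixes f f' :: "real \<Rightarrow> real"
  assumes f: "\<And>x. (f has_real_derivative f' x) (at x)"
    and f'': "(f' has_real_derivative c) (at x0)" and max: "\<And>x. f x \<le> f x0"
  shows "f' x0 = 0" "c \<le> 0"
proof -
  show 0: "f' x0 = 0" by (rule DERIV_local_max[OF f, of 1]) (use max in auto)
  show "c \<le> 0"
  proof (rule ccontr)
    assume "\<not> c \<le> 0"
    then obtain e where e: "0 < e" "\<And>h. 0 < h \<Longrightarrow> h < e \<Longrightarrow> f' x0 < f' (x0 + h)"
      using has_real_derivative_pos_inc_right[OF f''] by auto
    obtain z where z: "x0 < z" "z < x0 + e / 2" "f (x0 + e / 2) - f x0 = (x0 + e / 2 - x0) * f' z"
      using MVT2[of x0 "x0 + e / 2" f f'] f e(1) by auto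
    have "0 < f' z" using e(2)[of "z - x0"] z e(1) 0 by auto
    then have "0 < f (x0 + e / 2) - f x0" unfolding z(3) using e(1) by simp
    then show False using max[of "x0 + e / 2"] by simp
  qed
qed

lemma right_derivative_at_max:
  fixes f :: "real \<Rightarrow> real"
  assumes f: "(f has_real_derivative c) (at t within {a..b})"
    and t: "t \<in> {a..b}" "t < b" and max: "\<And>x. x \<in> {a..b} \<Longrightarrow> f x \<le> f t"
  shows "c \<le> 0"
proof (rule ccontr)
  assume "\<not> c \<le> 0"
  then obtain e where e: "0 < e" "\<And>h. 0 < h \<Longrightarrow> t + h \<in> {a..b} \<Longrightarrow> h < e \<Longrightarrow> f t < f (t + h)"
    using has_real_derivative_pos_inc_right[OF f] by auto
  define h where "h = min (e / 2) (b - t)"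
  have "0 < h" "t + h \<in> {a..b}" "h < e" using e(1) t by (auto simp: h_def)
  from e(2)[OF this] max[OF this(2)] show False by simp
qed

section \<open>Law of the Ornstein--Uhlenbeck process\<close>

text \<open>
  Mean value theorem with one-sided derivatives at the endpoints.
\<close>
lemma increment_bounds:
  fixes f f' :: "real \<Rightarrow> real"
  assumes f: "\<And>t. t \<in> {0..T} \<Longrightarrow> (f has_real_derivative f' t) (at t within {0..T})"
    and f': "\<And>t. t \<in> {0..T} \<Longrightarrow> lo \<le> f' t \<and> f' t \<le> hi"
    and tu: "0 \<le> t" "t \<le> u" "u \<le> T"
  shows "lo * (u - t) \<le> f u - f t" "f u - f t \<le> hi * (u - t)"
proof -
  have "\<exists>z\<in>{t..u}. f u - f t = (\<lambda>h. f' z * h) (u - t)"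
  proof (rule mvt_very_simple[OF tu(2)])
    fix z assume "t \<le> z" "z \<le> u"
    then have "(f has_real_derivative f' z) (at z within {t..u})"
      using tu by (intro has_field_derivative_subset[OF f]) auto
    then show "(f has_derivative (\<lambda>h. f' z * h)) (at z within {t..u})"
      by (simp add: has_field_derivative_def)
  qed
  then obtain z where z: "t \<le> z" "z \<le> u" "f u - f t = (u - t) * f' z" by (auto simp: mult.commute)
  then have "lo \<le> f' z" "f' z \<le> hi" using f'[of z] tu by auto
  then have "(u - t) * lo \<le> (u - t) * f' z" "(u - t) * f' z \<le> (u - t) * hi"
    using tu by (auto intro: mult_left_mono)
  then show "lo * (u - t) \<le> f u - f t" "f u - f t \<le> hi * (u - t)"
    using z(3) by (auto simp: mult.commute)
qed

text \<open>
  The process \<open>d\<eta> = d(t) \<eta> dt + sg dW\<close> on \<open>[0,T]\<close>.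
\<close>
locale ou_process =
  fixes T sg :: real and d :: "real \<Rightarrow> real"
  assumes T_pos: "0 < T" and sg_pos: "0 < sg" and cont_d: "continuous_on {0..T} d"
begin

definition drift_prim :: "real \<Rightarrow> real" where "drift_prim t = integral {0..t} d"

text \<open>
  Up to the factor \<open>sg^2\<close>, the quadratic variation of the martingale \<open>exp (- drift_prim t) \<eta> t\<close>.
\<close>
definition clock :: "real \<Rightarrow> real" where "clock t = integral {0..t} (\<lambda>v. exp (- 2 * drift_prim v))"

lemma drift_prim_deriv: "t \<in> {0..T} \<Longrightarrow> (drift_prim has_real_derivative d t) (at t within {0..T})"
  unfolding drift_prim_def by (rule integral_has_real_derivative[OF cont_d])

lemma cont_drift_prim: "continuous_on {0..T} drift_prim"
  using drift_prim_deriv by (rule DERIV_continuous_on)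

lemma clock_deriv: "t \<in> {0..T} \<Longrightarrow> (clock has_real_derivative exp (- 2 * drift_prim t)) (at t within {0..T})"
  unfolding clock_def by (rule integral_has_real_derivative) (auto intro!: continuous_intros cont_drift_prim)

lemma cont_clock: "continuous_on {0..T} clock"
  using clock_deriv by (rule DERIV_continuous_on)

lemma clock_strict_mono:
  assumes "0 \<le> t" "t < u" "u \<le> T"
  shows "clock t < clock u"
proof -
  have "\<exists>z\<in>{t..u}. clock u - clock t = (\<lambda>h. exp (- 2 * drift_prim z) * h) (u - t)"
  proof (rule mvt_very_simple)
    fix z assume "t \<le> z" "z \<le> u"
    then have "(clock has_real_derivative exp (- 2 * drift_prim z)) (at z within {t..u})"
      using assms by (intro has_field_derivative_subset[OF clock_deriv]) auto
    then show "(clock has_derivative (\<lambda>h. exp (- 2 * drift_prim z) * h)) (at z within {t..u})"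
      by (simp add: has_field_derivative_def)
  qed (use assms in simp)
  then obtain z where "clock u - clock t = exp (- 2 * drift_prim z) * (u - t)" by auto
  moreover have "0 < exp (- 2 * drift_prim z) * (u - t)" using assms by simp
  ultimately show ?thesis by linarith
qed

lemma clock_mono: "0 \<le> t \<Longrightarrow> t \<le> u \<Longrightarrow> u \<le> T \<Longrightarrow> clock t \<le> clock u"
  using clock_strict_mono[of t u] by (cases "t = u") auto

end

text \<open>
  A sum of independent centred normal variables is normal, with the sum of the variances.
\<close>
lemma brownian_weighted_sum:
  assumes W: "standard_brownian_motion M W"
    and \<tau>: "0 \<le> \<tau> 0" "\<And>i. i < n \<Longrightarrow> \<tau> i < \<tau> (Suc i)" and n: "0 < n"
    and c: "\<And>i. i < n \<Longrightarrow> 0 < c i"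
  shows "distributed M lborel (\<lambda>x. \<Sum>i<n. c i * (W (\<tau> (Suc i)) x - W (\<tau> i) x))
           (normal_density 0 (sqrt (\<Sum>i<n. (c i)\<^sup>2 * (\<tau> (Suc i) - \<tau> i))))"
proof -
  interpret prob_space M using W by (simp add: standard_brownian_motion_def)
  have \<tau>_nonneg: "0 \<le> \<tau> i" if "i \<le> n" for i
    using that
  proof (induction i)
    case (Suc i) then show ?case using \<tau>(2)[of i] by simp
  qed (use \<tau> in simp)
  let ?I = "\<lambda>i x. W (\<tau> (Suc i)) x - W (\<tau> i) x"
  have "indep_vars (\<lambda>_. borel) ?I {..<n}"
    using W \<tau> by (simp add: standard_brownian_motion_def)
  then have ind: "indep_vars (\<lambda>_. borel) (\<lambda>i x. c i * ?I i x) {..<n}"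
    by (rule indep_vars_compose2) simp
  have "distributed M lborel (\<lambda>x. \<Sum>i<n. c i * ?I i x)
     (normal_density (\<Sum>i<n. 0) (sqrt (\<Sum>i<n. (c i * sqrt (\<tau> (Suc i) - \<tau> i))\<^sup>2)))"
  proof (rule sum_indep_normal[OF _ _ ind])
    fix i assume "i \<in> {..<n}"
    then have i: "i < n" by simp
    show pos: "0 < c i * sqrt (\<tau> (Suc i) - \<tau> i)" using c[OF i] \<tau>(2)[OF i] by simp
    have "distributed M lborel (?I i) (normal_density 0 (sqrt (\<tau> (Suc i) - \<tau> i)))"
      using W \<tau>_nonneg[of i] \<tau>(2)[OF i] i by (simp add: standard_brownian_motion_def)
    from normal_density_affine[OF this, of "c i" 0]
    show "distributed M lborel (\<lambda>x. c i * ?I i x) (normal_density 0 (c i * sqrt (\<tau> (Suc i) - \<tau> i)))"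
      using c[OF i] \<tau>(2)[OF i] by simp
  qed (use n in auto)
  moreover have "(\<Sum>i<n. (c i * sqrt (\<tau> (Suc i) - \<tau> i))\<^sup>2) = (\<Sum>i<n. (c i)\<^sup>2 * (\<tau> (Suc i) - \<tau> i))"
    using \<tau>(2) by (intro sum.cong) (auto simp: power_mult_distrib less_imp_le)
  ultimately show ?thesis by simp
qed

context ou_process
begin

definition ou_mean :: "real \<Rightarrow> real \<Rightarrow> real" where "ou_mean t u = exp (drift_prim u - drift_prim t)"
definition ou_var :: "real \<Rightarrow> real \<Rightarrow> real" where
  "ou_var t u = sg\<^sup>2 * exp (2 * drift_prim u) * (clock u - clock t)"

text \<open>
  Variation of constants for a single path: \<open>y - N\<close> is differentiable although \<open>N\<close> is not, and
  \<open>exp (drift_prim u - drift_prim w) * (y w - N w)\<close> has a derivative that contains \<open>N\<close> but not \<open>y\<close>.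
  The stochastic integral is left in the integrated form that \<open>riemann_stieltjes_sums_tendsto\<close> produces.
\<close>
lemma ou_path:
  assumes tu: "0 \<le> t" "t \<le> u" "u \<le> T"
    and y: "continuous_on {t..u} y" and N: "continuous_on {t..u} N"
    and eq: "\<And>w. w \<in> {t..u} \<Longrightarrow> y w = s + integral {t..w} (\<lambda>v. d v * y v) + (N w - N t)"
  shows "y u = ou_mean t u * s + (exp (drift_prim u - drift_prim u) * N u - exp (drift_prim u - drift_prim t) * N t
           - integral {t..u} (\<lambda>v. - d v * exp (drift_prim u - drift_prim v) * N v))"
proof -
  have sub: "{t..u} \<subseteq> {0..T}" using tu by auto
  have cd: "continuous_on {t..u} d" "continuous_on {t..u} drift_prim"
    using continuous_on_subset[OF cont_d sub] continuous_on_subset[OF cont_drift_prim sub] by auto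
  define \<xi> where "\<xi> w = s - N t + integral {t..w} (\<lambda>v. d v * y v)" for w
  have \<xi>: "y w = \<xi> w + N w" if "w \<in> {t..u}" for w using eq[OF that] by (simp add: \<xi>_def)
  have d\<xi>: "(\<xi> has_real_derivative d w * y w) (at w within {t..u})" if "w \<in> {t..u}" for w
    unfolding \<xi>_def[abs_def]
    using DERIV_add[OF DERIV_const integral_has_real_derivative[of t u "\<lambda>v. d v * y v" w]] that cd y
    by (auto intro!: continuous_intros)
  have dG: "(drift_prim has_real_derivative d w) (at w within {t..u})" if "w \<in> {t..u}" for w
    using has_field_derivative_subset[OF drift_prim_deriv sub] that sub by auto
  have "((\<lambda>w. exp (drift_prim u - drift_prim w) * \<xi> w) has_real_derivative d w * exp (drift_prim u - drift_prim w) * N w) (at w within {t..u})"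
    if "w \<in> {t..u}" for w
    by (rule DERIV_cong[OF DERIV_mult[OF DERIV_chain2[OF DERIV_exp DERIV_diff[OF DERIV_const dG[OF that]]] d\<xi>[OF that]]])
       (simp add: \<xi>[OF that] algebra_simps)
  then have "((\<lambda>w. d w * exp (drift_prim u - drift_prim w) * N w) has_integral
      (exp (drift_prim u - drift_prim u) * \<xi> u - exp (drift_prim u - drift_prim t) * \<xi> t)) {t..u}"
    using tu by (intro fundamental_theorem_of_calculus) (auto simp: has_real_derivative_iff_has_vector_derivative[symmetric])
  from integral_unique[OF this] have "integral {t..u} (\<lambda>w. d w * exp (drift_prim u - drift_prim w) * N w) = \<xi> u - exp (drift_prim u - drift_prim t) * (s - N t)"
    by (simp add: \<xi>_def)
  then show ?thesis using \<xi>[of u] tu by (simp add: ou_mean_def algebra_simps)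
qed

text \<open>
  The limit of the variances of the approximating sums, in the same integrated form as for the paths
  but with \<open>N\<close> replaced by the identity and \<open>e\<close> by its square.
\<close>
lemma ou_var_integral:
  assumes tu: "0 \<le> t" "t \<le> u" "u \<le> T"
  shows "sg\<^sup>2 * ((exp (drift_prim u - drift_prim u))\<^sup>2 * u - (exp (drift_prim u - drift_prim t))\<^sup>2 * t
       - integral {t..u} (\<lambda>v. - 2 * d v * (exp (drift_prim u - drift_prim v))\<^sup>2 * v)) = ou_var t u"
proof -
  have sub: "{t..u} \<subseteq> {0..T}" using tu by auto
  have dG: "(drift_prim has_real_derivative d w) (at w within {t..u})" if "w \<in> {t..u}" for w
    using has_field_derivative_subset[OF drift_prim_deriv sub] that sub by auto
  have dJ: "(clock has_real_derivative exp (- 2 * drift_prim w)) (at w within {t..u})" if "w \<in> {t..u}" for w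
    using has_field_derivative_subset[OF clock_deriv sub] that sub by auto
  have "((\<lambda>w. (exp (drift_prim u - drift_prim w))\<^sup>2 * w - exp (2 * drift_prim u) * clock w) has_real_derivative
      - 2 * d w * (exp (drift_prim u - drift_prim w))\<^sup>2 * w) (at w within {t..u})" if w: "w \<in> {t..u}" for w
  proof -
    have e: "(exp (drift_prim u - drift_prim w))\<^sup>2 = exp (2 * drift_prim u) * exp (- 2 * drift_prim w)" 
      by (simp add: exp_double[symmetric] mult_exp_exp algebra_simps)
    show ?thesis
      by (rule derivative_eq_intros dG[OF w] dJ[OF w] refl)+
         (use e in \<open>simp add: algebra_simps power2_eq_square\<close>)
  qed
  then have "((\<lambda>w. - 2 * d w * (exp (drift_prim u - drift_prim w))\<^sup>2 * w) has_integral
     ((exp (drift_prim u - drift_prim u))\<^sup>2 * u - exp (2 * drift_prim u) * clock u - ((exp (drift_prim u - drift_prim t))\<^sup>2 * t - exp (2 * drift_prim u) * clock t))) {t..u}"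
    using tu by (intro fundamental_theorem_of_calculus) (auto simp: has_real_derivative_iff_has_vector_derivative[symmetric])
  from integral_unique[OF this] show ?thesis
    unfolding ou_var_def mult.assoc by (intro arg_cong[where f="\<lambda>y. sg\<^sup>2 * y"]) (simp add: algebra_simps)
qed

lemma ou_var_pos: "0 \<le> t \<Longrightarrow> t < u \<Longrightarrow> u \<le> T \<Longrightarrow> 0 < ou_var t u"
  using clock_strict_mono[of t u] sg_pos by (simp add: ou_var_def)

text \<open>
  The Riemann--Stieltjes sums with the Brownian path as integrator are normal variables, converge to
  the process almost surely, and have convergent variances.  Both sides of the claim are limits of the
  same expectations, by dominated convergence.
\<close>
lemma ou_law:
  assumes W: "standard_brownian_motion M W"
    and tu: "0 \<le> t" "t < u" "u \<le> T"
    and X: "X u \<in> borel_measurable M"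
    and path: "AE x in M. continuous_on {t..T} (\<lambda>u. X u x) \<and>
        (\<forall>u\<in>{t..T}. X u x = s + integral {t..u} (\<lambda>v. d v * X v x) + sg * (W u x - W t x))"
    and f: "continuous_on UNIV f" "\<And>y. \<bar>f y\<bar> \<le> C"
  shows "(LINT x|M. f (X u x)) = (LINT z|lborel. std_normal_density z * f (ou_mean t u * s + sqrt (ou_var t u) * z))"
proof -
  interpret prob_space M using W by (simp add: standard_brownian_motion_def)
  have sub: "{t..u} \<subseteq> {0..T}" using tu by auto
  have cd: "continuous_on {t..u} d" "continuous_on {t..u} drift_prim"
    using continuous_on_subset[OF cont_d sub] continuous_on_subset[OF cont_drift_prim sub] by auto
  have dG: "(drift_prim has_real_derivative d w) (at w within {t..u})" if "w \<in> {t..u}" for w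
    using has_field_derivative_subset[OF drift_prim_deriv sub] that sub by auto
  define e where "e v = exp (drift_prim u - drift_prim v)" for v
  have de: "(e has_real_derivative - d w * exp (drift_prim u - drift_prim w)) (at w within {t..u})" if w: "w \<in> {t..u}" for w
    unfolding e_def[abs_def] by (rule derivative_eq_intros dG[OF w] refl)+ simp
  have de2: "((\<lambda>v. (e v)\<^sup>2) has_real_derivative - 2 * d w * (exp (drift_prim u - drift_prim w))\<^sup>2) (at w within {t..u})" if w: "w \<in> {t..u}" for w
    by (rule derivative_eq_intros de[OF w] refl)+ (simp add: e_def power2_eq_square)
  define \<tau> where "\<tau> = (\<lambda>(n::nat) (i::nat). t + (u - t) * (real i / real (Suc n)))"
  define S where "S n x = (\<Sum>i<Suc n. (sg * e (\<tau> n (Suc i))) * (W (\<tau> n (Suc i)) x - W (\<tau> n i) x))" for n x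
  define V where "V n = (\<Sum>i<Suc n. (sg * e (\<tau> n (Suc i)))\<^sup>2 * (\<tau> n (Suc i) - \<tau> n i))" for n
  have \<tau>: "0 \<le> \<tau> n 0" "\<tau> n i < \<tau> n (Suc i)" for n i
    using tu by (auto simp: \<tau>_def divide_strict_right_mono)
  have epos: "0 < e v" for v by (simp add: e_def)
  have dist: "distributed M lborel (S n) (normal_density 0 (sqrt (V n)))" for n
    unfolding S_def[abs_def] V_def
    by (rule brownian_weighted_sum[OF W]) (use \<tau> epos sg_pos in auto)
  have Vpos: "0 < V n" for n
    unfolding V_def using \<tau> epos sg_pos by (intro sum_pos mult_pos_pos zero_less_power) (auto simp: algebra_simps)
  have "(\<lambda>n. sg\<^sup>2 * (\<Sum>i<Suc n. (e (\<tau> n (Suc i)))\<^sup>2 * (\<tau> n (Suc i) - \<tau> n i)))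
       \<longlonglongrightarrow> sg\<^sup>2 * ((e u)\<^sup>2 * u - (e t)\<^sup>2 * t - integral {t..u} (\<lambda>v. - 2 * d v * (exp (drift_prim u - drift_prim v))\<^sup>2 * v))"
    unfolding \<tau>_def
    by (intro tendsto_mult_left riemann_stieltjes_sums_tendsto[OF tu(2) de2, where N="\<lambda>v. v"])
       (auto intro!: continuous_intros cd)
  also have "sg\<^sup>2 * ((e u)\<^sup>2 * u - (e t)\<^sup>2 * t - integral {t..u} (\<lambda>v. - 2 * d v * (exp (drift_prim u - drift_prim v))\<^sup>2 * v)) = ou_var t u"
    unfolding e_def using tu by (intro ou_var_integral) auto
  also have "(\<lambda>n. sg\<^sup>2 * (\<Sum>i<Suc n. (e (\<tau> n (Suc i)))\<^sup>2 * (\<tau> n (Suc i) - \<tau> n i))) = V"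
    by (simp add: V_def fun_eq_iff sum_distrib_left power_mult_distrib mult.assoc distrib_left)
  finally have Vlim: "V \<longlonglongrightarrow> ou_var t u" .
  have AEW: "AE x in M. continuous_on {0..} (\<lambda>t. W t x)"
    using W by (simp add: standard_brownian_motion_def)
  have Slim: "AE x in M. (\<lambda>n. ou_mean t u * s + S n x) \<longlonglongrightarrow> X u x"
    using AEW path
  proof eventually_elim
    case (elim x)
    define N where "N v = sg * W v x" for v
    have cN: "continuous_on {t..u} N"
      unfolding N_def using elim(1) tu by (intro continuous_intros) (auto elim: continuous_on_subset)
    have "X u x = ou_mean t u * s + (exp (drift_prim u - drift_prim u) * N u - exp (drift_prim u - drift_prim t) * N t
           - integral {t..u} (\<lambda>v. - d v * exp (drift_prim u - drift_prim v) * N v))"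
    proof (rule ou_path)
      show "continuous_on {t..u} (\<lambda>u. X u x)" using elim(2) tu by (auto elim: continuous_on_subset)
      show "X w x = s + integral {t..w} (\<lambda>v. d v * X v x) + (N w - N t)" if "w \<in> {t..u}" for w
        using elim(2) that tu by (auto simp: N_def algebra_simps)
    qed (use tu cN in auto)
    moreover have "(\<lambda>n. \<Sum>i<Suc n. e (\<tau> n (Suc i)) * (N (\<tau> n (Suc i)) - N (\<tau> n i)))
       \<longlonglongrightarrow> e u * N u - e t * N t - integral {t..u} (\<lambda>v. - d v * exp (drift_prim u - drift_prim v) * N v)"
      unfolding \<tau>_def
      by (intro riemann_stieltjes_sums_tendsto[OF tu(2) de _ cN]) (auto intro!: continuous_intros cd)
    moreover have "(\<Sum>i<Suc n. e (\<tau> n (Suc i)) * (N (\<tau> n (Suc i)) - N (\<tau> n i))) = S n x" for n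
      unfolding S_def N_def by (intro sum.cong) (auto simp: algebra_simps)
    ultimately show ?case
      unfolding e_def by (auto intro!: tendsto_intros)
  qed
  have fm[measurable]: "f \<in> borel_measurable borel" using f(1) by (rule borel_measurable_continuous_onI)
  have Sm[measurable]: "S n \<in> borel_measurable M" for n
    using distributed_measurable[OF dist[of n]] by simp
  have fc: "isCont f y" for y using f(1) by (simp add: continuous_on_eq_continuous_at)
  have L1: "(\<lambda>n. LINT x|M. f (ou_mean t u * s + S n x)) \<longlonglongrightarrow> (LINT x|M. f (X u x))"
  proof (rule integral_dominated_convergence[where w="\<lambda>_. C"])
    show "AE x in M. (\<lambda>n. f (ou_mean t u * s + S n x)) \<longlonglongrightarrow> f (X u x)"
      using Slim by eventually_elim (rule isCont_tendsto_compose[OF fc])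
  qed (use X f(2) in auto)
  have "(LINT x|M. f (ou_mean t u * s + S n x)) = (LINT z|lborel. std_normal_density z * f (ou_mean t u * s + sqrt (V n) * z))" for n
  proof -
    have "(LINT x|M. f (ou_mean t u * s + S n x)) = (LINT y|lborel. normal_density 0 (sqrt (V n)) y * f (ou_mean t u * s + y))"
      by (rule distributed_integral[OF dist, symmetric]) auto
    also have "\<dots> = (LINT z|lborel. std_normal_density z * f (ou_mean t u * s + sqrt (V n) * z))"
      using Vpos by (rule integral_normal_density_scale[OF real_sqrt_gt_zero])
    finally show ?thesis .
  qed
  moreover have "(\<lambda>n. LINT z|lborel. std_normal_density z * f (ou_mean t u * s + sqrt (V n) * z))
      \<longlonglongrightarrow> (LINT z|lborel. std_normal_density z * f (ou_mean t u * s + sqrt (ou_var t u) * z))"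
  proof (rule gaussian_mean_tendsto)
    show "(\<lambda>n. f (ou_mean t u * s + sqrt (V n) * z)) \<longlonglongrightarrow> f (ou_mean t u * s + sqrt (ou_var t u) * z)" for z
      by (intro isCont_tendsto_compose[OF fc] tendsto_intros Vlim)
  qed (use f(2) in auto)
  ultimately show ?thesis using L1 LIMSEQ_unique by auto
qed

end

section \<open>The Gaussian Feynman--Kac formula\<close>

text \<open>
  Along a moving point the drift term of the equation is absorbed by the motion of the mean; the
  remaining term with the factor \<open>z\<close> is the one treated by Gaussian integration by parts.
\<close>
lemma drift_cancels:
  fixes yt :: real
  assumes "yt + 1/2 * c * yss + x * dr * ys + ps = 0"
  shows "ys * (dr * x + k * z) + yt = - (1/2 * c * yss) - ps + k * (z * ys)"
proof -
  have "yt = - (1/2 * c * yss) - x * dr * ys - ps" using assms by linarith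
  then show ?thesis by (simp only:) (simp add: algebra_simps)
qed

context ou_process
begin

lemma cont_ou_mean: "0 \<le> t \<Longrightarrow> continuous_on {t..T} (ou_mean t)"
  unfolding ou_mean_def by (intro continuous_intros continuous_on_subset[OF cont_drift_prim]) auto

lemma cont_ou_var: "0 \<le> t \<Longrightarrow> continuous_on {t..T} (ou_var t)"
  unfolding ou_var_def by (intro continuous_intros continuous_on_subset[OF cont_drift_prim] continuous_on_subset[OF cont_clock]) auto

text \<open>
  The point of the path of mean \<open>ou_mean t u * s\<close> that corresponds to the value \<open>z\<close> of a standard
  normal variable.
\<close>
definition ou_point :: "real \<Rightarrow> real \<Rightarrow> real \<Rightarrow> real \<Rightarrow> real" where
  "ou_point s t u z = ou_mean t u * s + sqrt (ou_var t u) * z"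

lemma cont_ou_point: "0 \<le> t \<Longrightarrow> continuous_on {t..T} (\<lambda>u. ou_point s t u z)"
  unfolding ou_point_def using cont_ou_mean[of t] cont_ou_var[of t] by (intro continuous_intros) auto

lemma ou_point_start: "ou_point s t t z = s"
  by (simp add: ou_point_def ou_mean_def ou_var_def)

lemma ou_point_deriv:
  assumes "0 \<le> t" "t < u" "u < T"
  shows "((\<lambda>u. ou_point s t u z) has_real_derivative
     d u * ou_point s t u z + sg\<^sup>2 / (2 * sqrt (ou_var t u)) * z) (at u)"
proof -
  have G: "(drift_prim has_real_derivative d u) (at u)" and clock: "(clock has_real_derivative exp (- 2 * drift_prim u)) (at u)"
    using drift_prim_deriv[of u] clock_deriv[of u] assms by (auto simp: at_within_Icc_at)
  have V: "0 < ou_var t u" using assms by (intro ou_var_pos) auto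
  define q where "q = sqrt (ou_var t u)"
  have q: "0 < q" "ou_var t u = q * q" using V by (auto simp: q_def)
  have e: "exp (2 * drift_prim u) * exp (- 2 * drift_prim u) = 1" by (simp add: mult_exp_exp)
  have dm: "(ou_mean t has_real_derivative d u * ou_mean t u) (at u)"
    unfolding ou_mean_def[abs_def] by (rule derivative_eq_intros G refl)+ simp
  have dv: "(ou_var t has_real_derivative sg\<^sup>2 + 2 * d u * ou_var t u) (at u)"
    unfolding ou_var_def[abs_def] by (rule derivative_eq_intros G clock refl)+ (use e in \<open>simp add: algebra_simps\<close>)
  have "((\<lambda>u. sqrt (ou_var t u)) has_real_derivative inverse q / 2 * (sg\<^sup>2 + 2 * d u * ou_var t u)) (at u)"
    unfolding q_def by (rule DERIV_chain2[OF DERIV_real_sqrt[OF V] dv])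
  from DERIV_add[OF DERIV_cmult_right[OF dm, of s] DERIV_cmult_right[OF this, of z]]
  show ?thesis unfolding ou_point_def[abs_def] q_def[symmetric]
    by (rule DERIV_cong) (use q in \<open>simp add: field_simps\<close>)
qed

text \<open>
  The derivative in \<open>u\<close> of the mean of \<open>Y\<close> at time \<open>u\<close> is the negative of the mean of \<open>Psi\<close>: differentiation under the
  integral gives \<open>- sg^2/2 Yss - Psi + sg^2/(2 sqrt (ou_var t u)) z Ys\<close>, and integration by parts turns
  the last term into \<open>sg^2/2 Yss\<close>.  The factor \<open>1 / sqrt (ou_var t u)\<close> is singular at \<open>u = t\<close>, so the
  fundamental theorem is used with derivatives in the open interval and continuity at the endpoints.
\<close>
lemma feynman_kac_gaussian:
  fixes Y Ys Yss Yt Psi :: "real \<Rightarrow> real \<Rightarrow> real"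
  assumes contY: "continuous_on (UNIV \<times> {0..T}) (\<lambda>(s, t). Y s t)"
    and contYs: "continuous_on (UNIV \<times> {0..T}) (\<lambda>(s, t). Ys s t)"
    and contYss: "continuous_on (UNIV \<times> {0..T}) (\<lambda>(s, t). Yss s t)"
    and contYt: "continuous_on (UNIV \<times> {0..T}) (\<lambda>(s, t). Yt s t)"
    and contPsi: "continuous_on (UNIV \<times> {0..T}) (\<lambda>(s, t). Psi s t)"
    and dt: "\<And>s t. t \<in> {0..T} \<Longrightarrow> ((\<lambda>u. Y s u) has_real_derivative Yt s t) (at t within {0..T})"
    and ds: "\<And>s t. t \<in> {0..T} \<Longrightarrow> ((\<lambda>x. Y x t) has_real_derivative Ys s t) (at s)"
    and dss: "\<And>s t. t \<in> {0..T} \<Longrightarrow> ((\<lambda>x. Ys x t) has_real_derivative Yss s t) (at s)"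
    and bnd: "\<And>s t. t \<in> {0..T} \<Longrightarrow> \<bar>Y s t\<bar> \<le> C" "\<And>s t. t \<in> {0..T} \<Longrightarrow> \<bar>Ys s t\<bar> \<le> C"
      "\<And>s t. t \<in> {0..T} \<Longrightarrow> \<bar>Yss s t\<bar> \<le> C" "\<And>s t. t \<in> {0..T} \<Longrightarrow> \<bar>Psi s t\<bar> \<le> C"
    and pde: "\<And>s t. t \<in> {0..T} \<Longrightarrow> Yt s t + 1/2 * sg\<^sup>2 * Yss s t + s * d t * Ys s t + Psi s t = 0"
    and terminal: "\<And>s. Y s T = 0" and t: "0 \<le> t" "t \<le> T"
  shows "continuous_on {t..T} (\<lambda>u. LINT z|lborel. std_normal_density z * Psi (ou_point s t u z) u)"
    and "Y s t = integral {t..T} (\<lambda>u. LINT z|lborel. std_normal_density z * Psi (ou_point s t u z) u)"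
proof -
  have C: "0 \<le> C" using bnd(1)[of 0 0] T_pos by auto
  have slice: "continuous_on UNIV (\<lambda>z. f (ou_point s t u z) u)"
    if f: "continuous_on (UNIV \<times> {0..T}) (\<lambda>(s, t). f s t)" and u: "u \<in> {0..T}" for f :: "real \<Rightarrow> real \<Rightarrow> real" and u
    using u unfolding ou_point_def
    by (intro continuous_on_compose2[OF f, of _ "\<lambda>z. (ou_mean t u * s + sqrt (ou_var t u) * z, u)", simplified] continuous_intros) auto
  have meas: "(\<lambda>z. f (ou_point s t u z) u) \<in> borel_measurable borel"
    if f: "continuous_on (UNIV \<times> {0..T}) (\<lambda>(s, t). f s t)" and u: "u \<in> {0..T}" for f :: "real \<Rightarrow> real \<Rightarrow> real" and u
    using slice[OF f u] by (rule borel_measurable_continuous_onI)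
  have cont_mean: "continuous_on {t..T} (\<lambda>u. LINT z|lborel. std_normal_density z * f (ou_point s t u z) u)"
    if f: "continuous_on (UNIV \<times> {0..T}) (\<lambda>(s, t). f s t)" and b: "\<And>s t. t \<in> {0..T} \<Longrightarrow> \<bar>f s t\<bar> \<le> C" for f :: "real \<Rightarrow> real \<Rightarrow> real"
  proof (rule continuous_on_sequentiallyI)
    fix U :: "nat \<Rightarrow> real" and w assume U: "\<forall>n. U n \<in> {t..T}" and w: "w \<in> {t..T}" and lim: "U \<longlonglongrightarrow> w"
    have U0: "U n \<in> {0..T}" for n using U[rule_format, of n] t by auto
    show "(\<lambda>n. LINT z|lborel. std_normal_density z * f (ou_point s t (U n) z) (U n)) \<longlonglongrightarrow>
       (LINT z|lborel. std_normal_density z * f (ou_point s t w z) w)"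
    proof (rule gaussian_mean_tendsto[where C=C])
      fix z
      have "continuous_on {t..T} (\<lambda>u. f (ou_point s t u z) u)"
        using t by (intro continuous_on_compose2[OF f, of _ "\<lambda>u. (ou_point s t u z, u)", simplified] continuous_intros cont_ou_point) auto
      then show "(\<lambda>n. f (ou_point s t (U n) z) (U n)) \<longlonglongrightarrow> f (ou_point s t w z) w"
        using U w lim unfolding continuous_on_sequentially o_def by blast
    next
      show "(\<lambda>z. f (ou_point s t (U n) z) (U n)) \<in> borel_measurable borel" for n
        using U0 by (rule meas[OF f])
      show "(\<lambda>z. f (ou_point s t w z) w) \<in> borel_measurable borel"
        using w t by (intro meas[OF f]) auto
      show "\<bar>f (ou_point s t (U n) z) (U n)\<bar> \<le> C" for n z
        using U0 by (rule b)
    qed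
  qed
  show contE: "continuous_on {t..T} (\<lambda>u. LINT z|lborel. std_normal_density z * Psi (ou_point s t u z) u)"
    by (rule cont_mean[OF contPsi bnd(4)])
  let ?\<phi> = "\<lambda>u. LINT z|lborel. std_normal_density z * Y (ou_point s t u z) u"
  have der: "(?\<phi> has_real_derivative - (LINT z|lborel. std_normal_density z * Psi (ou_point s t u z) u)) (at u)"
    if u: "u \<in> {t<..<T}" for u
  proof -
    \<comment> \<open>domination near \<open>u\<close> needs the variance bounded away from zero\<close>
    define t' where "t' = (t + u) / 2"
    have t': "t < t'" "t' < u" using u by (auto simp: t'_def)
    obtain V0 where V0: "0 < V0" "\<And>w. w \<in> {t'..T} \<Longrightarrow> V0 \<le> sqrt (ou_var t w)"
    proof -
      have "continuous_on {t'..T} (\<lambda>w. sqrt (ou_var t w))"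
        using t t' by (intro continuous_intros continuous_on_subset[OF cont_ou_var]) auto
      from continuous_attains_inf[OF compact_Icc _ this] t' u
      obtain w0 where "w0 \<in> {t'..T}" "\<And>w. w \<in> {t'..T} \<Longrightarrow> sqrt (ou_var t w0) \<le> sqrt (ou_var t w)" by force
      moreover from this(1) have "0 < ou_var t w0" using t t' by (intro ou_var_pos) auto
      ultimately show ?thesis using that[of "sqrt (ou_var t w0)"] by auto
    qed
    define D where "D w z = - (1/2 * sg\<^sup>2 * Yss (ou_point s t w z) w) - Psi (ou_point s t w z) w
        + sg\<^sup>2 / (2 * sqrt (ou_var t w)) * (z * Ys (ou_point s t w z) w)" for w z
    have derY: "((\<lambda>w. Y (ou_point s t w z) w) has_real_derivative D w z) (at w)" if w: "w \<in> {t'<..<T}" for w z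
    proof -
      have w': "w \<in> {0..T}" "t < w" "w < T" using w t t' by auto
      have "((\<lambda>(x, y). Y x y) has_derivative (\<lambda>(h, k). Ys (ou_point s t w z) w * h + blinfun_apply (blinfun_mult_right (Yt (ou_point s t w z) w)) k))
         (at (ou_point s t w z, w) within UNIV \<times> {0..T})"
      proof (rule has_derivative_partialsI[where fy="\<lambda>x y. blinfun_mult_right (Yt x y)"])
        show "((\<lambda>x. Y x w) has_derivative (*) (Ys (ou_point s t w z) w)) (at (ou_point s t w z) within UNIV)"
          using ds[OF w'(1)] by (simp add: has_field_derivative_def)
        show "((\<lambda>y. Y x y) has_derivative blinfun_apply (blinfun_mult_right (Yt x y))) (at y within {0..T})" if "y \<in> {0..T}" for x y
          using dt[OF that] by (simp add: has_field_derivative_def)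
        have "continuous_on (UNIV \<times> {0..T}) (\<lambda>(x, y). blinfun_mult_right (Yt x y))"
          using bounded_linear.continuous_on[OF bounded_linear_blinfun_mult_right contYt] by (simp add: split_beta)
        then show "continuous (at (ou_point s t w z, w) within UNIV \<times> {0..T}) (\<lambda>(x, y). blinfun_mult_right (Yt x y))"
          using w'(1) by (auto simp: continuous_on_eq_continuous_within)
      qed (use w' in auto)
      then have "((\<lambda>(x, y). Y x y) has_derivative (\<lambda>(h, k). Ys (ou_point s t w z) w * h + Yt (ou_point s t w z) w * k))
         (at (ou_point s t w z, w) within (\<lambda>w. (ou_point s t w z, w)) ` {t<..<T})"
        using t by (auto elim!: has_derivative_subset simp: split_beta)
      moreover have "((\<lambda>w. (ou_point s t w z, w)) has_derivative
         (\<lambda>h. ((d w * ou_point s t w z + sg\<^sup>2 / (2 * sqrt (ou_var t w)) * z) * h, h))) (at w within {t<..<T})"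
        using ou_point_deriv[OF t(1) w'(2,3), of s z]
        by (intro has_derivative_Pair has_derivative_ident) (simp add: has_field_derivative_def has_derivative_at_withinI)
      ultimately have "((\<lambda>(x, y). Y x y) \<circ> (\<lambda>w. (ou_point s t w z, w)) has_derivative
         (\<lambda>(h, k). Ys (ou_point s t w z) w * h + Yt (ou_point s t w z) w * k) \<circ>
         (\<lambda>h. ((d w * ou_point s t w z + sg\<^sup>2 / (2 * sqrt (ou_var t w)) * z) * h, h))) (at w within {t<..<T})"
        by (rule diff_chain_within[rotated])
      moreover have "(\<lambda>(h, k). Ys (ou_point s t w z) w * h + Yt (ou_point s t w z) w * k) \<circ>
         (\<lambda>h. ((d w * ou_point s t w z + sg\<^sup>2 / (2 * sqrt (ou_var t w)) * z) * h, h)) = (*) (D w z)"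
      proof -
        have "Ys (ou_point s t w z) w * (d w * ou_point s t w z + sg\<^sup>2 / (2 * sqrt (ou_var t w)) * z)
            + Yt (ou_point s t w z) w = D w z"
          unfolding D_def by (rule drift_cancels[OF pde[OF w'(1)]])
        from this[symmetric] show ?thesis
          by (simp only: fun_eq_iff o_def split_conv distrib_right mult.assoc simp_thms)
      qed
      moreover have "at w within {t<..<T} = at w" using w' by (intro at_within_open) auto
      ultimately show ?thesis by (simp add: has_field_derivative_def o_def)
    qed
    have u': "u \<in> {0..T}" using u t by auto
    have "(?\<phi> has_real_derivative (LINT z|lborel. std_normal_density z * D u z)) (at u)"
    proof (rule has_real_derivative_integral_dominated[where S="{t'<..<T}" and
          w="\<lambda>z. std_normal_density z * ((1/2 * sg\<^sup>2 * C + C) + sg\<^sup>2 / (2 * V0) * C * \<bar>z\<bar>)"])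
      show "integrable lborel (\<lambda>z. std_normal_density z * Y (ou_point s t x z) x)" if "x \<in> {t'<..<T}" for x
        using that t t' by (intro integrable_std_normal_bounded[where A=C and B=0] meas[OF contY]) (auto intro: bnd)
      show "((\<lambda>x. std_normal_density z * Y (ou_point s t x z) x) has_real_derivative std_normal_density z * D x z) (at x)"
        if "x \<in> {t'<..<T}" for x z
        by (intro DERIV_cmult derY that)
      show "(\<lambda>z. std_normal_density z * D u z) \<in> borel_measurable lborel"
        unfolding D_def using meas[OF contYss u'] meas[OF contPsi u'] meas[OF contYs u'] by measurable
      show "\<bar>std_normal_density z * D x z\<bar> \<le> std_normal_density z * ((1/2 * sg\<^sup>2 * C + C) + sg\<^sup>2 / (2 * V0) * C * \<bar>z\<bar>)"
        if x: "x \<in> {t'<..<T}" for x z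
      proof -
        have x': "x \<in> {0..T}" using x t t' by auto
        have q: "V0 \<le> sqrt (ou_var t x)" using V0(2)[of x] x by auto
        have A1: "\<bar>1/2 * sg\<^sup>2 * Yss (ou_point s t x z) x\<bar> \<le> 1/2 * sg\<^sup>2 * C"
          using bnd(3)[OF x'] by (auto simp: abs_mult intro!: mult_left_mono)
        have "\<bar>sg\<^sup>2 / (2 * sqrt (ou_var t x)) * (z * Ys (ou_point s t x z) x)\<bar>
           = sg\<^sup>2 / (2 * sqrt (ou_var t x)) * (\<bar>z\<bar> * \<bar>Ys (ou_point s t x z) x\<bar>)"
          using order.strict_trans2[OF V0(1) q] by (simp add: abs_mult abs_of_pos)
        also have "\<dots> \<le> sg\<^sup>2 / (2 * V0) * (\<bar>z\<bar> * C)"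
          using q V0(1) bnd(2)[OF x', of "ou_point s t x z"] C
          by (intro mult_mono divide_left_mono) (auto intro!: mult_pos_pos order.strict_trans2[OF V0(1) q])
        finally have A2: "\<bar>sg\<^sup>2 / (2 * sqrt (ou_var t x)) * (z * Ys (ou_point s t x z) x)\<bar> \<le> sg\<^sup>2 / (2 * V0) * C * \<bar>z\<bar>"
          by (simp add: mult.assoc mult.commute[of C])
        have "\<bar>D x z\<bar> \<le> (1/2 * sg\<^sup>2 * C + C) + sg\<^sup>2 / (2 * V0) * C * \<bar>z\<bar>"
          using A1 A2 bnd(4)[OF x', of "ou_point s t x z"] unfolding D_def by linarith
        then show ?thesis by (simp add: abs_mult mult_left_mono)
      qed
      show "integrable lborel (\<lambda>z. std_normal_density z * ((1/2 * sg\<^sup>2 * C + C) + sg\<^sup>2 / (2 * V0) * C * \<bar>z\<bar>))"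
      proof (rule integrable_std_normal_bounded)
        show "\<bar>(1/2 * sg\<^sup>2 * C + C) + sg\<^sup>2 / (2 * V0) * C * \<bar>z\<bar>\<bar> \<le> (1/2 * sg\<^sup>2 * C + C) + sg\<^sup>2 / (2 * V0) * C * \<bar>z\<bar>" for z
          using C V0(1) by simp
      qed simp
    qed (use u t' in auto)
    moreover have "(LINT z|lborel. std_normal_density z * D u z) = - (LINT z|lborel. std_normal_density z * Psi (ou_point s t u z) u)"
    proof -
      let ?q = "sqrt (ou_var t u)"
      have q: "0 < ?q" using ou_var_pos[of t u] u t by simp
      have i1: "integrable lborel (\<lambda>z. std_normal_density z * Yss (ou_point s t u z) u)"
        by (rule integrable_std_normal_bounded[where A=C and B=0]) (use meas[OF contYss u'] bnd(3)[OF u'] in auto)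
      have i2: "integrable lborel (\<lambda>z. std_normal_density z * Psi (ou_point s t u z) u)"
        by (rule integrable_std_normal_bounded[where A=C and B=0]) (use meas[OF contPsi u'] bnd(4)[OF u'] in auto)
      have i3: "integrable lborel (\<lambda>z. std_normal_density z * (z * Ys (ou_point s t u z) u))"
        by (rule integrable_std_normal_bounded[where A=0 and B=C])
           (use meas[OF contYs u'] bnd(2)[OF u'] in \<open>auto simp: abs_mult mult.commute[of C] intro: mult_left_mono\<close>)
      have dz: "((\<lambda>z. Ys (ou_point s t u z) u) has_real_derivative Yss (ou_point s t u z) u * ?q) (at z)" for z
      proof (rule DERIV_chain2[where f="\<lambda>x. Ys x u" and g="ou_point s t u", OF dss[OF u']])
        show "(ou_point s t u has_real_derivative ?q) (at z)"
          unfolding ou_point_def[abs_def] by (auto intro!: derivative_eq_intros)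
      qed
      have "(LINT z|lborel. std_normal_density z * (z * Ys (ou_point s t u z) u)) = (LINT z|lborel. std_normal_density z * (Yss (ou_point s t u z) u * ?q))"
      proof (rule gaussian_integration_by_parts[OF dz, where C="max C (C * ?q)"])
        show "continuous_on UNIV (\<lambda>z. Yss (ou_point s t u z) u * ?q)"
          by (intro continuous_intros slice[OF contYss u'])
        show "\<bar>Ys (ou_point s t u z) u\<bar> \<le> max C (C * ?q)" for z using bnd(2)[OF u', of "ou_point s t u z"] by auto
        show "\<bar>Yss (ou_point s t u z) u * ?q\<bar> \<le> max C (C * ?q)" for z
          using bnd(3)[OF u', of "ou_point s t u z"] q by (auto simp: abs_mult intro!: max.coboundedI2 mult_right_mono)
      qed
      also have "\<dots> = ?q * (LINT z|lborel. std_normal_density z * Yss (ou_point s t u z) u)"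
        by (subst integral_mult_right_zero[symmetric]) (simp add: ac_simps)
      finally have ibp: "(LINT z|lborel. std_normal_density z * (z * Ys (ou_point s t u z) u)) = \<dots>" .
      have "(LINT z|lborel. std_normal_density z * D u z)
        = (LINT z|lborel. - (1/2 * sg\<^sup>2) * (std_normal_density z * Yss (ou_point s t u z) u)
             - std_normal_density z * Psi (ou_point s t u z) u
             + sg\<^sup>2 / (2 * ?q) * (std_normal_density z * (z * Ys (ou_point s t u z) u)))"
        by (simp add: D_def algebra_simps)
      also have "\<dots> = - (1/2 * sg\<^sup>2) * (LINT z|lborel. std_normal_density z * Yss (ou_point s t u z) u)
            - (LINT z|lborel. std_normal_density z * Psi (ou_point s t u z) u)
            + sg\<^sup>2 / (2 * ?q) * (LINT z|lborel. std_normal_density z * (z * Ys (ou_point s t u z) u))"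
        using i1 i2 i3
        by (subst Bochner_Integration.integral_add Bochner_Integration.integral_diff integral_mult_right_zero;
             (intro Bochner_Integration.integrable_diff integrable_mult_right)?)+ auto
      also have "\<dots> = - (LINT z|lborel. std_normal_density z * Psi (ou_point s t u z) u)"
        unfolding ibp using q by simp
      finally show ?thesis .
    qed
    ultimately show ?thesis by simp
  qed
  have hi: "((\<lambda>u. - (LINT z|lborel. std_normal_density z * Psi (ou_point s t u z) u)) has_integral ?\<phi> T - ?\<phi> t) {t..T}"
  proof (rule fundamental_theorem_of_calculus_interior[OF t(2) cont_mean[OF contY bnd(1)]])
    show "(?\<phi> has_vector_derivative - (LINT z|lborel. std_normal_density z * Psi (ou_point s t u z) u)) (at u)"
      if "u \<in> {t<..<T}" for u
      using der[OF that] by (simp only: has_real_derivative_iff_has_vector_derivative)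
  qed
  have "?\<phi> T = 0" "?\<phi> t = Y s t" by (simp_all add: terminal ou_point_start)
  then have "((\<lambda>u. LINT z|lborel. std_normal_density z * Psi (ou_point s t u z) u) has_integral Y s t) {t..T}"
    using has_integral_neg[OF hi] by simp
  then show "Y s t = integral {t..T} (\<lambda>u. LINT z|lborel. std_normal_density z * Psi (ou_point s t u z) u)"
    by (simp add: integral_unique)
qed

end

section \<open>The linearized equation\<close>

text \<open>
  The equation \<open>v_t + sg^2/2 v_ss + s d v_s + a v + b exp (- l s^2 / 2) = 0\<close> with terminal value \<open>1\<close>.
\<close>
locale linear_problem = ou_process +
  fixes b L K :: real and a l :: "real \<Rightarrow> real"
  assumes b_pos: "0 < b"
    and cont_a: "continuous_on {0..T} a"
    and cont_l: "continuous_on {0..T} l"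
    and d_bounds: "\<And>t. t \<in> {0..T} \<Longrightarrow> - K \<le> d t \<and> d t \<le> 0"
    and a_nonneg: "\<And>t. t \<in> {0..T} \<Longrightarrow> 0 \<le> a t"
    and l_bounds: "\<And>t. t \<in> {0..T} \<Longrightarrow> 0 \<le> l t \<and> l t \<le> L"
    and short_time: "L * sg\<^sup>2 * T * exp (2 * K * T) < 1"
begin

definition pot_prim :: "real \<Rightarrow> real" where "pot_prim t = integral {0..t} a"

text \<open>
  This factor separates the variables: in terms of the mean and variance of the process,
  \<open>kern_den t u = 1 + l u * ou_var t u\<close> and
  \<open>kern_rate t u = l u * (ou_mean t u)^2 / kern_den t u\<close>, but in the form below \<open>t\<close> occurs only in
  \<open>clock t\<close> and \<open>drift_prim t\<close>, whose derivatives are known.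
\<close>
definition rho :: "real \<Rightarrow> real" where "rho u = l u * exp (2 * drift_prim u)"
definition kern_den :: "real \<Rightarrow> real \<Rightarrow> real" where "kern_den t u = 1 + rho u * sg\<^sup>2 * (clock u - clock t)"
definition kern_rate :: "real \<Rightarrow> real \<Rightarrow> real" where "kern_rate t u = rho u * exp (- 2 * drift_prim t) / kern_den t u"

text \<open>
  The solution at time \<open>t\<close> of the homogeneous equation that has the value \<open>b exp (- l u s^2 / 2)\<close> at
  time \<open>u\<close>.  Equivalently, \<open>b exp (pot_prim u - pot_prim t)\<close> times the mean of
  \<open>exp (- l u \<eta>^2 / 2)\<close>, where \<open>\<eta>\<close> is the value at time \<open>u\<close> of the process started at \<open>s\<close> at
  time \<open>t\<close>.
\<close>
definition kern :: "real \<Rightarrow> real \<Rightarrow> real \<Rightarrow> real" where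
  "kern s t u = b * exp (pot_prim u - pot_prim t) / sqrt (kern_den t u) * exp (- (kern_rate t u * s\<^sup>2 / 2))"

lemma pot_prim_deriv: "t \<in> {0..T} \<Longrightarrow> (pot_prim has_real_derivative a t) (at t within {0..T})"
  unfolding pot_prim_def by (rule integral_has_real_derivative[OF cont_a])

lemma cont_pot_prim: "continuous_on {0..T} pot_prim"
  using pot_prim_deriv by (rule DERIV_continuous_on)

lemma cont_rho: "continuous_on {0..T} rho"
  unfolding rho_def by (intro continuous_intros cont_l cont_drift_prim)

lemma drift_prim_mono:
  assumes "0 \<le> t" "t \<le> u" "u \<le> T"
  shows "drift_prim u \<le> drift_prim t" "drift_prim t - drift_prim u \<le> K * (u - t)"
  using increment_bounds[OF drift_prim_deriv d_bounds assms] by auto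

lemma pot_prim_mono:
  assumes "0 \<le> t" "t \<le> u" "u \<le> T"
  shows "pot_prim t \<le> pot_prim u"
proof -
  obtain B where "\<And>t. t \<in> {0..T} \<Longrightarrow> a t \<le> B"
    using continuous_attains_sup[OF compact_Icc _ cont_a] T_pos by fastforce
  then show ?thesis
    using increment_bounds(1)[OF pot_prim_deriv, of 0 B t u] a_nonneg assms by auto
qed

lemma K_nonneg: "0 \<le> K" using d_bounds[of 0] T_pos by auto

lemma L_nonneg: "0 \<le> L" using l_bounds[of 0] T_pos by auto

lemma rho_nonneg: "u \<in> {0..T} \<Longrightarrow> 0 \<le> rho u"
  using l_bounds by (auto simp: rho_def)

lemma kern_den_ge_1: "0 \<le> t \<Longrightarrow> t \<le> u \<Longrightarrow> u \<le> T \<Longrightarrow> 1 \<le> kern_den t u"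
  unfolding kern_den_def using rho_nonneg clock_mono by simp

text \<open>
  For \<open>t \<le> u\<close> positivity is immediate.  The extension to \<open>u < t\<close>, which makes \<open>kern\<close> smooth on the
  whole square of times and the Leibniz rule applicable, is where the short horizon is needed.
\<close>
lemma kern_den_pos:
  assumes t: "t \<in> {0..T}" and u: "u \<in> {0..T}"
  shows "0 < kern_den t u"
proof (cases "t \<le> u")
  case True then show ?thesis using kern_den_ge_1[of t u] t u by auto
next
  case False
  then have ut: "0 \<le> u" "u \<le> t" "t \<le> T" using t u by auto
  let ?E = "exp (2 * K * T - 2 * drift_prim u)"
  have hi: "exp (- 2 * drift_prim v) \<le> ?E" if v: "v \<in> {u..T}" for v
  proof -
    have "drift_prim u - drift_prim v \<le> K * (v - u)" using drift_prim_mono(2)[of u v] that ut by auto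
    also have "\<dots> \<le> K * T" using v ut K_nonneg by (intro mult_left_mono) auto
    finally show ?thesis by simp
  qed
  have "clock t - clock u = integral {u..t} (\<lambda>v. exp (- 2 * drift_prim v))"
    unfolding clock_def
    using Henstock_Kurzweil_Integration.integral_combine[OF ut(1,2), of "\<lambda>v. exp (- 2 * drift_prim v)"]
    by (simp add: integrable_continuous_real continuous_intros continuous_on_subset[OF cont_drift_prim] ut)
  also have "\<dots> \<le> integral {u..t} (\<lambda>v. ?E)"
    using ut by (intro integral_le integrable_continuous_real continuous_intros continuous_on_subset[OF cont_drift_prim] hi) auto
  also have "\<dots> = (t - u) * ?E" using ut by simp
  also have "\<dots> \<le> T * ?E" using ut by (intro mult_right_mono) auto
  finally have "rho u * sg\<^sup>2 * (clock t - clock u) \<le> rho u * sg\<^sup>2 * (T * ?E)"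
    using rho_nonneg[OF u] by (intro mult_left_mono) auto
  also have "\<dots> = l u * (sg\<^sup>2 * T * exp (2 * K * T))"
    by (simp add: rho_def exp_diff)
  also have "\<dots> \<le> L * (sg\<^sup>2 * T * exp (2 * K * T))"
    using l_bounds[OF u] T_pos by (intro mult_right_mono) auto
  also have "\<dots> < 1" using short_time by (simp add: mult.assoc)
  finally show ?thesis unfolding kern_den_def by (simp add: algebra_simps)
qed

lemma kern_rate_bounds:
  assumes "0 \<le> t" "t \<le> u" "u \<le> T"
  shows "0 \<le> kern_rate t u" "kern_rate t u \<le> L"
proof -
  have D: "1 \<le> kern_den t u" and r: "0 \<le> rho u" using kern_den_ge_1 rho_nonneg assms by auto
  show "0 \<le> kern_rate t u" unfolding kern_rate_def using D r by auto
  have "kern_rate t u \<le> rho u * exp (- 2 * drift_prim t) / 1"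
    unfolding kern_rate_def using D r by (intro divide_left_mono) auto
  also have "\<dots> = l u * exp (2 * (drift_prim u - drift_prim t))"
    by (simp add: rho_def exp_diff exp_minus divide_inverse right_diff_distrib)
  also have "\<dots> \<le> l u * 1"
    using l_bounds[of u] drift_prim_mono(1)[OF assms] assms by (intro mult_left_mono) auto
  also have "\<dots> \<le> L" using l_bounds[of u] assms by auto
  finally show "kern_rate t u \<le> L" .
qed

lemma kern_den_deriv:
  assumes "t \<in> {0..T}" "u \<in> {0..T}"
  shows "((\<lambda>t. kern_den t u) has_real_derivative - (sg\<^sup>2 * kern_rate t u * kern_den t u)) (at t within {0..T})"
  unfolding kern_den_def[of _ u, abs_def]
  by (rule derivative_eq_intros clock_deriv assms refl)+
     (use kern_den_pos[OF assms] in \<open>simp add: kern_rate_def kern_den_def\<close>)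

text \<open>
  A Riccati equation without constant term: it makes the coefficients of \<open>s^2\<close> cancel in the
  homogeneous equation for \<open>kern\<close>.
\<close>
lemma kern_rate_deriv:
  assumes "t \<in> {0..T}" "u \<in> {0..T}"
  shows "((\<lambda>t. kern_rate t u) has_real_derivative (sg\<^sup>2 * (kern_rate t u)\<^sup>2 - 2 * d t * kern_rate t u)) (at t within {0..T})"
  unfolding kern_rate_def[of _ u, abs_def]
  by (rule derivative_eq_intros drift_prim_deriv kern_den_deriv assms refl)+
     (use kern_den_pos[OF assms] in \<open>simp_all add: kern_rate_def field_simps power2_eq_square\<close>)

text \<open>
  The value forced by the homogeneous equation.
\<close>
definition kern_t :: "real \<Rightarrow> real \<Rightarrow> real \<Rightarrow> real" where
  "kern_t s t u = - (1/2 * sg\<^sup>2 * (((kern_rate t u)\<^sup>2 * s\<^sup>2 - kern_rate t u) * kern s t u)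
      + s * d t * (- (kern_rate t u * s) * kern s t u) + a t * kern s t u)"

text \<open>
  The exponent, the denominator and the rate contribute \<open>- a\<close>, \<open>sg^2/2\<close> times the rate, and a multiple
  of \<open>s^2\<close>; together they make up the homogeneous equation.
\<close>
lemma kern_deriv_t:
  assumes "t \<in> {0..T}" "u \<in> {0..T}"
  shows "((\<lambda>t. kern s t u) has_real_derivative kern_t s t u) (at t within {0..T})"
proof -
  have D: "0 < kern_den t u" using kern_den_pos[OF assms] .
  define q where "q = sqrt (kern_den t u)"
  have q: "0 < q" "kern_den t u = q * q" using D by (auto simp: q_def)
  have sq: "((\<lambda>t. sqrt (kern_den t u)) has_real_derivative - (sg\<^sup>2 * kern_rate t u * q / 2)) (at t within {0..T})"
    by (rule DERIV_cong[OF DERIV_chain2[OF DERIV_real_sqrt[OF D] kern_den_deriv[OF assms]]])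
       (use q in \<open>simp add: q_def[symmetric]\<close>)
  have h1: "((\<lambda>t. exp (pot_prim u - pot_prim t)) has_real_derivative exp (pot_prim u - pot_prim t) * (0 - a t)) (at t within {0..T})"
    by (intro DERIV_chain2[OF DERIV_exp] DERIV_diff DERIV_const pot_prim_deriv assms)
  have h2: "((\<lambda>t. exp (- (kern_rate t u * s\<^sup>2 / 2))) has_real_derivative
      exp (- (kern_rate t u * s\<^sup>2 / 2)) * - ((sg\<^sup>2 * (kern_rate t u)\<^sup>2 - 2 * d t * kern_rate t u) * s\<^sup>2 / 2)) (at t within {0..T})"
    by (intro DERIV_chain2[OF DERIV_exp] DERIV_minus DERIV_cdivide DERIV_cmult_right kern_rate_deriv assms)
  have "((\<lambda>t. b * exp (pot_prim u - pot_prim t) / sqrt (kern_den t u) * exp (- (kern_rate t u * s\<^sup>2 / 2)))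
     has_real_derivative
       b * exp (pot_prim u - pot_prim t) / q * exp (- (kern_rate t u * s\<^sup>2 / 2)) *
       (- a t + sg\<^sup>2 * kern_rate t u / 2 - (sg\<^sup>2 * (kern_rate t u)\<^sup>2 - 2 * d t * kern_rate t u) * s\<^sup>2 / 2)) (at t within {0..T})"
    using q(1) by (intro DERIV_cong[OF DERIV_mult[OF DERIV_divide[OF DERIV_cmult[OF h1] sq] h2]])
      (simp_all add: q_def[symmetric] field_simps)
  then show ?thesis
    unfolding q_def kern_def[symmetric]
    by (rule DERIV_cong) (simp add: kern_t_def field_simps power2_eq_square)
qed

definition kern_s :: "real \<Rightarrow> real \<Rightarrow> real \<Rightarrow> real" where
  "kern_s s t u = - (kern_rate t u * s) * kern s t u"
definition kern_ss :: "real \<Rightarrow> real \<Rightarrow> real \<Rightarrow> real" where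
  "kern_ss s t u = ((kern_rate t u)\<^sup>2 * s\<^sup>2 - kern_rate t u) * kern s t u"

lemma kern_deriv_s:
  "((\<lambda>s. kern s t u) has_real_derivative kern_s s t u) (at s)"
proof -
  have "((\<lambda>s. C * exp (- (\<beta> * s\<^sup>2 / 2))) has_real_derivative - (\<beta> * s) * (C * exp (- (\<beta> * s\<^sup>2 / 2)))) (at s)"
    for C \<beta> :: real
    by (auto intro!: derivative_eq_intros)
  then show ?thesis unfolding kern_s_def kern_def .
qed

lemma kern_deriv_ss:
  "((\<lambda>s. kern_s s t u) has_real_derivative kern_ss s t u) (at s)"
  unfolding kern_s_def[of _ t u, abs_def]
  by (auto intro!: derivative_eq_intros kern_deriv_s simp: kern_s_def kern_ss_def algebra_simps power2_eq_square)

lemma kern_pos: "t \<in> {0..T} \<Longrightarrow> u \<in> {0..T} \<Longrightarrow> 0 < kern s t u"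
  using kern_den_pos b_pos by (simp add: kern_def)

lemma kern_diag: "t \<in> {0..T} \<Longrightarrow> kern s t t = b * exp (- (l t * s\<^sup>2 / 2))"
  by (simp add: kern_def kern_rate_def kern_den_def rho_def exp_minus)

lemma cont_kern_rate: "continuous_on ({0..T} \<times> {0..T}) (\<lambda>(t, u). kern_rate t u)"
proof -
  have "continuous_on ({0..T} \<times> {0..T}) (\<lambda>z. rho (snd z) * exp (- 2 * drift_prim (fst z)) /
      (1 + rho (snd z) * sg\<^sup>2 * (clock (snd z) - clock (fst z))))"
    by (intro continuous_intros continuous_on_compose2[OF cont_rho] continuous_on_compose2[OF cont_drift_prim]
        continuous_on_compose2[OF cont_clock])
       (use kern_den_pos in \<open>force simp: kern_den_def\<close>)+
  then show ?thesis by (simp add: kern_rate_def kern_den_def split_beta)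
qed

lemma cont_kern:
  "continuous_on (UNIV \<times> {0..T} \<times> {0..T}) (\<lambda>(s, t, u). kern s t u)"
proof -
  have "continuous_on (UNIV \<times> {0..T} \<times> {0..T})
     (\<lambda>z. b * exp (pot_prim (snd (snd z)) - pot_prim (fst (snd z))) /
       sqrt (1 + rho (snd (snd z)) * sg\<^sup>2 * (clock (snd (snd z)) - clock (fst (snd z)))) *
       exp (- ((\<lambda>(t, u). kern_rate t u) (snd z) * (fst z)\<^sup>2 / 2)))"
    by (intro continuous_intros continuous_on_compose2[OF cont_rho] continuous_on_compose2[OF cont_pot_prim]
        continuous_on_compose2[OF cont_clock] continuous_on_compose2[OF cont_kern_rate])
       (use kern_den_pos in \<open>force simp: kern_den_def\<close>)+
  then show ?thesis by (simp add: kern_def kern_den_def split_beta)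
qed

lemma cont_kern_s: "continuous_on (UNIV \<times> {0..T} \<times> {0..T}) (\<lambda>(s, t, u). kern_s s t u)"
  unfolding kern_s_def split_beta
  using cont_kern cont_kern_rate by (auto simp: split_beta intro!: continuous_intros
     continuous_on_compose2[OF cont_kern_rate, of _ snd, simplified split_beta])

lemma cont_kern_ss: "continuous_on (UNIV \<times> {0..T} \<times> {0..T}) (\<lambda>(s, t, u). kern_ss s t u)"
  unfolding kern_ss_def split_beta
  using cont_kern cont_kern_rate by (auto simp: split_beta intro!: continuous_intros
     continuous_on_compose2[OF cont_kern_rate, of _ snd, simplified split_beta])

lemma kern_t_eq:
  "kern_t s t u = - (1/2 * sg\<^sup>2 * kern_ss s t u + s * d t * kern_s s t u + a t * kern s t u)"
  by (simp add: kern_t_def kern_s_def kern_ss_def)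

text \<open>
  Duhamel's formula.
\<close>
definition v :: "real \<Rightarrow> real \<Rightarrow> real" where
  "v s t = exp (pot_prim T - pot_prim t) + integral {t..T} (kern s t)"
definition v_s :: "real \<Rightarrow> real \<Rightarrow> real" where
  "v_s s t = integral {t..T} (kern_s s t)"
definition v_ss :: "real \<Rightarrow> real \<Rightarrow> real" where
  "v_ss s t = integral {t..T} (kern_ss s t)"

text \<open>
  The value forced by the equation; it is the time derivative by \<open>v_deriv_t\<close>.
\<close>
definition v_t :: "real \<Rightarrow> real \<Rightarrow> real" where
  "v_t s t = - (1/2 * sg\<^sup>2 * v_ss s t + s * d t * v_s s t + a t * v s t + b * exp (- (l t * s\<^sup>2 / 2)))"

lemma cont_slice:
  assumes "continuous_on (UNIV \<times> {0..T} \<times> {0..T}) (\<lambda>(s, t, u). f s t u)" "t \<in> {0..T}"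
  shows "continuous_on {t..T} (f s t)"
  using assms(2) by (intro continuous_on_compose2[OF assms(1), of _ "\<lambda>u. (s, t, u)", simplified] continuous_intros) auto

lemma cont_moving:
  fixes f :: "real \<Rightarrow> real \<Rightarrow> real \<Rightarrow> real"
  assumes f: "continuous_on (UNIV \<times> {0..T} \<times> {0..T}) (\<lambda>(s, t, u). f s t u)"
  shows "continuous_on (UNIV \<times> {0..T}) (\<lambda>(s, t). integral {t..T} (f s t))"
  unfolding split_beta
  by (rule continuous_on_integral_lower_limit[where a=0 and f="\<lambda>z. f (fst z) (snd z)" and c=snd])
     (auto simp: split_beta intro!: continuous_intros
       continuous_on_compose2[OF f, of _ "\<lambda>z. (fst (fst z), snd (fst z), snd z)", simplified])

lemma cont_v_s: "continuous_on (UNIV \<times> {0..T}) (\<lambda>(s, t). v_s s t)"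
  unfolding v_s_def by (rule cont_moving[OF cont_kern_s])

lemma cont_v_ss: "continuous_on (UNIV \<times> {0..T}) (\<lambda>(s, t). v_ss s t)"
  unfolding v_ss_def by (rule cont_moving[OF cont_kern_ss])

lemma cont_v: "continuous_on (UNIV \<times> {0..T}) (\<lambda>(s, t). v s t)"
  unfolding v_def using cont_moving[OF cont_kern]
  by (auto simp: split_beta intro!: continuous_intros continuous_on_compose2[OF cont_pot_prim])

lemma cont_v_t: "continuous_on (UNIV \<times> {0..T}) (\<lambda>(s, t). v_t s t)"
  unfolding v_t_def using cont_v cont_v_s cont_v_ss
  by (auto simp: split_beta intro!: continuous_intros continuous_on_compose2[OF cont_d]
     continuous_on_compose2[OF cont_a] continuous_on_compose2[OF cont_l])

lemma deriv_s_integral: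
  assumes t: "t \<in> {0..T}"
    and f: "continuous_on (UNIV \<times> {0..T} \<times> {0..T}) (\<lambda>(s, t, u). f s t u)"
    and f': "continuous_on (UNIV \<times> {0..T} \<times> {0..T}) (\<lambda>(s, t, u). f' s t u)"
    and der: "\<And>s u. u \<in> {0..T} \<Longrightarrow> ((\<lambda>s. f s t u) has_real_derivative f' s t u) (at s)"
  shows "((\<lambda>s. integral {t..T} (f s t)) has_real_derivative integral {t..T} (f' s t)) (at s)"
proof -
  have "((\<lambda>s. integral (cbox t T) (f s t)) has_field_derivative integral (cbox t T) (f' s t)) (at s within UNIV)"
  proof (rule leibniz_rule_field_derivative)
    show "f x t integrable_on cbox t T" for x
      using cont_slice[OF f t] by (auto intro: integrable_continuous_real)
    show "continuous_on (UNIV \<times> cbox t T) (\<lambda>(x, u). f' x t u)"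
      using t by (auto simp: split_beta intro!: continuous_intros
        continuous_on_compose2[OF f', of _ "\<lambda>z. (fst z, t, snd z)", simplified])
  qed (use t der in auto)
  then show ?thesis by simp
qed

lemma v_deriv_s: "t \<in> {0..T} \<Longrightarrow> ((\<lambda>s. v s t) has_real_derivative v_s s t) (at s)"
  unfolding v_def v_s_def
  using DERIV_add[OF DERIV_const deriv_s_integral[OF _ cont_kern cont_kern_s kern_deriv_s]] by simp

lemma v_deriv_ss: "t \<in> {0..T} \<Longrightarrow> ((\<lambda>s. v_s s t) has_real_derivative v_ss s t) (at s)"
  unfolding v_s_def v_ss_def
  by (rule deriv_s_integral[OF _ cont_kern_s cont_kern_ss kern_deriv_ss])

text \<open>
  The derivative of the lower limit contributes \<open>- kern s t t\<close>, which is the source term.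
\<close>
lemma v_deriv_t:
  assumes t: "t \<in> {0..T}"
  shows "((\<lambda>t. v s t) has_real_derivative v_t s t) (at t within {0..T})"
proof -
  have 1: "((\<lambda>t. integral {t..T} (kern s t)) has_real_derivative
       (integral {t..T} (kern_t s t) - kern s t t)) (at t within {0..T})"
  proof (rule leibniz_rule_lower_limit[OF _ kern_deriv_t _ t])
    show "continuous_on ({0..T} \<times> {0..T}) (\<lambda>(t, u). kern s t u)"
      by (auto simp: split_beta intro!: continuous_intros
        continuous_on_compose2[OF cont_kern, of _ "\<lambda>z. (s, fst z, snd z)", simplified])
    have "continuous_on ({0..T} \<times> {0..T}) (\<lambda>z. kern_s s (fst z) (snd z))"
         "continuous_on ({0..T} \<times> {0..T}) (\<lambda>z. kern_ss s (fst z) (snd z))"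
         "continuous_on ({0..T} \<times> {0..T}) (\<lambda>z. kern s (fst z) (snd z))"
      by (auto simp: split_beta intro!: continuous_intros
        continuous_on_compose2[OF cont_kern, of _ "\<lambda>z. (s, fst z, snd z)", simplified]
        continuous_on_compose2[OF cont_kern_s, of _ "\<lambda>z. (s, fst z, snd z)", simplified]
        continuous_on_compose2[OF cont_kern_ss, of _ "\<lambda>z. (s, fst z, snd z)", simplified])
    then show "continuous_on ({0..T} \<times> {0..T}) (\<lambda>(t, u). kern_t s t u)"
      unfolding kern_t_eq split_beta
      by (intro continuous_intros continuous_on_compose2[OF cont_d] continuous_on_compose2[OF cont_a]) auto
  qed auto
  have i: "kern s t integrable_on {t..T}" "kern_s s t integrable_on {t..T}" "kern_ss s t integrable_on {t..T}"
    using cont_slice[OF _ t] cont_kern cont_kern_s cont_kern_ss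
    by (auto intro!: integrable_continuous_real)
  have "(kern_t s t has_integral - (1/2 * sg\<^sup>2 * v_ss s t + s * d t * v_s s t + a t * integral {t..T} (kern s t))) {t..T}"
    unfolding kern_t_eq[of s t, abs_def] v_ss_def v_s_def
    by (intro has_integral_neg has_integral_add has_integral_mult_right integrable_integral i)
  then have "integral {t..T} (kern_t s t) = - (1/2 * sg\<^sup>2 * v_ss s t + s * d t * v_s s t + a t * integral {t..T} (kern s t))"
    by (rule integral_unique)
  moreover have "((\<lambda>t. exp (pot_prim T - pot_prim t)) has_real_derivative - a t * exp (pot_prim T - pot_prim t)) (at t within {0..T})"
    using t by (auto intro!: derivative_eq_intros pot_prim_deriv)
  ultimately show ?thesis
    unfolding v_def using t
    by (intro DERIV_cong[OF DERIV_add[OF _ 1]]) (auto simp: v_t_def v_def kern_diag algebra_simps)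
qed

lemma v_terminal: "v s T = 1"
  by (simp add: v_def)

lemma kern_le:
  assumes "0 \<le> t" "t \<le> u" "u \<le> T"
  shows "kern s t u \<le> exp (pot_prim T - pot_prim t) * b * exp (- (kern_rate t u * s\<^sup>2 / 2))"
proof -
  have D: "1 \<le> sqrt (kern_den t u)" using kern_den_ge_1[OF assms] by simp
  have "b * exp (pot_prim u - pot_prim t) / sqrt (kern_den t u) \<le> b * exp (pot_prim u - pot_prim t) / 1"
    using D b_pos by (intro divide_left_mono) auto
  also have "\<dots> \<le> b * exp (pot_prim T - pot_prim t)"
    using pot_prim_mono[of u T] assms b_pos by auto
  finally have "b * exp (pot_prim u - pot_prim t) / sqrt (kern_den t u) \<le> exp (pot_prim T - pot_prim t) * b" by (simp add: mult.commute)
  then show ?thesis unfolding kern_def by (rule mult_right_mono) simp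
qed

lemma kern_int_nonneg: "t \<in> {0..T} \<Longrightarrow> 0 \<le> integral {t..T} (kern s t)"
  by (intro integral_nonneg integrable_continuous_real cont_slice[OF cont_kern])
     (auto intro!: less_imp_le[OF kern_pos])

lemma v_ge_exp: "t \<in> {0..T} \<Longrightarrow> exp (pot_prim T - pot_prim t) \<le> v s t"
  using kern_int_nonneg by (simp add: v_def)

lemma v_ge_1: "t \<in> {0..T} \<Longrightarrow> 1 \<le> v s t"
  using v_ge_exp[of t s] pot_prim_mono[of t T] by (smt (verit) atLeastAtMost_iff one_le_exp_iff)

lemma v_le:
  assumes t: "t \<in> {0..T}"
  shows "v s t \<le> exp (pot_prim T - pot_prim t) * (1 + b * T)"
proof -
  let ?A = "exp (pot_prim T - pot_prim t)"
  have "integral {t..T} (kern s t) \<le> integral {t..T} (\<lambda>u. ?A * b)"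
  proof (intro integral_le integrable_continuous_real cont_slice[OF cont_kern t] continuous_intros)
    fix u assume u: "u \<in> {t..T}"
    have "kern s t u \<le> ?A * b * exp (- (kern_rate t u * s\<^sup>2 / 2))" using kern_le[of t u] t u by auto
    also have "\<dots> \<le> ?A * b * 1"
      using b_pos kern_rate_bounds[of t u] t u by (intro mult_left_mono) auto
    finally show "kern s t u \<le> ?A * b" by simp
  qed
  also have "\<dots> = ?A * b * (T - t)" using t by simp
  also have "\<dots> \<le> ?A * b * T" using t b_pos by (intro mult_left_mono) auto
  finally show ?thesis unfolding v_def by (simp add: algebra_simps)
qed

lemma square_exp_le: "0 \<le> y \<Longrightarrow> y * exp (- (y / 2)) \<le> (2::real)"
proof -
  assume "0 \<le> y"
  have "y / 2 \<le> exp (y / 2)" using exp_ge_add_one_self[of "y / 2"] by linarith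
  then show ?thesis by (simp add: exp_minus field_simps)
qed

lemma abs_integral_le:
  fixes f h :: "real \<Rightarrow> real"
  assumes "continuous_on {t..T} f" "continuous_on {t..T} h" "\<And>u. u \<in> {t..T} \<Longrightarrow> \<bar>f u\<bar> \<le> h u"
  shows "\<bar>integral {t..T} f\<bar> \<le> integral {t..T} h"
  using integral_norm_bound_integral[of f "{t..T}" h] assms integrable_continuous_real by auto

text \<open>
  With \<open>x = sqrt (kern_rate t u) \<bar>s\<bar>\<close> the integrand is at most \<open>sqrt L * x * kern\<close>.  Since
  \<open>x \<le> x^2 / (4 c) + c\<close> and \<open>x^2 exp (- x^2 / 2) \<le> 2\<close>, the integral is at most \<open>c\<close> times
  \<open>exp (pot_prim T - pot_prim t)\<close> plus \<open>c\<close> times the integral of \<open>kern\<close> for \<open>c = sqrt (b T / 2)\<close>, and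
  the sum is \<open>c * v\<close>.  This bound grows like the square root of \<open>b\<close>, as \<open>B1_bound\<close> does; bounding
  the numerator alone would give linear growth.
\<close>
lemma v_s_bound:
  assumes t: "t \<in> {0..T}"
  shows "\<bar>v_s s t\<bar> \<le> sqrt L * sqrt (b * T / 2) * v s t"
proof -
  let ?A = "exp (pot_prim T - pot_prim t)"
  \<comment> \<open>this value balances the two terms of the arithmetic-geometric mean inequality below\<close>
  define c where "c = sqrt (b * T / 2)"
  have c: "0 < c" "c * c = b * T / 2" using b_pos T_pos by (auto simp: c_def)
  have pw: "\<bar>kern_s s t u\<bar> \<le> sqrt L * (?A * b / (2 * c) + c * kern s t u)" if u: "u \<in> {t..T}" for u
  proof -
    have tu: "0 \<le> t" "t \<le> u" "u \<le> T" using t u by auto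
    define x where "x = sqrt (kern_rate t u) * \<bar>s\<bar>"
    have kern_rate: "0 \<le> kern_rate t u" "kern_rate t u \<le> L" using kern_rate_bounds[OF tu] .
    have x: "0 \<le> x" "x * x = kern_rate t u * s\<^sup>2"
      using kern_rate by (auto simp: x_def power2_eq_square) (metis abs_mult_self_eq mult.assoc mult.left_commute real_sqrt_mult_self abs_of_nonneg)
    have k: "0 < kern s t u" using kern_pos tu t by auto
    have "x * x * kern s t u \<le> x * x * (?A * b * exp (- (x * x / 2)))"
      using kern_le[OF tu, of s] x(1) unfolding x(2) by (intro mult_left_mono) (auto simp: kern_rate)
    also have "\<dots> = ?A * b * (x * x * exp (- (x * x / 2)))" by simp
    also have "\<dots> \<le> ?A * b * 2"
      using square_exp_le[of "x * x"] b_pos by (intro mult_left_mono) auto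
    finally have 1: "x * x * kern s t u \<le> 2 * ?A * b" by simp
    have "0 \<le> (x / (2 * c) - 1)\<^sup>2" by simp
    then have "x \<le> x * x / (4 * c) + c" using c(1) by (simp add: field_simps power2_eq_square)
    then have "x * kern s t u \<le> (x * x / (4 * c) + c) * kern s t u"
      using k by (intro mult_right_mono) auto
    also have "\<dots> = (x * x * kern s t u) / (4 * c) + c * kern s t u" by (simp add: field_simps)
    also have "\<dots> \<le> (2 * ?A * b) / (4 * c) + c * kern s t u"
      using 1 c by (intro add_right_mono divide_right_mono) auto
    finally have 2: "x * kern s t u \<le> ?A * b / (2 * c) + c * kern s t u" by (simp add: mult.commute)
    have "\<bar>kern_s s t u\<bar> = sqrt (kern_rate t u) * (x * kern s t u)"
      using kern_rate k by (simp add: kern_s_def abs_mult x_def)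
    also have "\<dots> \<le> sqrt L * (x * kern s t u)"
      using kern_rate x k by (intro mult_right_mono) auto
    also have "\<dots> \<le> sqrt L * (?A * b / (2 * c) + c * kern s t u)"
      using 2 L_nonneg by (intro mult_left_mono) auto
    finally show ?thesis .
  qed
  have "\<bar>v_s s t\<bar> \<le> integral {t..T} (\<lambda>u. sqrt L * (?A * b / (2 * c) + c * kern s t u))"
    unfolding v_s_def
    by (intro abs_integral_le pw continuous_intros cont_slice[OF cont_kern t] cont_slice[OF cont_kern_s t])
  also have "\<dots> = sqrt L * (?A * b / (2 * c) * (T - t) + c * integral {t..T} (kern s t))"
  proof (rule integral_unique)
    have "((\<lambda>u. ?A * b / (2 * c)) has_integral ?A * b / (2 * c) * (T - t)) {t..T}"
      using has_integral_const_real[of "?A * b / (2 * c)" t T] t by (simp add: mult.commute)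
    then show "((\<lambda>u. sqrt L * (?A * b / (2 * c) + c * kern s t u)) has_integral
       sqrt L * (?A * b / (2 * c) * (T - t) + c * integral {t..T} (kern s t))) {t..T}"
      by (intro has_integral_mult_right has_integral_add integrable_integral
          integrable_continuous_real cont_slice[OF cont_kern t])
  qed
  also have "\<dots> \<le> sqrt L * (?A * b / (2 * c) * T + c * integral {t..T} (kern s t))"
    using t L_nonneg c b_pos by (intro mult_left_mono add_right_mono) auto
  also have "?A * b / (2 * c) * T = c * ?A"
    using c by (simp add: field_simps)
  finally show ?thesis by (simp add: v_def c_def algebra_simps)
qed

lemma v_ss_bound:
  assumes t: "t \<in> {0..T}"
  shows "\<bar>v_ss s t\<bar> \<le> 3 * L * b * T * v s t"
proof -
  let ?A = "exp (pot_prim T - pot_prim t)"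
  have pw: "\<bar>kern_ss s t u\<bar> \<le> 3 * L * b * ?A" if u: "u \<in> {t..T}" for u
  proof -
    have tu: "0 \<le> t" "t \<le> u" "u \<le> T" using t u by auto
    define y where "y = kern_rate t u * s\<^sup>2"
    have kern_rate: "0 \<le> kern_rate t u" "kern_rate t u \<le> L" using kern_rate_bounds[OF tu] .
    have y: "0 \<le> y" using kern_rate by (simp add: y_def)
    have k: "0 < kern s t u" using kern_pos tu t by auto
    have "kern_ss s t u = kern_rate t u * ((y - 1) * kern s t u)"
      by (simp add: kern_ss_def y_def power2_eq_square algebra_simps)
    then have "\<bar>kern_ss s t u\<bar> = kern_rate t u * (\<bar>y - 1\<bar> * kern s t u)"
      using kern_rate k by (simp add: abs_mult)
    also have "\<dots> \<le> L * ((y + 1) * (?A * b * exp (- (y / 2))))"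
      using kern_rate k y kern_le[OF tu, of s] by (intro mult_mono) (auto simp: y_def[symmetric])
    also have "\<dots> = L * (?A * b * (y * exp (- (y / 2)) + exp (- (y / 2))))" by (simp add: algebra_simps)
    also have "\<dots> \<le> L * (?A * b * (2 + 1))"
      using square_exp_le[OF y] y b_pos L_nonneg by (intro mult_left_mono add_mono) auto
    finally show ?thesis by (simp add: algebra_simps)
  qed
  have "\<bar>v_ss s t\<bar> \<le> integral {t..T} (\<lambda>u. 3 * L * b * ?A)"
    unfolding v_ss_def by (intro abs_integral_le pw continuous_intros cont_slice[OF cont_kern_ss t])
  also have "\<dots> = 3 * L * b * ?A * (T - t)" using t by simp
  also have "\<dots> \<le> 3 * L * b * ?A * T"
    using t b_pos L_nonneg by (intro mult_left_mono) auto
  also have "\<dots> = 3 * L * b * T * ?A" by simp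
  also have "\<dots> \<le> 3 * L * b * T * v s t"
    using v_ge_exp[OF t] b_pos L_nonneg T_pos by (intro mult_left_mono) auto
  finally show ?thesis .
qed

end

section \<open>The function g and the smallness of the horizon\<close>

locale spread_model =
  fixes p :: spread_params
  assumes gamma_pos: "0 < \<gamma> p" and gamma_lt_1: "\<gamma> p < 1"
    and kappa_pos: "0 < \<kappa> p" and sigma_pos: "0 < \<sigma> p" and varpi_pos: "0 < varpi p"
    and rate_nonneg: "0 \<le> rate p" and rate_le: "rate p \<le> \<kappa> p"
    and horizon_pos: "0 < horizon p" and horizon_lt: "horizon p < T0_bound p"
begin

lemma kappa1_bounds: "\<kappa> p \<le> \<kappa>\<^sub>1 p" "\<kappa>\<^sub>1 p \<le> 2 * \<kappa> p" "0 < \<kappa>\<^sub>1 p"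
  using rate_nonneg rate_le kappa_pos by (auto simp: \<kappa>\<^sub>1_def)

lemma gamma1_pos: "0 < \<gamma>\<^sub>1 p"
  using sigma_pos gamma_lt_1 by (simp add: \<gamma>\<^sub>1_def)

lemma gamma2_pos: "0 < \<gamma>\<^sub>2 p"
  using kappa_pos kappa1_bounds gamma_pos gamma_lt_1 by (simp add: \<gamma>\<^sub>2_def add_pos_pos)

lemma gamma3_pos: "0 < \<gamma>\<^sub>3 p"
  using sigma_pos kappa1_bounds gamma_pos gamma_lt_1 by (simp add: \<gamma>\<^sub>3_def)

text \<open>
  With \<open>\<kappa>_1 \<le> 2 \<kappa>\<close> the claim reduces to \<open>\<gamma> < ((1 + \<gamma>) / 2)^2\<close>.
\<close>
lemma discriminant_pos: "\<gamma>check\<^sub>3 p < (\<gamma>check\<^sub>2 p)\<^sup>2"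
proof -
  let ?k = "\<kappa>\<^sub>1 p" and ?c = "\<gamma> p"
  have "?c * ?k + (1 - ?c) * \<kappa> p \<ge> ?k * (1 + ?c) / 2"
    using mult_left_mono[of ?k "2 * \<kappa> p" "(1 - ?c) / 2"] kappa1_bounds gamma_lt_1 by (simp add: field_simps)
  moreover have "0 \<le> ?k * (1 + ?c) / 2" using kappa1_bounds gamma_pos by simp
  ultimately have "(?k * (1 + ?c) / 2)\<^sup>2 \<le> (?c * ?k + (1 - ?c) * \<kappa> p)\<^sup>2" by (rule power_mono)
  moreover have "(?k * (1 + ?c) / 2)\<^sup>2 - ?c * ?k\<^sup>2 = (?k * (1 - ?c) / 2)\<^sup>2"
    by (simp add: field_simps power2_eq_square)
  moreover have "0 < (?k * (1 - ?c) / 2)\<^sup>2" using kappa1_bounds gamma_lt_1 by simp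
  ultimately have key: "?c * ?k\<^sup>2 < (?c * ?k + (1 - ?c) * \<kappa> p)\<^sup>2" by linarith
  have "\<gamma>\<^sub>1 p * \<gamma>\<^sub>3 p = ?c * ?k\<^sup>2 / (1 - ?c)\<^sup>2"
    using sigma_pos gamma_lt_1 by (simp add: \<gamma>\<^sub>1_def \<gamma>\<^sub>3_def power2_eq_square)
  also have "\<dots> < (?c * ?k + (1 - ?c) * \<kappa> p)\<^sup>2 / (1 - ?c)\<^sup>2"
    using key gamma_lt_1 by (intro divide_strict_right_mono) auto
  also have "\<dots> = ((?c * ?k + (1 - ?c) * \<kappa> p) / (1 - ?c))\<^sup>2" by (simp add: power_divide)
  also have "(?c * ?k + (1 - ?c) * \<kappa> p) / (1 - ?c) = \<gamma>\<^sub>2 p"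
    using gamma_lt_1 by (simp add: \<gamma>\<^sub>2_def add_divide_distrib)
  finally have "\<gamma>\<^sub>1 p * \<gamma>\<^sub>3 p / (\<gamma>\<^sub>1 p)\<^sup>2 < (\<gamma>\<^sub>2 p)\<^sup>2 / (\<gamma>\<^sub>1 p)\<^sup>2"
    using gamma1_pos by (intro divide_strict_right_mono) auto
  then show ?thesis
    using gamma1_pos by (simp add: \<gamma>check\<^sub>2_def \<gamma>check\<^sub>3_def power_divide power2_eq_square)
qed

lemma theta_pos: "0 < \<theta>par p"
  using discriminant_pos by (simp add: \<theta>par_def)

lemma theta_square: "(\<theta>par p)\<^sup>2 = (\<gamma>check\<^sub>2 p)\<^sup>2 - \<gamma>check\<^sub>3 p"
  using discriminant_pos by (simp add: \<theta>par_def)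

lemma theta_lt: "\<theta>par p < \<gamma>check\<^sub>2 p"
proof (rule power_less_imp_less_base[where n=2])
  show "(\<theta>par p)\<^sup>2 < (\<gamma>check\<^sub>2 p)\<^sup>2"
    using theta_square gamma1_pos gamma3_pos by (simp add: \<gamma>check\<^sub>3_def)
  show "0 \<le> \<gamma>check\<^sub>2 p" using gamma1_pos gamma2_pos by (simp add: \<gamma>check\<^sub>2_def)
qed

definition gden :: "real \<Rightarrow> real" where
  "gden t = exp (\<omega>par p * (horizon p - t)) * (\<gamma>check\<^sub>2 p + \<theta>par p) - \<gamma>check\<^sub>2 p + \<theta>par p"

lemma omega_pos: "0 < \<omega>par p"
  using theta_pos gamma1_pos by (simp add: \<omega>par_def)

lemma gden_ge:
  assumes "t \<le> horizon p"
  shows "2 * \<theta>par p \<le> gden t"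
proof -
  have "1 * (\<gamma>check\<^sub>2 p + \<theta>par p) \<le> exp (\<omega>par p * (horizon p - t)) * (\<gamma>check\<^sub>2 p + \<theta>par p)"
    using assms omega_pos theta_pos theta_lt by (intro mult_right_mono) auto
  then show ?thesis by (simp add: gden_def)
qed

lemma g_eq: "g_fn p t = (\<gamma>check\<^sub>2 p - \<theta>par p) * (1 - 2 * \<theta>par p / gden t)"
  by (simp add: g_fn_def gden_def algebra_simps)

lemma g_terminal: "g_fn p (horizon p) = 0"
  using theta_pos by (simp add: g_eq gden_def)

lemma g_bounds:
  assumes "t \<in> {0..horizon p}"
  shows "0 \<le> g_fn p t" "g_fn p t \<le> g_fn p 0" "g_fn p t \<le> \<gamma>check\<^sub>2 p - \<theta>par p"
proof -
  have D: "2 * \<theta>par p \<le> gden t" "0 < gden t" using gden_ge[of t] assms theta_pos by auto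
  have "gden t \<le> gden 0"
    unfolding gden_def using assms omega_pos theta_pos theta_lt
    by (auto intro!: mult_right_mono mult_left_mono)
  then have "2 * \<theta>par p / gden 0 \<le> 2 * \<theta>par p / gden t"
    using D theta_pos by (intro divide_left_mono) auto
  then show "g_fn p t \<le> g_fn p 0"
    unfolding g_eq using theta_lt by (intro mult_left_mono) auto
  show "0 \<le> g_fn p t"
    unfolding g_eq using theta_lt D by (intro mult_nonneg_nonneg) (auto simp: field_simps)
  have "(\<gamma>check\<^sub>2 p - \<theta>par p) * (1 - 2 * \<theta>par p / gden t) \<le> (\<gamma>check\<^sub>2 p - \<theta>par p) * 1"
    using theta_lt theta_pos D by (intro mult_left_mono) auto
  then show "g_fn p t \<le> \<gamma>check\<^sub>2 p - \<theta>par p" by (simp add: g_eq)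
qed

lemma g0_pos: "0 < g_fn p 0"
proof -
  have "1 * (\<gamma>check\<^sub>2 p + \<theta>par p) < exp (\<omega>par p * (horizon p - 0)) * (\<gamma>check\<^sub>2 p + \<theta>par p)"
    using omega_pos theta_pos theta_lt horizon_pos by (intro mult_strict_right_mono) auto
  then have "2 * \<theta>par p < gden 0" by (simp add: gden_def)
  then show ?thesis
    unfolding g_eq using theta_lt theta_pos by (intro mult_pos_pos) (auto simp: field_simps)
qed

definition g_deriv :: "real \<Rightarrow> real" where
  "g_deriv t = 2 * \<gamma>\<^sub>2 p * g_fn p t - \<gamma>\<^sub>1 p * (g_fn p t)\<^sup>2 - \<gamma>\<^sub>3 p"

text \<open>
  In terms of \<open>gden\<close> both sides are rational functions, because the exponential in \<open>gden\<close> is itself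
  an affine function of \<open>gden\<close>.
\<close>
lemma g_riccati:
  assumes t: "t \<le> horizon p"
  shows "(g_fn p has_real_derivative g_deriv t) (at t)"
proof -
  define A \<theta> c1 D where "A = \<gamma>check\<^sub>2 p" and "\<theta> = \<theta>par p" and "c1 = \<gamma>\<^sub>1 p" and "D = gden t"
  have D: "0 < D" using gden_ge[OF t] theta_pos by (auto simp: D_def)
  have c1: "0 < c1" using gamma1_pos by (simp add: c1_def)
  have E: "exp (\<omega>par p * (horizon p - t)) * (A + \<theta>) = D + A - \<theta>"
    by (simp add: D_def gden_def A_def \<theta>_def)
  have "(gden has_real_derivative - (2 * \<theta> * c1) * (exp (\<omega>par p * (horizon p - t)) * (A + \<theta>))) (at t)"
    unfolding gden_def[abs_def] A_def[symmetric] \<theta>_def[symmetric]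
    by (auto intro!: derivative_eq_intros simp: \<omega>par_def \<theta>_def c1_def)
  then have dD: "(gden has_real_derivative - (2 * \<theta> * c1) * (D + A - \<theta>)) (at t)"
    unfolding E .
  have "(g_fn p has_real_derivative (A - \<theta>) * (2 * \<theta> * (- (2 * \<theta> * c1) * (D + A - \<theta>)) / (D * D))) (at t)"
    unfolding g_eq[abs_def] A_def[symmetric] \<theta>_def[symmetric]
    using D by (intro DERIV_cong[OF DERIV_cmult[OF DERIV_diff[OF DERIV_const DERIV_divide[OF DERIV_const dD]]]])
      (simp_all add: D_def[symmetric] field_simps)
  moreover have "g_deriv t = (A - \<theta>) * (2 * \<theta> * (- (2 * \<theta> * c1) * (D + A - \<theta>)) / (D * D))"
  proof -
    have g: "g_fn p t = (A - \<theta>) * (1 - 2 * \<theta> / D)" by (simp add: g_eq A_def \<theta>_def D_def)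
    have "\<gamma>\<^sub>2 p = c1 * A" "\<gamma>\<^sub>3 p = c1 * (A\<^sup>2 - \<theta>\<^sup>2)"
      using c1 theta_square by (auto simp: A_def c1_def \<theta>_def \<gamma>check\<^sub>2_def \<gamma>check\<^sub>3_def)
    then have "g_deriv t = - c1 * ((g_fn p t - A)\<^sup>2 - \<theta>\<^sup>2)"
      by (simp add: g_deriv_def c1_def algebra_simps power2_eq_square)
    also have "g_fn p t - A = - (\<theta> + 2 * \<theta> * (A - \<theta>) / D)"
      using D by (simp add: g field_simps)
    also have "- c1 * ((- (\<theta> + 2 * \<theta> * (A - \<theta>) / D))\<^sup>2 - \<theta>\<^sup>2) =
        (A - \<theta>) * (2 * \<theta> * (- (2 * \<theta> * c1) * (D + A - \<theta>)) / (D * D))"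
      using D by (simp add: field_simps power2_eq_square)
    finally show ?thesis .
  qed
  ultimately show ?thesis by simp
qed

lemma cont_g: "continuous_on {0..horizon p} (g_fn p)"
  using g_riccati by (intro DERIV_continuous_on[where D=g_deriv]) (auto intro: has_field_derivative_at_within)

text \<open>
  The two consequences of the threshold that are used: \<open>\<kappa>_2 \<ge> \<kappa>_1^2 / 2\<close> and \<open>\<kappa> \<le> \<kappa>_1\<close> give the first,
  and \<open>8 \<gamma> \<le> (3 + \<gamma>) (\<gamma> + 1)\<close> gives the second.
\<close>
lemma T0_facts:
  "3 * \<kappa>\<^sub>1 p * horizon p \<le> 1 - \<gamma> p"
  "8 * (g_fn p 0 / (1 - \<gamma> p) * (\<sigma> p)\<^sup>2 * horizon p) \<le> 1"
proof -
  let ?T = "horizon p" and ?c = "\<gamma> p" and ?k = "\<kappa>\<^sub>1 p"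
  have h: "?T < \<kappa> p * (1 - ?c) / (2 * (3 + ?c) * \<kappa>\<^sub>2 p)"
     "?T < ?c * (1 - ?c) / ((3 + ?c) * (?c + 1) * (\<sigma> p)\<^sup>2 * g_fn p 0)"
    using horizon_lt by (auto simp: T0_bound_def)
  have k2: "?k\<^sup>2 / 2 \<le> \<kappa>\<^sub>2 p" "0 < \<kappa>\<^sub>2 p"
  proof -
    have "?k\<^sup>2 * (1 / 2) \<le> \<kappa>\<^sub>2 p"
      unfolding \<kappa>\<^sub>2_def using g0_pos kappa1_bounds by (intro mult_left_mono) auto
    then show "?k\<^sup>2 / 2 \<le> \<kappa>\<^sub>2 p" by simp
    moreover have "0 < ?k\<^sup>2 / 2" using kappa1_bounds by simp
    ultimately show "0 < \<kappa>\<^sub>2 p" by linarith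
  qed
  have "?T * (2 * (3 + ?c) * \<kappa>\<^sub>2 p) < \<kappa> p * (1 - ?c)"
    using h(1) k2 gamma_pos by (simp add: pos_less_divide_eq)
  moreover have "?T * (2 * (3 + 0) * (?k\<^sup>2 / 2)) \<le> ?T * (2 * (3 + ?c) * \<kappa>\<^sub>2 p)"
    using k2 gamma_pos horizon_pos by (intro mult_left_mono mult_mono) auto
  moreover have "\<kappa> p * (1 - ?c) \<le> ?k * (1 - ?c)"
    using kappa1_bounds gamma_lt_1 by (intro mult_right_mono) auto
  ultimately have "?k * (3 * ?k * ?T) \<le> ?k * (1 - ?c)"
    by (simp add: power2_eq_square algebra_simps)
  then show "3 * ?k * ?T \<le> 1 - ?c"
    using kappa1_bounds by simp
  have pos: "0 < (3 + ?c) * (?c + 1)" using gamma_pos by simp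
  have "?T * ((3 + ?c) * (?c + 1) * (\<sigma> p)\<^sup>2 * g_fn p 0) < ?c * (1 - ?c)"
    using h(2) gamma_pos g0_pos sigma_pos by (simp add: pos_less_divide_eq)
  then have "(3 + ?c) * (?c + 1) * (g_fn p 0 / (1 - ?c) * (\<sigma> p)\<^sup>2 * ?T) \<le> ?c"
    using gamma_lt_1 by (simp add: field_simps)
  also have "8 * ?c \<le> (3 + ?c) * (?c + 1)"
    using mult_nonneg_nonneg[of "1 - ?c" "3 - ?c"] gamma_lt_1 by (simp add: algebra_simps)
  then have "?c \<le> (3 + ?c) * (?c + 1) * (1 / 8)" by simp
  finally have "g_fn p 0 / (1 - ?c) * (\<sigma> p)\<^sup>2 * ?T \<le> 1 / 8"
    using pos by (subst (asm) mult_le_cancel_left_pos) auto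
  then show "8 * (g_fn p 0 / (1 - \<gamma> p) * (\<sigma> p)\<^sup>2 * horizon p) \<le> 1" by linarith
qed

lemma gamma2_horizon: "\<gamma>\<^sub>2 p * horizon p \<le> 1 / 3"
proof -
  let ?T = "horizon p" and ?c = "\<gamma> p" and ?k = "\<kappa>\<^sub>1 p"
  have 1: "?k * ?T \<le> (1 - ?c) / 3" using T0_facts(1) by simp
  have "\<kappa> p * ?T \<le> ?k * ?T" using kappa1_bounds horizon_pos by (intro mult_right_mono) auto
  moreover have "?c / (1 - ?c) * (?k * ?T) \<le> ?c / 3"
  proof -
    have "?c / (1 - ?c) * (?k * ?T) \<le> ?c / (1 - ?c) * ((1 - ?c) / 3)"
      using 1 gamma_pos gamma_lt_1 by (intro mult_left_mono) auto
    also have "\<dots> = ?c / 3" using gamma_lt_1 by simp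
    finally show ?thesis .
  qed
  moreover have "\<gamma>\<^sub>2 p * ?T = ?c / (1 - ?c) * (?k * ?T) + \<kappa> p * ?T"
    by (simp add: \<gamma>\<^sub>2_def distrib_right)
  ultimately have "\<gamma>\<^sub>2 p * ?T \<le> ?c / 3 + (1 - ?c) / 3" using 1 by linarith
  then show ?thesis by (simp add: field_simps)
qed

definition pot :: "real \<Rightarrow> real" where
  "pot t = ((\<sigma> p)\<^sup>2 * g_fn p t / 2 + rate p * \<gamma> p) / (1 - \<gamma> p)"

definition ell :: "real \<Rightarrow> real" where "ell t = g_fn p t / (1 - \<gamma> p)"
definition bcoef :: real where "bcoef = varpi p powr (- 1 / (1 - \<gamma> p))"

sublocale linear_problem "horizon p" "\<sigma> p" "g1_fn p" bcoef "ell 0" "\<gamma>\<^sub>2 p" pot ell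
proof
  show "continuous_on {0..horizon p} (g1_fn p)"
    unfolding g1_fn_def by (intro continuous_intros cont_g)
  show "continuous_on {0..horizon p} pot"
    unfolding pot_def using gamma_lt_1 by (intro continuous_intros cont_g) auto
  show "continuous_on {0..horizon p} ell"
    unfolding ell_def using gamma_lt_1 by (intro continuous_intros cont_g) auto
  show "- \<gamma>\<^sub>2 p \<le> g1_fn p t \<and> g1_fn p t \<le> 0" if t: "t \<in> {0..horizon p}" for t
  proof -
    have "0 \<le> \<gamma>\<^sub>1 p * g_fn p t" using g_bounds(1)[OF t] gamma1_pos by simp
    moreover have "\<gamma>\<^sub>1 p * g_fn p t \<le> \<gamma>\<^sub>1 p * \<gamma>check\<^sub>2 p"
      using g_bounds(3)[OF t] theta_pos gamma1_pos by (intro mult_left_mono) auto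
    moreover have "\<gamma>\<^sub>1 p * \<gamma>check\<^sub>2 p = \<gamma>\<^sub>2 p" using gamma1_pos by (simp add: \<gamma>check\<^sub>2_def)
    ultimately show ?thesis by (simp add: g1_fn_def)
  qed
  show "0 \<le> pot t" if "t \<in> {0..horizon p}" for t
    using g_bounds(1)[OF that] gamma_pos gamma_lt_1 rate_nonneg by (simp add: pot_def)
  show "0 \<le> ell t \<and> ell t \<le> ell 0" if "t \<in> {0..horizon p}" for t
    unfolding ell_def using g_bounds[OF that] gamma_lt_1 by (auto simp: divide_right_mono)
  show "ell 0 * (\<sigma> p)\<^sup>2 * horizon p * exp (2 * \<gamma>\<^sub>2 p * horizon p) < 1"
  proof -
    have "exp (2 * \<gamma>\<^sub>2 p * horizon p) \<le> exp 1" using gamma2_horizon by simp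
    also have "\<dots> \<le> 3" by (rule exp_le)
    finally have "g_fn p 0 / (1 - \<gamma> p) * (\<sigma> p)\<^sup>2 * horizon p * exp (2 * \<gamma>\<^sub>2 p * horizon p) \<le> (1/8) * 3"
      using T0_facts(2) g0_pos gamma_lt_1 horizon_pos by (intro mult_mono) auto
    then show ?thesis unfolding ell_def by linarith
  qed
qed (use horizon_pos sigma_pos varpi_pos in \<open>auto simp: bcoef_def\<close>)

section \<open>The solution of the reduced equation\<close>

definition Y :: "real \<Rightarrow> real \<Rightarrow> real" where "Y s t = (1 - \<gamma> p) * ln (v s t)"
definition Y_s :: "real \<Rightarrow> real \<Rightarrow> real" where "Y_s s t = (1 - \<gamma> p) * (v_s s t / v s t)"
definition Y_ss :: "real \<Rightarrow> real \<Rightarrow> real" where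
  "Y_ss s t = (1 - \<gamma> p) * (v_ss s t / v s t - (v_s s t / v s t)\<^sup>2)"
definition Y_t :: "real \<Rightarrow> real \<Rightarrow> real" where "Y_t s t = (1 - \<gamma> p) * (v_t s t / v s t)"

lemma v_pos: "t \<in> {0..horizon p} \<Longrightarrow> 0 < v s t"
  using v_ge_1[of t s] by simp

lemma Y_deriv_s: "t \<in> {0..horizon p} \<Longrightarrow> ((\<lambda>s. Y s t) has_real_derivative Y_s s t) (at s)"
  unfolding Y_def Y_s_def
  using v_pos[of t s] by (auto intro!: derivative_eq_intros v_deriv_s)

lemma Y_deriv_ss: "t \<in> {0..horizon p} \<Longrightarrow> ((\<lambda>s. Y_s s t) has_real_derivative Y_ss s t) (at s)"
  unfolding Y_s_def Y_ss_def using v_pos[of t s]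
  by (auto intro!: derivative_eq_intros v_deriv_s v_deriv_ss simp: field_simps power2_eq_square)

lemma Y_deriv_t: "t \<in> {0..horizon p} \<Longrightarrow> ((\<lambda>t. Y s t) has_real_derivative Y_t s t) (at t within {0..horizon p})"
  unfolding Y_def Y_t_def
  using v_pos[of t s] by (auto intro!: derivative_eq_intros v_deriv_t)

lemma ds_Y: "t \<in> {0..horizon p} \<Longrightarrow> ds Y s t = Y_s s t"
  unfolding ds_def by (rule DERIV_imp_deriv[OF Y_deriv_s])

lemma v_nonzero: "z \<in> UNIV \<times> {0..horizon p} \<Longrightarrow> v (fst z) (snd z) \<noteq> 0"
  using v_pos[of "snd z" "fst z"] by auto

lemma cont_Y: "continuous_on (UNIV \<times> {0..horizon p}) (\<lambda>(s, t). Y s t)"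
  unfolding Y_def split_beta using cont_v v_nonzero
  by (intro continuous_intros) (auto simp: split_beta)

lemma cont_Y_s: "continuous_on (UNIV \<times> {0..horizon p}) (\<lambda>(s, t). Y_s s t)"
  unfolding Y_s_def split_beta using cont_v cont_v_s v_nonzero
  by (intro continuous_intros) (auto simp: split_beta)

lemma cont_Y_ss: "continuous_on (UNIV \<times> {0..horizon p}) (\<lambda>(s, t). Y_ss s t)"
  unfolding Y_ss_def split_beta using cont_v cont_v_s cont_v_ss v_nonzero
  by (intro continuous_intros) (auto simp: split_beta)

lemma cont_Y_t: "continuous_on (UNIV \<times> {0..horizon p}) (\<lambda>(s, t). Y_t s t)"
  unfolding Y_t_def split_beta using cont_v cont_v_t v_nonzero
  by (intro continuous_intros) (auto simp: split_beta)

lemma Y_terminal: "Y s (horizon p) = 0"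
  by (simp add: Y_def v_terminal)

text \<open>
  \<open>Y_ss\<close> contains \<open>- (v_s / v)^2\<close>, which cancels the quadratic gradient term of \<open>\<Psi>\<close>.
\<close>
lemma Y_pde:
  assumes t: "t \<in> {0..horizon p}"
  shows "Y_t s t + 1 / 2 * (\<sigma> p)\<^sup>2 * Y_ss s t + s * g1_fn p t * Y_s s t + \<Psi> p Y s t = 0"
proof -
  define c where "c = 1 - \<gamma> p"
  have c: "0 < c" using gamma_lt_1 by (simp add: c_def)
  have v: "0 < v s t" by (rule v_pos[OF t])
  have "- (1 / c) * (s\<^sup>2 / 2 * g_fn p t + Y s t) = - (ell t * s\<^sup>2 / 2) - ln (v s t)"
    using c by (simp add: Y_def ell_def c_def[symmetric] field_simps)
  then have G: "G_fn p s t (Y s t) = exp (- (ell t * s\<^sup>2 / 2)) / v s t"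
    unfolding G_fn_def c_def[symmetric] using v by (simp add: exp_diff)
  have pt: "pot t = ((\<sigma> p)\<^sup>2 * g_fn p t / 2 + rate p * \<gamma> p) / c" by (simp add: pot_def c_def)
  have bc: "varpi p powr (- 1 / c) = bcoef" by (simp add: bcoef_def c_def)
  show ?thesis
    unfolding \<Psi>_def ds_Y[OF t] G Y_t_def Y_ss_def Y_s_def v_t_def c_def[symmetric] pt bc
    using c v by (simp add: field_simps power2_eq_square)
qed

lemma Y_nonneg: "t \<in> {0..horizon p} \<Longrightarrow> 0 \<le> Y s t"
  using v_ge_1[of t s] gamma_lt_1 by (simp add: Y_def)

lemma bcoef_eq: "varpi p powr (1 / (\<gamma> p - 1)) = bcoef"
proof -
  have "1 / (\<gamma> p - 1) = - 1 / (1 - \<gamma> p)" using gamma_lt_1 by (simp add: field_simps)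
  then show ?thesis by (simp add: bcoef_def)
qed

text \<open>
  The square of \<open>sqrt A + sqrt B\<close> is at least \<open>A + B\<close>, and \<open>A + B \<ge> 2 \<sigma>^2 b\<close> whatever the sign under
  the absolute value in \<open>B1_bound\<close>.  On the other side the square of the bound for \<open>v_s / v\<close> is of
  order \<open>b\<close>, with a factor that is small by \<open>T0_facts\<close>.
\<close>
lemma Y_s_bound:
  assumes t: "t \<in> {0..horizon p}"
  shows "\<bar>Y_s s t\<bar> \<le> B1_bound p"
proof -
  let ?T = "horizon p" and ?s2 = "(\<sigma> p)\<^sup>2"
  define A where "A = pi / (2 * ?T)"
  define B where "B = \<bar>pi - 4 * ?T * ?s2 * bcoef\<bar> / (2 * ?T)"
  have AB: "0 \<le> A" "0 \<le> B" using horizon_pos by (auto simp: A_def B_def)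
  have s2: "0 < ?s2" using sigma_pos by simp
  have "2 * ?s2 * bcoef = (pi + (4 * ?T * ?s2 * bcoef - pi)) / (2 * ?T)" using horizon_pos by simp
  also have "\<dots> \<le> (pi + \<bar>pi - 4 * ?T * ?s2 * bcoef\<bar>) / (2 * ?T)"
    using horizon_pos by (intro divide_right_mono) auto
  also have "\<dots> = A + B" by (simp add: A_def B_def add_divide_distrib)
  also have "\<dots> \<le> (sqrt A + sqrt B)\<^sup>2"
    using AB by (simp add: power2_sum)
  finally have lower: "2 * ?s2 * bcoef \<le> (sqrt A + sqrt B)\<^sup>2" .
  have e0: "0 \<le> ell 0" using L_nonneg .
  have "(?s2 * (sqrt (ell 0) * sqrt (bcoef * ?T / 2)))\<^sup>2 = (ell 0 * ?s2 * ?T) * (?s2 * bcoef / 2)"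
    using e0 b_pos horizon_pos unfolding power_mult_distrib by (simp add: power2_eq_square[of "(\<sigma> p)\<^sup>2"])
  also have "\<dots> \<le> 1 * (?s2 * bcoef / 2)"
    using T0_facts(2) s2 b_pos by (intro mult_right_mono) (auto simp: ell_def)
  also have "\<dots> \<le> 2 * ?s2 * bcoef" using s2 b_pos by simp
  also note lower
  finally have "?s2 * (sqrt (ell 0) * sqrt (bcoef * ?T / 2)) \<le> sqrt A + sqrt B"
    by (rule power2_le_imp_le) (use AB in auto)
  then have main: "sqrt (ell 0) * sqrt (bcoef * ?T / 2) \<le> (sqrt A + sqrt B) / ?s2"
    using s2 by (simp add: pos_le_divide_eq mult.commute)
  have "\<bar>Y_s s t\<bar> = (1 - \<gamma> p) * (\<bar>v_s s t\<bar> / v s t)"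
    using gamma_lt_1 v_pos[OF t, of s] by (simp add: Y_s_def abs_mult)
  also have "\<dots> \<le> (1 - \<gamma> p) * (sqrt (ell 0) * sqrt (bcoef * ?T / 2))"
    using v_s_bound[OF t, of s] v_pos[OF t, of s] gamma_lt_1
    by (intro mult_left_mono) (auto simp: pos_divide_le_eq)
  also have "\<dots> \<le> (1 - \<gamma> p) * ((sqrt A + sqrt B) / ?s2)"
    using main gamma_lt_1 by (intro mult_left_mono) auto
  also have "\<dots> = B1_bound p"
    by (simp add: B1_bound_def bcoef_eq \<gamma>\<^sub>1_def A_def B_def)
  finally show ?thesis .
qed

lemma B1_nonneg: "0 \<le> B1_bound p"
  using Y_s_bound[of 0 0] horizon_pos by auto

text \<open>
  The source adds at most a factor \<open>1 + b T\<close> to \<open>v\<close>, and \<open>ln (1 + b T) \<le> b T\<close>; this is already bounded by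
  the term \<open>q1_const p * horizon p\<close> of \<open>B0_bound\<close>.
\<close>
lemma Y_le_B0:
  assumes t: "t \<in> {0..horizon p}"
  shows "Y s t \<le> B0_bound p"
proof -
  let ?T = "horizon p"
  let ?P = "((\<sigma> p)\<^sup>2 * g_fn p 0 / 2 + rate p * \<gamma> p) / (1 - \<gamma> p)"
  have P0: "0 \<le> ?P" using g0_pos rate_nonneg gamma_pos gamma_lt_1 by simp
  have potP: "0 \<le> pot t \<and> pot t \<le> ?P" if "t \<in> {0..?T}" for t
    using a_nonneg[OF that] g_bounds(2)[OF that] gamma_lt_1
    by (auto simp: pot_def intro!: divide_right_mono mult_left_mono)
  have "pot_prim ?T - pot_prim t \<le> ?P * (?T - t)"
    using increment_bounds(2)[OF pot_prim_deriv potP, of t ?T] t by auto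
  also have "\<dots> \<le> ?P * ?T" using P0 t by (intro mult_left_mono) auto
  finally have pot_prim: "pot_prim ?T - pot_prim t \<le> ?P * ?T" .
  have bT: "0 < bcoef * ?T" using b_pos horizon_pos by simp
  have "ln (v s t) \<le> ln (exp (pot_prim ?T - pot_prim t) * (1 + bcoef * ?T))"
    using v_le[OF t, of s] v_pos[OF t, of s] bT by (subst ln_le_cancel_iff) auto
  also have "\<dots> = pot_prim ?T - pot_prim t + ln (1 + bcoef * ?T)"
    using bT by (subst ln_mult) auto
  also have "\<dots> \<le> ?P * ?T + bcoef * ?T"
    using pot_prim ln_add_one_self_le_self[of "bcoef * ?T"] bT by auto
  finally have "Y s t \<le> (1 - \<gamma> p) * (?P * ?T + bcoef * ?T)"
    unfolding Y_def using gamma_lt_1 by (intro mult_left_mono) auto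
  also have "\<dots> = q1_const p * ?T"
    unfolding q1_const_def bcoef_eq using gamma_lt_1 by (simp add: field_simps)
  also have "\<dots> \<le> B0_bound p"
    unfolding B0_bound_def using horizon_pos gamma1_pos by (intro mult_right_mono) auto
  finally show ?thesis .
qed

lemma Y_ss_bounded: "\<exists>C. \<forall>s. \<forall>t\<in>{0..horizon p}. \<bar>Y_ss s t\<bar> \<le> C"
proof (intro exI allI ballI)
  let ?M = "3 * ell 0 * bcoef * horizon p" and ?S = "sqrt (ell 0) * sqrt (bcoef * horizon p / 2)"
  fix s t assume t: "t \<in> {0..horizon p}"
  have 1: "\<bar>v_ss s t / v s t\<bar> \<le> ?M"
    using v_ss_bound[OF t, of s] v_pos[OF t, of s] by (simp add: pos_divide_le_eq)
  have "\<bar>v_s s t / v s t\<bar> \<le> ?S"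
    using v_s_bound[OF t, of s] v_pos[OF t, of s] by (simp add: pos_divide_le_eq)
  then have 2: "(v_s s t / v s t)\<^sup>2 \<le> ?S\<^sup>2"
    by (metis abs_ge_zero power2_abs power_mono)
  have "\<bar>v_ss s t / v s t - (v_s s t / v s t)\<^sup>2\<bar> \<le> ?M + ?S\<^sup>2"
    using 1 2 zero_le_power2[of "v_s s t / v s t"] by linarith
  then show "\<bar>Y_ss s t\<bar> \<le> (1 - \<gamma> p) * (?M + ?S\<^sup>2)"
    unfolding Y_ss_def using gamma_lt_1 by (simp add: abs_mult mult_left_mono)
qed

lemma cont_ds_Y: "continuous_on (UNIV \<times> {0..horizon p}) (\<lambda>(s, t). ds Y s t)"
  by (rule continuous_on_eq[OF cont_Y_s]) (auto simp: ds_Y)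

lemma Y_in_X: "Y \<in> \<X> p"
proof -
  have "(\<lambda>x. Y x t) differentiable (at s)" if "t \<in> {0..horizon p}" for s t
    using Y_deriv_s[OF that] real_differentiable_def by blast
  then show ?thesis
    unfolding \<X>_def using cont_Y cont_ds_Y Y_nonneg Y_le_B0 Y_s_bound by (auto simp: ds_Y)
qed

lemma Y_solves: "solves_Y_pde p Y"
proof -
  have d1: "((\<lambda>x. ds Y x t) has_real_derivative Y_ss s t) (at s)" if "t \<in> {0..horizon p}" for s t
    using Y_deriv_ss[OF that] by (simp add: ds_Y[OF that])
  have d2: "((\<lambda>x. Y x t) has_real_derivative ds Y s t) (at s)" if "t \<in> {0..horizon p}" for s t
    using Y_deriv_s[OF that] by (simp add: ds_Y[OF that])
  have d3: "Y_t s t + 1 / 2 * (\<sigma> p)\<^sup>2 * Y_ss s t + s * g1_fn p t * ds Y s t + \<Psi> p Y s t = 0"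
    if "t \<in> {0..horizon p}" for s t
    using Y_pde[OF that] by (simp add: ds_Y[OF that])
  show ?thesis
    unfolding solves_Y_pde_def
    by (intro conjI exI[of _ Y_t] exI[of _ Y_ss] allI ballI cont_Y cont_ds_Y cont_Y_t cont_Y_ss
        Y_deriv_t Y_terminal d1 d2 d3)
qed

section \<open>Uniqueness\<close>

lemma solves_Y_pdeE:
  assumes "solves_Y_pde p h"
  obtains ht hss where "continuous_on (UNIV \<times> {0..horizon p}) (\<lambda>(s, t). h s t)"
    "\<And>s t. t \<in> {0..horizon p} \<Longrightarrow> ((\<lambda>u. h s u) has_real_derivative ht s t) (at t within {0..horizon p})"
    "\<And>s t. t \<in> {0..horizon p} \<Longrightarrow> ((\<lambda>x. h x t) has_real_derivative ds h s t) (at s)"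
    "\<And>s t. t \<in> {0..horizon p} \<Longrightarrow> ((\<lambda>x. ds h x t) has_real_derivative hss s t) (at s)"
    "\<And>s t. t \<in> {0..horizon p} \<Longrightarrow>
       ht s t + 1 / 2 * (\<sigma> p)\<^sup>2 * hss s t + s * g1_fn p t * ds h s t + \<Psi> p h s t = 0"
    "\<And>s. h s (horizon p) = 0"
proof -
  from assms obtain ht hss where c: "continuous_on (UNIV \<times> {0..horizon p}) (\<lambda>(s, t). h s t)"
    and H: "\<forall>s. \<forall>t\<in>{0..horizon p}.
           ((\<lambda>u. h s u) has_real_derivative ht s t) (at t within {0..horizon p}) \<and>
           ((\<lambda>x. h x t) has_real_derivative ds h s t) (at s) \<and>
           ((\<lambda>x. ds h x t) has_real_derivative hss s t) (at s) \<and>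
           ht s t + 1 / 2 * (\<sigma> p)\<^sup>2 * hss s t + s * g1_fn p t * ds h s t + \<Psi> p h s t = 0"
    and T: "\<forall>s. h s (horizon p) = 0"
    unfolding solves_Y_pde_def by blast
  show thesis by (rule that[of ht hss]) (use c H T in blast)+
qed

lemma G_fn_antimono: "y1 \<le> y2 \<Longrightarrow> G_fn p s t y2 \<le> G_fn p s t y1"
  using gamma_lt_1 by (auto simp: G_fn_def divide_right_mono)

text \<open>
  Where \<open>Y1 - Y2 - \<epsilon> \<psi>\<close> with \<open>\<psi> = exp (K (T - t)) (1 + s^2)\<close> attains a positive maximum, its
  derivatives have the signs of a maximum.  The exponential term of \<open>\<Psi>\<close> decreases in \<open>Y\<close>, and
  the difference of the quadratic terms is linear in \<open>Y1_s - Y2_s = \<epsilon> \<psi>_s\<close> with a coefficient bounded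
  by \<open>Q\<close>.  Subtracting the two equations leaves \<open>0\<close> below a strictly negative multiple of \<open>\<psi>\<close> as soon
  as \<open>K > \<sigma>^2 + Q\<close>.
\<close>
lemma comparison:
  assumes X1: "Y1 \<in> \<X> p" and X2: "Y2 \<in> \<X> p"
    and S1: "solves_Y_pde p Y1" and S2: "solves_Y_pde p Y2" and t0: "t0 \<in> {0..horizon p}"
  shows "Y1 s0 t0 \<le> Y2 s0 t0"
proof (rule ccontr)
  assume "\<not> Y1 s0 t0 \<le> Y2 s0 t0"
  define \<delta> where "\<delta> = Y1 s0 t0 - Y2 s0 t0"
  have \<delta>: "0 < \<delta>" using \<open>\<not> Y1 s0 t0 \<le> Y2 s0 t0\<close> by (simp add: \<delta>_def)
  let ?T = "horizon p" and ?s2 = "(\<sigma> p)\<^sup>2"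
  define Q where "Q = \<gamma>\<^sub>1 p * B1_bound p"
  \<comment> \<open>\<open>\<sigma>^2\<close> comes from \<open>\<psi>_ss\<close>, \<open>Q\<close> from the gradient terms, and the last summand makes the inequality strict\<close>
  define K where "K = ?s2 + Q + 1"
  have Q: "0 \<le> Q" using gamma1_pos B1_nonneg by (simp add: Q_def)
  have K: "0 < K" using Q by (simp add: K_def add_nonneg_pos)
  define E where "E t = exp (K * (?T - t))" for t
  define \<psi> where "\<psi> s t = E t * (1 + s\<^sup>2)" for s t
  have E1: "1 \<le> E t" if "t \<in> {0..?T}" for t using that K by (simp add: E_def)
  have \<psi>1: "1 + s\<^sup>2 \<le> \<psi> s t" if "t \<in> {0..?T}" for s t
    using mult_right_mono[OF E1[OF that], of "1 + s\<^sup>2"] by (simp add: \<psi>_def)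
  have \<psi>pos: "0 < \<psi> s t" if "t \<in> {0..?T}" for s t
    using \<psi>1[OF that, of s] zero_le_power2[of s] by linarith
  define \<epsilon> where "\<epsilon> = \<delta> / (2 * \<psi> s0 t0)"
  have \<epsilon>: "0 < \<epsilon>" using \<delta> \<psi>pos[OF t0] by (simp add: \<epsilon>_def)
  define w where "w s t = Y1 s t - Y2 s t - \<epsilon> * \<psi> s t" for s t
  have w0: "w s0 t0 = \<delta> / 2"
    using \<psi>pos[OF t0, of s0] by (simp add: w_def \<epsilon>_def \<delta>_def[symmetric] field_simps)
  obtain Y1t Y1ss where Y1: "continuous_on (UNIV \<times> {0..?T}) (\<lambda>(s, t). Y1 s t)"
    "\<And>s t. t \<in> {0..?T} \<Longrightarrow> ((\<lambda>u. Y1 s u) has_real_derivative Y1t s t) (at t within {0..?T})"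
    "\<And>s t. t \<in> {0..?T} \<Longrightarrow> ((\<lambda>x. Y1 x t) has_real_derivative ds Y1 s t) (at s)"
    "\<And>s t. t \<in> {0..?T} \<Longrightarrow> ((\<lambda>x. ds Y1 x t) has_real_derivative Y1ss s t) (at s)"
    "\<And>s t. t \<in> {0..?T} \<Longrightarrow> Y1t s t + 1 / 2 * ?s2 * Y1ss s t + s * g1_fn p t * ds Y1 s t + \<Psi> p Y1 s t = 0"
    "\<And>s. Y1 s ?T = 0"
    using solves_Y_pdeE[OF S1] by metis
  obtain Y2t Y2ss where Y2: "continuous_on (UNIV \<times> {0..?T}) (\<lambda>(s, t). Y2 s t)"
    "\<And>s t. t \<in> {0..?T} \<Longrightarrow> ((\<lambda>u. Y2 s u) has_real_derivative Y2t s t) (at t within {0..?T})"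
    "\<And>s t. t \<in> {0..?T} \<Longrightarrow> ((\<lambda>x. Y2 x t) has_real_derivative ds Y2 s t) (at s)"
    "\<And>s t. t \<in> {0..?T} \<Longrightarrow> ((\<lambda>x. ds Y2 x t) has_real_derivative Y2ss s t) (at s)"
    "\<And>s t. t \<in> {0..?T} \<Longrightarrow> Y2t s t + 1 / 2 * ?s2 * Y2ss s t + s * g1_fn p t * ds Y2 s t + \<Psi> p Y2 s t = 0"
    "\<And>s. Y2 s ?T = 0"
    using solves_Y_pdeE[OF S2] by metis
  have bd: "Y1 s t - Y2 s t \<le> B0_bound p" "\<bar>ds Y1 s t\<bar> \<le> B1_bound p" "\<bar>ds Y2 s t\<bar> \<le> B1_bound p"
    if "t \<in> {0..?T}" for s t
  proof -
    have "Y1 s t \<le> B0_bound p" "0 \<le> Y2 s t" using X1 X2 that by (auto simp: \<X>_def)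
    then show "Y1 s t - Y2 s t \<le> B0_bound p" by simp
    show "\<bar>ds Y1 s t\<bar> \<le> B1_bound p" "\<bar>ds Y2 s t\<bar> \<le> B1_bound p" using X1 X2 that by (auto simp: \<X>_def)
  qed
  \<comment> \<open>outside \<open>[-R, R]\<close> the penalty exceeds \<open>Y1 - Y2 \<le> B0_bound p\<close>\<close>
  define R where "R = 1 + \<bar>s0\<bar> + \<bar>B0_bound p\<bar> / \<epsilon>"
  have R: "1 \<le> R" "\<bar>s0\<bar> \<le> R" using \<epsilon> by (auto simp: R_def)
  have outside: "w s t < 0" if "t \<in> {0..?T}" "R \<le> \<bar>s\<bar>" for s t
  proof -
    have "\<bar>B0_bound p\<bar> / \<epsilon> \<le> \<bar>s\<bar> * 1" using that by (simp add: R_def)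
    also have "\<dots> \<le> \<bar>s\<bar> * \<bar>s\<bar>" using that R by (intro mult_left_mono) auto
    finally have "B0_bound p \<le> \<epsilon> * s\<^sup>2" using \<epsilon> by (simp add: field_simps power2_eq_square)
    moreover have "\<epsilon> * (1 + s\<^sup>2) \<le> \<epsilon> * \<psi> s t" using \<psi>1[OF that(1)] \<epsilon> by (intro mult_left_mono) auto
    ultimately show ?thesis using bd(1)[OF that(1), of s] \<epsilon> by (simp add: w_def distrib_left)
  qed
  have "continuous_on ({-R..R} \<times> {0..?T}) (\<lambda>z. w (fst z) (snd z))"
    unfolding w_def \<psi>_def E_def
    using continuous_on_subset[OF Y1(1), of "{-R..R} \<times> {0..?T}"] continuous_on_subset[OF Y2(1), of "{-R..R} \<times> {0..?T}"]
    by (intro continuous_intros) (auto simp: split_beta)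
  from continuous_attains_sup[OF _ _ this] R t0
  obtain s1 t1 where m: "s1 \<in> {-R..R}" "t1 \<in> {0..?T}"
    "\<And>s t. s \<in> {-R..R} \<Longrightarrow> t \<in> {0..?T} \<Longrightarrow> w s t \<le> w s1 t1"
    by (auto simp: compact_Times)
  have wpos: "0 < w s1 t1" using m(3)[of s0 t0] w0 \<delta> R t0 by (auto simp: abs_le_iff)
  have gmax: "w s t \<le> w s1 t1" if "t \<in> {0..?T}" for s t
    using m(3)[of s t] outside[OF that, of s] wpos that by (cases "R \<le> \<bar>s\<bar>") (auto simp: not_le abs_less_iff)
  have "t1 \<noteq> ?T"
    using wpos Y1(6)[of s1] Y2(6)[of s1] mult_pos_pos[OF \<epsilon> \<psi>pos[OF m(2), of s1]] by (auto simp: w_def)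
  then have t1: "t1 < ?T" using m(2) by auto
  have dws: "((\<lambda>s. w s t1) has_real_derivative ds Y1 s t1 - ds Y2 s t1 - \<epsilon> * (E t1 * (2 * s))) (at s)" for s
    unfolding w_def \<psi>_def by (auto intro!: derivative_eq_intros Y1(3) Y2(3) m(2))
  have dwss: "((\<lambda>s. ds Y1 s t1 - ds Y2 s t1 - \<epsilon> * (E t1 * (2 * s))) has_real_derivative
      Y1ss s1 t1 - Y2ss s1 t1 - \<epsilon> * (E t1 * 2)) (at s1)"
    by (auto intro!: derivative_eq_intros Y1(4) Y2(4) m(2))
  have dwt: "((\<lambda>t. w s1 t) has_real_derivative Y1t s1 t1 - Y2t s1 t1 + \<epsilon> * (K * \<psi> s1 t1)) (at t1 within {0..?T})"
    unfolding w_def \<psi>_def E_def by (auto intro!: derivative_eq_intros Y1(2) Y2(2) m(2) simp: algebra_simps)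
  have D1: "ds Y1 s1 t1 - ds Y2 s1 t1 = \<epsilon> * (E t1 * (2 * s1))"
    and D2: "Y1ss s1 t1 - Y2ss s1 t1 \<le> \<epsilon> * (E t1 * 2)"
    using second_derivative_at_max[OF dws dwss] gmax[OF m(2)] by auto
  have D3: "Y1t s1 t1 - Y2t s1 t1 \<le> - (\<epsilon> * (K * \<psi> s1 t1))"
    using right_derivative_at_max[OF dwt m(2) t1] gmax by auto
  have "0 < \<epsilon> * \<psi> s1 t1" using \<epsilon> \<psi>pos[OF m(2)] by simp
  then have "Y2 s1 t1 \<le> Y1 s1 t1" using wpos by (simp add: w_def)
  then have G: "G_fn p s1 t1 (Y1 s1 t1) \<le> G_fn p s1 t1 (Y2 s1 t1)" by (rule G_fn_antimono)
  define q where "q = \<gamma>\<^sub>1 p / 2 * (ds Y1 s1 t1 + ds Y2 s1 t1)"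
  have q: "\<bar>q\<bar> \<le> Q"
  proof -
    have "\<bar>ds Y1 s1 t1 + ds Y2 s1 t1\<bar> \<le> 2 * B1_bound p" using bd(2,3)[OF m(2), of s1] by linarith
    then have "\<gamma>\<^sub>1 p / 2 * \<bar>ds Y1 s1 t1 + ds Y2 s1 t1\<bar> \<le> \<gamma>\<^sub>1 p / 2 * (2 * B1_bound p)"
      using gamma1_pos by (intro mult_left_mono) auto
    then show ?thesis using gamma1_pos by (simp add: q_def Q_def abs_mult)
  qed
  have "\<Psi> p Y1 s1 t1 - \<Psi> p Y2 s1 t1 \<le> q * (ds Y1 s1 t1 - ds Y2 s1 t1)"
  proof -
    have "?s2 * (ds Y1 s1 t1)\<^sup>2 / (2 * (1 - \<gamma> p)) - ?s2 * (ds Y2 s1 t1)\<^sup>2 / (2 * (1 - \<gamma> p)) = q * (ds Y1 s1 t1 - ds Y2 s1 t1)"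
      by (simp add: q_def \<gamma>\<^sub>1_def power2_eq_square diff_divide_distrib[symmetric] algebra_simps)
    moreover have "(1 - \<gamma> p) * varpi p powr (- 1 / (1 - \<gamma> p)) * G_fn p s1 t1 (Y1 s1 t1)
      \<le> (1 - \<gamma> p) * varpi p powr (- 1 / (1 - \<gamma> p)) * G_fn p s1 t1 (Y2 s1 t1)"
      using G gamma_lt_1 by (intro mult_left_mono) auto
    ultimately show ?thesis by (simp add: \<Psi>_def)
  qed
  also have "q * (ds Y1 s1 t1 - ds Y2 s1 t1) = \<epsilon> * E t1 * (q * (2 * s1))" unfolding D1 by simp
  also have "\<dots> \<le> \<epsilon> * E t1 * (Q * (1 + s1\<^sup>2))"
  proof -
    have "q * (2 * s1) \<le> \<bar>q\<bar> * (2 * \<bar>s1\<bar>)" by (metis abs_ge_self abs_mult abs_numeral)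
    also have "\<dots> \<le> Q * (1 + s1\<^sup>2)"
      using q Q zero_le_power2[of "1 - \<bar>s1\<bar>"] by (intro mult_mono) (auto simp: power2_eq_square algebra_simps)
    finally show ?thesis using \<epsilon> by (intro mult_left_mono) (auto simp: E_def)
  qed
  finally have P: "\<Psi> p Y1 s1 t1 - \<Psi> p Y2 s1 t1 \<le> \<epsilon> * E t1 * (Q * (1 + s1\<^sup>2))" .
  have "s1 * g1_fn p t1 * (ds Y1 s1 t1 - ds Y2 s1 t1) = (\<epsilon> * E t1 * (2 * s1\<^sup>2)) * g1_fn p t1"
    unfolding D1 by (simp add: power2_eq_square)
  also have "\<dots> \<le> 0"
    using d_bounds[OF m(2)] \<epsilon> by (intro mult_nonneg_nonpos) (auto simp: E_def)
  finally have g1: "s1 * g1_fn p t1 * ds Y1 s1 t1 - s1 * g1_fn p t1 * ds Y2 s1 t1 \<le> 0"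
    by (simp add: right_diff_distrib)
  have D2': "1 / 2 * ?s2 * Y1ss s1 t1 - 1 / 2 * ?s2 * Y2ss s1 t1 \<le> \<epsilon> * E t1 * ?s2"
    using mult_left_mono[OF D2, of "1 / 2 * ?s2"] by (simp add: algebra_simps)
  have "0 \<le> \<epsilon> * E t1 * (Q * (1 + s1\<^sup>2)) + \<epsilon> * E t1 * ?s2 - \<epsilon> * (K * \<psi> s1 t1)"
    using Y1(5)[OF m(2), of s1] Y2(5)[OF m(2), of s1] P g1 D2' D3 by linarith
  also have "\<dots> = - (\<epsilon> * E t1 * (1 + s1\<^sup>2 + ?s2 * s1\<^sup>2))"
    by (simp add: \<psi>_def K_def algebra_simps)
  also have "\<dots> < 0"
    using \<epsilon> by (auto simp: E_def intro!: mult_pos_pos add_pos_nonneg)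
  finally show False by simp
qed

section \<open>The fixed point of the Feynman--Kac mapping\<close>

lemma cont_Psi: "continuous_on (UNIV \<times> {0..horizon p}) (\<lambda>(s, t). \<Psi> p Y s t)"
proof -
  have "continuous_on (UNIV \<times> {0..horizon p}) (\<lambda>z. ds Y (fst z) (snd z))"
       "continuous_on (UNIV \<times> {0..horizon p}) (\<lambda>z. Y (fst z) (snd z))"
    using cont_ds_Y cont_Y by (auto simp: split_beta)
  then show ?thesis
    unfolding \<Psi>_def G_fn_def split_beta using gamma_lt_1
    by (intro continuous_intros continuous_on_compose2[OF cont_g]) auto
qed

lemma Psi_bounded: "\<exists>C. \<forall>s. \<forall>t\<in>{0..horizon p}. \<bar>\<Psi> p Y s t\<bar> \<le> C"
proof (intro exI allI ballI)
  fix s t assume t: "t \<in> {0..horizon p}"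
  let ?c = "1 - \<gamma> p" and ?s2 = "(\<sigma> p)\<^sup>2"
  have c: "0 < ?c" using gamma_lt_1 by simp
  have "(ds Y s t)\<^sup>2 \<le> (B1_bound p)\<^sup>2"
    using Y_s_bound[OF t, of s] unfolding ds_Y[OF t] by (metis abs_ge_zero power2_abs power_mono)
  then have 1: "0 \<le> ?s2 * (ds Y s t)\<^sup>2 / (2 * ?c)" "?s2 * (ds Y s t)\<^sup>2 / (2 * ?c) \<le> ?s2 * (B1_bound p)\<^sup>2 / (2 * ?c)"
    using c by (auto intro!: divide_right_mono mult_left_mono)
  have 2: "0 \<le> ?s2 * g_fn p t / 2" "?s2 * g_fn p t / 2 \<le> ?s2 * g_fn p 0 / 2"
    using g_bounds[OF t] by (auto intro!: divide_right_mono mult_left_mono)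
  have "0 \<le> s\<^sup>2 / 2 * g_fn p t + Y s t" using g_bounds(1)[OF t] Y_nonneg[OF t] by simp
  then have "G_fn p s t (Y s t) \<le> 1" unfolding G_fn_def using c by simp
  then have 3: "0 \<le> ?c * varpi p powr (- 1 / ?c) * G_fn p s t (Y s t)"
     "?c * varpi p powr (- 1 / ?c) * G_fn p s t (Y s t) \<le> ?c * varpi p powr (- 1 / ?c)"
    using c mult_left_mono[of "G_fn p s t (Y s t)" 1 "?c * varpi p powr (- 1 / ?c)"] by (auto simp: G_fn_def)
  show "\<bar>\<Psi> p Y s t\<bar> \<le> ?s2 * (B1_bound p)\<^sup>2 / (2 * ?c) + ?s2 * g_fn p 0 / 2 + \<bar>rate p * \<gamma> p\<bar> + ?c * varpi p powr (- 1 / ?c)"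
    unfolding \<Psi>_def using 1 2 3 by linarith
qed

text \<open>
  By \<open>ou_law\<close> the inner expectation is the Gaussian integral of \<open>feynman_kac_gaussian\<close>.  At \<open>u = t\<close>, where
  the law degenerates, both sides are \<open>\<Psi> p Y s t\<close>.
\<close>
lemma Y_fixed_point:
  assumes W: "standard_brownian_motion M W" and \<eta>: "solves_eta_sde p M W \<eta>" and t: "t \<in> {0..horizon p}"
  shows "Y s t = FK_map p M \<eta> Y s t"
proof -
  let ?T = "horizon p"
  interpret prob_space M using W by (simp add: standard_brownian_motion_def)
  obtain C1 C2 where C1: "\<And>s t. t \<in> {0..?T} \<Longrightarrow> \<bar>Y_ss s t\<bar> \<le> C1"
    and C2: "\<And>s t. t \<in> {0..?T} \<Longrightarrow> \<bar>\<Psi> p Y s t\<bar> \<le> C2"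
    using Y_ss_bounded Psi_bounded by metis
  define C where "C = max (max (B0_bound p) (B1_bound p)) (max C1 C2)"
  have bY: "\<bar>Y s t\<bar> \<le> C" "\<bar>Y_s s t\<bar> \<le> C" "\<bar>Y_ss s t\<bar> \<le> C" "\<bar>\<Psi> p Y s t\<bar> \<le> C" if "t \<in> {0..?T}" for s t
    using Y_nonneg[OF that, of s] Y_le_B0[OF that, of s] Y_s_bound[OF that, of s] C1[OF that, of s] C2[OF that, of s]
    by (auto simp: C_def)
  have t': "0 \<le> t" "t \<le> ?T" using t by auto
  let ?h = "\<lambda>u. LINT z|lborel. std_normal_density z * \<Psi> p Y (ou_point s t u z) u"
  note FK = feynman_kac_gaussian[OF cont_Y cont_Y_s cont_Y_ss cont_Y_t cont_Psi Y_deriv_t Y_deriv_s Y_deriv_ss bY Y_pde Y_terminal t']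
  have path: "\<And>u. u \<in> {t..?T} \<Longrightarrow> \<eta> s t u \<in> borel_measurable M"
    "AE x in M. continuous_on {t..?T} (\<lambda>u. \<eta> s t u x) \<and>
        (\<forall>u\<in>{t..?T}. \<eta> s t u x = s + integral {t..u} (\<lambda>v. g1_fn p v * \<eta> s t v x) + \<sigma> p * (W u x - W t x))"
    using \<eta> t unfolding solves_eta_sde_def by blast+
  have "(LINT x|M. \<Psi> p Y (\<eta> s t u x) u) = ?h u" if u: "u \<in> {t..?T}" for u
  proof -
    have u0: "u \<in> {0..?T}" using u t by auto
    have cf: "continuous_on UNIV (\<lambda>y. \<Psi> p Y y u)"
      using u0 by (intro continuous_on_compose2[OF cont_Psi, of _ "\<lambda>y. (y, u)", simplified] continuous_intros) auto
    have [measurable]: "(\<lambda>y. \<Psi> p Y y u) \<in> borel_measurable borel" using cf by (rule borel_measurable_continuous_onI)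
    show ?thesis
    proof (cases "u = t")
      case True
      have "AE x in M. \<eta> s t t x = s" using path(2) by eventually_elim (use t in auto)
      then have "(LINT x|M. \<Psi> p Y (\<eta> s t u x) u) = (LINT x|M. \<Psi> p Y s t)"
        using path(1)[OF u] unfolding True by (intro integral_cong_AE) (auto simp: True[symmetric])
      then show ?thesis by (simp add: True ou_point_start prob_space)
    next
      case False
      then show ?thesis
        unfolding ou_point_def
        using u t' by (intro ou_law[OF W _ _ _ path(1)[OF u] path(2) cf bY(4)[OF u0]]) auto
    qed
  qed
  then have "FK_map p M \<eta> Y s t = (LINT u:{t..?T}|lborel. ?h u)"
    unfolding FK_map_def by (intro set_lebesgue_integral_cong) auto
  also have "\<dots> = integral {t..?T} ?h"
    by (rule set_borel_integral_eq_integral(2)[OF borel_integrable_atLeastAtMost'[OF FK(1)]])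
  also have "\<dots> = Y s t" by (rule FK(2)[symmetric])
  finally show ?thesis by simp
qed

end

section \<open>The Hamilton--Jacobi--Bellman equation\<close>

text \<open>
  Convexity of the exponential function between \<open>0\<close> and \<open>ln y\<close>.
\<close>
lemma bernoulli_powr_le:
  fixes y a :: real
  assumes "0 \<le> y" "0 < a" "a < 1"
  shows "y powr a \<le> 1 + a * (y - 1)"
proof (cases "y = 0")
  case False
  then have y: "0 < y" using assms by simp
  have "exp ((1 - a) * 0 + a * ln y) \<le> (1 - a) * exp 0 + a * exp (ln y)"
    using convex_onD[OF exp_convex, of a 0 "ln y"] assms by simp
  then show ?thesis using y by (simp add: powr_def algebra_simps)
qed (use assms in simp)

text \<open>
  The concave function \<open>c powr a\<close> lies below its tangent at \<open>c0\<close>.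
\<close>
lemma consumption_max:
  fixes a c0 c :: real
  assumes a: "0 < a" "a < 1" and c0: "0 < c0" and c: "0 \<le> c"
  shows "c powr a - c * (a * c0 powr (a - 1)) \<le> (1 - a) * c0 powr a"
proof -
  have e: "c0 powr (a - 1) = c0 powr a / c0" using c0 by (simp add: powr_diff)
  have "c powr a = c0 powr a * (c / c0) powr a"
    using c0 c by (simp add: powr_divide)
  also have "\<dots> \<le> c0 powr a * (1 + a * (c / c0 - 1))"
    using bernoulli_powr_le[of "c / c0" a] a c0 c by (intro mult_left_mono) auto
  finally show ?thesis unfolding e by (simp add: algebra_simps)
qed

lemma quadratic_max:
  fixes A B \<alpha> :: real
  assumes "A < 0"
  shows "\<alpha>\<^sup>2 * A / 2 + B * \<alpha> \<le> - (B\<^sup>2 / (2 * A))"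
proof -
  have "A * (\<alpha>\<^sup>2 * A / 2 + B * \<alpha> + B\<^sup>2 / (2 * A)) = (A * \<alpha> + B)\<^sup>2 / 2"
    using assms by (simp add: field_simps power2_eq_square)
  then have "0 \<le> A * (\<alpha>\<^sup>2 * A / 2 + B * \<alpha> + B\<^sup>2 / (2 * A))"
    using zero_le_power2[of "A * \<alpha> + B"] by linarith
  then have "\<alpha>\<^sup>2 * A / 2 + B * \<alpha> + B\<^sup>2 / (2 * A) \<le> 0"
    using assms by (simp add: zero_le_mult_iff)
  then show ?thesis by linarith
qed

text \<open>
  Every component of the gradient and of the Hessian of \<open>z\<close> is a power of \<open>x\<close> times a function of \<open>s\<close>.
\<close>
lemma has_derivative_separated:
  fixes \<xi> :: "real ^ 2"
  assumes A: "(A has_real_derivative A') (at (\<xi> $ 1))" and B: "(B has_real_derivative B') (at (\<xi> $ 2))"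
  shows "((\<lambda>\<zeta>::real^2. A (\<zeta> $ 1) * B (\<zeta> $ 2)) has_derivative
     (\<lambda>h. A' * B (\<xi> $ 2) * h $ 1 + A (\<xi> $ 1) * B' * h $ 2)) (at \<xi>)"
proof -
  have a: "((\<lambda>\<zeta>::real^2. A (\<zeta> $ 1)) has_derivative (\<lambda>h. A' * h $ 1)) (at \<xi>)"
    using has_derivative_compose[OF bounded_linear_imp_has_derivative[OF bounded_linear_vec_nth]] A
    unfolding has_field_derivative_def by fastforce
  have b: "((\<lambda>\<zeta>::real^2. B (\<zeta> $ 2)) has_derivative (\<lambda>h. B' * h $ 2)) (at \<xi>)"
    using has_derivative_compose[OF bounded_linear_imp_has_derivative[OF bounded_linear_vec_nth]] B
    unfolding has_field_derivative_def by fastforce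
  show ?thesis
    by (rule has_derivative_eq_rhs[OF has_derivative_mult[OF a b]]) (simp add: fun_eq_iff algebra_simps)
qed

lemma has_derivative_vec2:
  fixes f :: "real ^ 2 \<Rightarrow> real ^ 2" and A :: "real ^ 2 ^ 2"
  assumes "\<And>i. ((\<lambda>\<zeta>. f \<zeta> $ i) has_derivative (\<lambda>h. A $ i $ 1 * h $ 1 + A $ i $ 2 * h $ 2)) (at \<xi>)"
  shows "(f has_derivative (\<lambda>h. A *v h)) (at \<xi>)"
proof (subst has_derivative_componentwise_within, intro ballI)
  fix e :: "real ^ 2" assume "e \<in> Basis"
  then obtain i where e: "e = axis i 1" by (auto simp: Basis_vec_def)
  have "(\<lambda>h. (A *v h) \<bullet> e) = (\<lambda>h. A $ i $ 1 * h $ 1 + A $ i $ 2 * h $ 2)"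
    by (simp add: e inner_axis matrix_vector_mult_def sum_2)
  moreover have "(\<lambda>\<zeta>. f \<zeta> \<bullet> e) = (\<lambda>\<zeta>. f \<zeta> $ i)" by (simp add: e inner_axis)
  ultimately show "((\<lambda>\<zeta>. f \<zeta> \<bullet> e) has_derivative (\<lambda>h. (A *v h) \<bullet> e)) (at \<xi>)"
    using assms[of i] by simp
qed

context spread_model
begin

text \<open>
  The equation that remains after maximization and division by \<open>z\<close>, with \<open>ys\<close> for \<open>Y_s\<close> and \<open>N\<close> for
  the consumption term.  Its part quadratic in \<open>s\<close> vanishes by the Riccati equation, and
  \<open>\<gamma> / (1 - \<gamma>) + 1 = 1 / (1 - \<gamma>)\<close> merges the two squares of \<open>ys\<close>.
\<close>
lemma hjb_reduced_identity:
  assumes pde: "yt + 1 / 2 * (\<sigma> p)\<^sup>2 * yss + s * g1_fn p t * ys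
     + ((\<sigma> p)\<^sup>2 * ys\<^sup>2 / (2 * (1 - \<gamma> p)) + (\<sigma> p)\<^sup>2 * g_fn p t / 2 + rate p * \<gamma> p + N) = 0"
  shows "s\<^sup>2 / 2 * g_deriv t + yt
     + \<gamma> p * ((\<sigma> p)\<^sup>2 * (s * g_fn p t + ys) - \<kappa>\<^sub>1 p * s)\<^sup>2 / (2 * (\<sigma> p)\<^sup>2 * (1 - \<gamma> p))
     + 1 / 2 * (\<sigma> p)\<^sup>2 * ((s * g_fn p t + ys)\<^sup>2 + g_fn p t + yss)
     + rate p * \<gamma> p - \<kappa> p * s * (s * g_fn p t + ys) + N = 0"
proof -
  define c where "c = 1 - \<gamma> p"
  have c: "0 < c" "\<gamma> p = 1 - c" using gamma_lt_1 by (auto simp: c_def)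
  have "s\<^sup>2 / 2 * g_deriv t + yt
     + \<gamma> p * ((\<sigma> p)\<^sup>2 * (s * g_fn p t + ys) - \<kappa>\<^sub>1 p * s)\<^sup>2 / (2 * (\<sigma> p)\<^sup>2 * (1 - \<gamma> p))
     + 1 / 2 * (\<sigma> p)\<^sup>2 * ((s * g_fn p t + ys)\<^sup>2 + g_fn p t + yss)
     + rate p * \<gamma> p - \<kappa> p * s * (s * g_fn p t + ys) + N
     = yt + 1 / 2 * (\<sigma> p)\<^sup>2 * yss + s * g1_fn p t * ys
     + ((\<sigma> p)\<^sup>2 * ys\<^sup>2 / (2 * (1 - \<gamma> p)) + (\<sigma> p)\<^sup>2 * g_fn p t / 2 + rate p * \<gamma> p + N)"
    unfolding g_deriv_def g1_fn_def \<gamma>\<^sub>1_def \<gamma>\<^sub>2_def \<gamma>\<^sub>3_def c(2)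
    using c(1) sigma_pos by (simp add: field_simps power2_eq_square)
  then show ?thesis using pde by simp
qed

text \<open>
  The logarithmic derivative of \<open>U\<close> in \<open>s\<close>.
\<close>
definition slope :: "real \<Rightarrow> real \<Rightarrow> real" where "slope s t = s * g_fn p t + Y_s s t"
definition U_s :: "real \<Rightarrow> real \<Rightarrow> real" where "U_s s t = U_fn p Y s t * slope s t"
definition U_ss :: "real \<Rightarrow> real \<Rightarrow> real" where
  "U_ss s t = U_fn p Y s t * ((slope s t)\<^sup>2 + g_fn p t + Y_ss s t)"
definition U_t :: "real \<Rightarrow> real \<Rightarrow> real" where
  "U_t s t = U_fn p Y s t * (s\<^sup>2 / 2 * g_deriv t + Y_t s t)"

lemma U_pos: "0 < U_fn p Y s t" by (simp add: U_fn_def)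

lemma U_deriv_s: "t \<in> {0..horizon p} \<Longrightarrow> ((\<lambda>s. U_fn p Y s t) has_real_derivative U_s s t) (at s)"
  unfolding U_fn_def U_s_def slope_def
  by (auto intro!: derivative_eq_intros Y_deriv_s simp: algebra_simps)

lemma U_deriv_ss: "t \<in> {0..horizon p} \<Longrightarrow> ((\<lambda>s. U_s s t) has_real_derivative U_ss s t) (at s)"
  unfolding U_s_def[abs_def] U_ss_def slope_def
  by (rule derivative_eq_intros U_deriv_s Y_deriv_ss refl | assumption)+
     (simp add: U_s_def slope_def algebra_simps power2_eq_square)

lemma U_deriv_t: "t \<in> {0..horizon p} \<Longrightarrow> ((\<lambda>t. U_fn p Y s t) has_real_derivative U_t s t) (at t within {0..horizon p})"
  unfolding U_fn_def U_t_def
  by (auto intro!: derivative_eq_intros Y_deriv_t has_field_derivative_at_within[OF g_riccati] simp: algebra_simps)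

lemma cont_fst_snd:
  "continuous_on (UNIV \<times> {0..horizon p}) (\<lambda>z. Y (fst z) (snd z))"
  "continuous_on (UNIV \<times> {0..horizon p}) (\<lambda>z. Y_s (fst z) (snd z))"
  "continuous_on (UNIV \<times> {0..horizon p}) (\<lambda>z. Y_ss (fst z) (snd z))"
  "continuous_on (UNIV \<times> {0..horizon p}) (\<lambda>z. Y_t (fst z) (snd z))"
  "continuous_on (UNIV \<times> {0..horizon p}) (\<lambda>z. g_fn p (snd z))"
  using cont_Y cont_Y_s cont_Y_ss cont_Y_t continuous_on_compose2[OF cont_g continuous_on_snd[OF continuous_on_id], of "UNIV \<times> {0..horizon p}"]
  by (auto simp: split_beta)

lemma cont_U:
  "continuous_on (UNIV \<times> {0..horizon p}) (\<lambda>z. U_fn p Y (fst z) (snd z))"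
  "continuous_on (UNIV \<times> {0..horizon p}) (\<lambda>z. U_s (fst z) (snd z))"
  "continuous_on (UNIV \<times> {0..horizon p}) (\<lambda>z. U_ss (fst z) (snd z))"
  "continuous_on (UNIV \<times> {0..horizon p}) (\<lambda>z. U_t (fst z) (snd z))"
proof -
  show U: "continuous_on (UNIV \<times> {0..horizon p}) (\<lambda>z. U_fn p Y (fst z) (snd z))"
    unfolding U_fn_def by (intro continuous_intros cont_fst_snd) auto
  show "continuous_on (UNIV \<times> {0..horizon p}) (\<lambda>z. U_s (fst z) (snd z))"
    unfolding U_s_def slope_def by (intro continuous_intros cont_fst_snd U)
  show "continuous_on (UNIV \<times> {0..horizon p}) (\<lambda>z. U_ss (fst z) (snd z))"
    unfolding U_ss_def slope_def by (intro continuous_intros cont_fst_snd U)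
  show "continuous_on (UNIV \<times> {0..horizon p}) (\<lambda>z. U_t (fst z) (snd z))"
    unfolding U_t_def g_deriv_def by (intro continuous_intros cont_fst_snd U) auto
qed

definition z_fn :: "real ^ 2 \<Rightarrow> real \<Rightarrow> real" where
  "z_fn \<xi> t = varpi p * (\<xi> $ 1) powr \<gamma> p * U_fn p Y (\<xi> $ 2) t"
definition z_t :: "real ^ 2 \<Rightarrow> real \<Rightarrow> real" where
  "z_t \<xi> t = varpi p * (\<xi> $ 1) powr \<gamma> p * U_t (\<xi> $ 2) t"
definition z_x :: "real ^ 2 \<Rightarrow> real \<Rightarrow> real" where
  "z_x \<xi> t = varpi p * \<gamma> p * (\<xi> $ 1) powr (\<gamma> p - 1) * U_fn p Y (\<xi> $ 2) t"
definition z_s :: "real ^ 2 \<Rightarrow> real \<Rightarrow> real" where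
  "z_s \<xi> t = varpi p * (\<xi> $ 1) powr \<gamma> p * U_s (\<xi> $ 2) t"
definition z_xx :: "real ^ 2 \<Rightarrow> real \<Rightarrow> real" where
  "z_xx \<xi> t = varpi p * \<gamma> p * (\<gamma> p - 1) * (\<xi> $ 1) powr (\<gamma> p - 2) * U_fn p Y (\<xi> $ 2) t"
definition z_xs :: "real ^ 2 \<Rightarrow> real \<Rightarrow> real" where
  "z_xs \<xi> t = varpi p * \<gamma> p * (\<xi> $ 1) powr (\<gamma> p - 1) * U_s (\<xi> $ 2) t"
definition z_ss :: "real ^ 2 \<Rightarrow> real \<Rightarrow> real" where
  "z_ss \<xi> t = varpi p * (\<xi> $ 1) powr \<gamma> p * U_ss (\<xi> $ 2) t"
definition z_grad :: "real ^ 2 \<Rightarrow> real \<Rightarrow> real ^ 2" where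
  "z_grad \<xi> t = (\<chi> i. if i = 1 then z_x \<xi> t else z_s \<xi> t)"
definition z_hess :: "real ^ 2 \<Rightarrow> real \<Rightarrow> real ^ 2 ^ 2" where
  "z_hess \<xi> t = (\<chi> i j. if i = 1 then (if j = 1 then z_xx \<xi> t else z_xs \<xi> t)
                       else (if j = 1 then z_xs \<xi> t else z_ss \<xi> t))"

lemma powr_deriv: "0 < x \<Longrightarrow> ((\<lambda>x. k * x powr e) has_real_derivative k * e * x powr (e - 1)) (at x)" for x k e :: real
  by (auto intro!: derivative_eq_intros)

lemma z_gderiv:
  assumes x: "0 < \<xi> $ 1" and t: "t \<in> {0..horizon p}"
  shows "GDERIV (\<lambda>\<zeta>. z_fn \<zeta> t) \<xi> :> z_grad \<xi> t"
proof -
  have "(\<lambda>h::real^2. h \<bullet> z_grad \<xi> t) = (\<lambda>h. varpi p * \<gamma> p * (\<xi> $ 1) powr (\<gamma> p - 1) * U_fn p Y (\<xi> $ 2) t * h $ 1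
      + varpi p * (\<xi> $ 1) powr \<gamma> p * U_s (\<xi> $ 2) t * h $ 2)"
    by (simp add: inner_vec_def sum_2 z_grad_def z_x_def z_s_def fun_eq_iff algebra_simps)
  then show ?thesis
    unfolding gderiv_def z_fn_def
    using has_derivative_separated[OF powr_deriv[OF x] U_deriv_s[OF t]] by simp
qed

lemma z_grad_deriv:
  assumes x: "0 < \<xi> $ 1" and t: "t \<in> {0..horizon p}"
  shows "((\<lambda>\<zeta>. z_grad \<zeta> t) has_derivative (\<lambda>h. z_hess \<xi> t *v h)) (at \<xi>)"
proof (rule has_derivative_vec2)
  fix i :: 2
  consider "i = 1" | "i = 2" using exhaust_2 by blast
  then show "((\<lambda>\<zeta>. z_grad \<zeta> t $ i) has_derivative (\<lambda>h. z_hess \<xi> t $ i $ 1 * h $ 1 + z_hess \<xi> t $ i $ 2 * h $ 2)) (at \<xi>)"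
  proof cases
    case 1
    show ?thesis
      unfolding 1 using has_derivative_separated[OF powr_deriv[OF x, of "varpi p * \<gamma> p" "\<gamma> p - 1"] U_deriv_s[OF t]]
      by (simp add: z_grad_def z_hess_def z_x_def z_xx_def z_xs_def)
  next
    case 2
    show ?thesis
      unfolding 2 using has_derivative_separated[OF powr_deriv[OF x, of "varpi p" "\<gamma> p"] U_deriv_ss[OF t]]
      by (simp add: z_grad_def z_hess_def z_s_def z_xs_def z_ss_def)
  qed
qed

text \<open>
  Every derivative of \<open>z\<close> is \<open>k P = z\<close> times a function of \<open>s\<close> and \<open>t\<close>, divided by a power of
  \<open>x\<close>, so that \<open>z\<close> factors out.  The maximizing consumption \<open>c0\<close> is the solution of \<open>z_x = \<gamma> c^(\<gamma> - 1)\<close>, and the maximizing investment is \<open>- B / A\<close>.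
\<close>
lemma z_hjb:
  assumes x: "0 < \<xi> $ 1" and t: "t \<in> {0..horizon p}"
  shows "ereal (z_t \<xi> t) + Hamiltonian p \<xi> t (z_grad \<xi> t) (z_hess \<xi> t) = 0"
proof -
  define X s where "X = \<xi> $ 1" and "s = \<xi> $ 2"
  define k where "k = varpi p * U_fn p Y s t"
  define P where "P = X powr \<gamma> p"
  define L where "L = slope s t"
  define N where "N = (1 - \<gamma> p) * varpi p powr (- 1 / (1 - \<gamma> p)) * G_fn p s t (Y s t)"
  have X: "0 < X" using x by (simp add: X_def)
  have k: "0 < k" using varpi_pos U_pos by (simp add: k_def)
  have P: "0 < P" using X by (simp add: P_def)
  have P1: "X powr (\<gamma> p - 1) = P / X" using X by (simp add: P_def powr_diff)
  have P2: "X powr (\<gamma> p - 2) = P / X\<^sup>2" using X by (simp add: P_def powr_diff)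
  have zx: "z_x \<xi> t = \<gamma> p * k * P / X" by (simp add: z_x_def X_def[symmetric] s_def[symmetric] P1 k_def)
  have zs: "z_s \<xi> t = k * P * L" by (simp add: z_s_def X_def[symmetric] s_def[symmetric] P_def[symmetric] k_def U_s_def L_def)
  have zxx: "z_xx \<xi> t = - (\<gamma> p * (1 - \<gamma> p) * k * P / X\<^sup>2)"
    using X by (simp add: z_xx_def X_def[symmetric] s_def[symmetric] P2 k_def field_simps)
  have zxs: "z_xs \<xi> t = \<gamma> p * k * P * L / X" by (simp add: z_xs_def X_def[symmetric] s_def[symmetric] P1 k_def U_s_def L_def)
  have zss: "z_ss \<xi> t = k * P * (L\<^sup>2 + g_fn p t + Y_ss s t)"
    by (simp add: z_ss_def X_def[symmetric] s_def[symmetric] P_def[symmetric] k_def U_ss_def L_def)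
  have zt: "z_t \<xi> t = k * P * (s\<^sup>2 / 2 * g_deriv t + Y_t s t)"
    by (simp add: z_t_def X_def[symmetric] s_def[symmetric] P_def[symmetric] k_def U_t_def)
  define c0 where "c0 = X * k powr (- 1 / (1 - \<gamma> p))"
  have c0: "0 < c0" using X k by (simp add: c0_def)
  have q: "z_x \<xi> t = \<gamma> p * c0 powr (\<gamma> p - 1)"
  proof -
    have "c0 powr (\<gamma> p - 1) = X powr (\<gamma> p - 1) * k powr ((- 1 / (1 - \<gamma> p)) * (\<gamma> p - 1))"
      using X k by (simp add: c0_def powr_mult powr_powr)
    also have "(- 1 / (1 - \<gamma> p)) * (\<gamma> p - 1) = 1" using gamma_lt_1 by (simp add: field_simps)
    finally show ?thesis using k by (simp add: zx P1)
  qed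
  have c0P: "(1 - \<gamma> p) * c0 powr \<gamma> p = k * P * N"
  proof -
    have "c0 powr \<gamma> p = c0 powr (\<gamma> p - 1) * c0" using c0 by (simp add: powr_diff)
    also have "c0 powr (\<gamma> p - 1) = k * P / X"
      using q gamma_pos by (simp add: zx mult.assoc times_divide_eq_right[symmetric] del: times_divide_eq_right)
    finally have "c0 powr \<gamma> p = k * P * k powr (- 1 / (1 - \<gamma> p))" using X by (simp add: c0_def)
    also have "k powr (- 1 / (1 - \<gamma> p)) = varpi p powr (- 1 / (1 - \<gamma> p)) * G_fn p s t (Y s t)"
      unfolding k_def G_fn_def U_fn_def using varpi_pos
      by (subst powr_mult) (auto simp: exp_powr_real)
    finally show ?thesis by (simp add: N_def)
  qed
  define B where "B = (\<sigma> p)\<^sup>2 * z_xs \<xi> t - \<kappa>\<^sub>1 p * s * z_x \<xi> t"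
  define A where "A = (\<sigma> p)\<^sup>2 * z_xx \<xi> t"
  have A: "A < 0" using sigma_pos gamma_pos gamma_lt_1 k P X by (simp add: A_def zxx)
  have BA: "- (B\<^sup>2 / (2 * A)) = k * P * (\<gamma> p * ((\<sigma> p)\<^sup>2 * L - \<kappa>\<^sub>1 p * s)\<^sup>2 / (2 * (\<sigma> p)\<^sup>2 * (1 - \<gamma> p)))"
  proof -
    have B: "B = \<gamma> p * k * P / X * ((\<sigma> p)\<^sup>2 * L - \<kappa>\<^sub>1 p * s)" using X by (simp add: B_def zx zxs field_simps)
    show ?thesis unfolding B A_def zxx using sigma_pos gamma_pos gamma_lt_1 k P X
      by (simp add: field_simps power2_eq_square)
  qed
  define M where "M = - (B\<^sup>2 / (2 * A)) + 1 / 2 * (\<sigma> p)\<^sup>2 * z_ss \<xi> t + rate p * X * z_x \<xi> t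
      - \<kappa> p * s * z_s \<xi> t + (1 - \<gamma> p) * c0 powr \<gamma> p"
  define obj where "obj = (\<lambda>(\<alpha>, c). \<alpha>\<^sup>2 * (\<sigma> p)\<^sup>2 / 2 * z_xx \<xi> t + B * \<alpha> + 1 / 2 * (\<sigma> p)\<^sup>2 * z_ss \<xi> t
      + rate p * X * z_x \<xi> t - \<kappa> p * s * z_s \<xi> t - c * z_x \<xi> t + c powr \<gamma> p)"
  have Ham: "Hamiltonian p \<xi> t (z_grad \<xi> t) (z_hess \<xi> t) = (SUP i\<in>UNIV \<times> {0..}. ereal (obj i))"
    unfolding Hamiltonian_def obj_def B_def X_def s_def z_grad_def z_hess_def by (simp add: split_beta)
  have le: "obj (\<alpha>, c) \<le> M" if "0 \<le> c" for \<alpha> c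
  proof -
    have "\<alpha>\<^sup>2 * (\<sigma> p)\<^sup>2 / 2 * z_xx \<xi> t + B * \<alpha> \<le> - (B\<^sup>2 / (2 * A))"
      using quadratic_max[OF A, of \<alpha> B] by (simp add: A_def)
    moreover have "c powr \<gamma> p - c * z_x \<xi> t \<le> (1 - \<gamma> p) * c0 powr \<gamma> p"
      unfolding q by (rule consumption_max[OF gamma_pos gamma_lt_1 c0 that])
    ultimately show ?thesis by (simp add: obj_def M_def)
  qed
  have attained: "obj (- B / A, c0) = M"
  proof -
    have "(- B / A)\<^sup>2 * (\<sigma> p)\<^sup>2 / 2 * z_xx \<xi> t + B * (- B / A) = (- B / A)\<^sup>2 * A / 2 + B * (- B / A)"
      by (simp add: A_def)
    also have "\<dots> = - (B\<^sup>2 / (2 * A))" using A by (simp add: field_simps power2_eq_square)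
    finally have 1: "(- B / A)\<^sup>2 * (\<sigma> p)\<^sup>2 / 2 * z_xx \<xi> t + B * (- B / A) = - (B\<^sup>2 / (2 * A))" .
    have "c0 * z_x \<xi> t = \<gamma> p * c0 powr \<gamma> p" unfolding q using c0 by (simp add: powr_diff)
    then have "c0 powr \<gamma> p - c0 * z_x \<xi> t = (1 - \<gamma> p) * c0 powr \<gamma> p" by (simp add: algebra_simps)
    then show ?thesis using 1 unfolding obj_def M_def by (simp only: split_conv)
  qed
  have "(SUP i\<in>UNIV \<times> {0..}. ereal (obj i)) = ereal M"
  proof (rule SUP_eqI)
    show "ereal (obj i) \<le> ereal M" if "i \<in> UNIV \<times> {0..}" for i
      using that le[of "snd i" "fst i"] by auto
    show "ereal M \<le> y" if "\<And>i. i \<in> UNIV \<times> {0..} \<Longrightarrow> ereal (obj i) \<le> y" for y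
      using that[of "(- B / A, c0)"] c0 unfolding attained by simp
  qed
  moreover have "z_t \<xi> t + M = 0"
  proof -
    have "z_t \<xi> t + M = k * P * (s\<^sup>2 / 2 * g_deriv t + Y_t s t
       + \<gamma> p * ((\<sigma> p)\<^sup>2 * L - \<kappa>\<^sub>1 p * s)\<^sup>2 / (2 * (\<sigma> p)\<^sup>2 * (1 - \<gamma> p))
       + 1 / 2 * (\<sigma> p)\<^sup>2 * (L\<^sup>2 + g_fn p t + Y_ss s t)
       + rate p * \<gamma> p - \<kappa> p * s * L + N)"
      unfolding M_def BA c0P zt zss zs zx using X by (simp add: algebra_simps)
    also have "\<dots> = 0"
      using hjb_reduced_identity[of "Y_t s t" "Y_ss s t" s t "Y_s s t" N] Y_pde[OF t, of s]
      by (simp add: L_def slope_def N_def \<Psi>_def ds_Y[OF t])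
    finally show ?thesis .
  qed
  ultimately show ?thesis unfolding Ham by simp
qed

lemma z_solves: "classical_HJB_solution p z_fn"
proof -
  let ?D = "{\<xi>::real^2. 0 < \<xi> $ 1} \<times> {0..horizon p}"
  have snd2: "continuous_on ?D (\<lambda>w. f (fst w $ 2) (snd w))"
    if "continuous_on (UNIV \<times> {0..horizon p}) (\<lambda>z. f (fst z) (snd z))" for f :: "real \<Rightarrow> real \<Rightarrow> real"
    by (rule continuous_on_compose2[OF that, of _ "\<lambda>w. (fst w $ 2, snd w)", simplified]) (auto intro!: continuous_intros)
  have pw: "continuous_on ?D (\<lambda>w. (fst w $ 1) powr e)" for e
    by (intro continuous_intros) auto
  note U = snd2[OF cont_U(1)] snd2[OF cont_U(2)] snd2[OF cont_U(3)] snd2[OF cont_U(4)]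
  have z: "continuous_on ?D (\<lambda>w. z_fn (fst w) (snd w))" "continuous_on ?D (\<lambda>w. z_t (fst w) (snd w))"
    "continuous_on ?D (\<lambda>w. z_x (fst w) (snd w))" "continuous_on ?D (\<lambda>w. z_s (fst w) (snd w))"
    "continuous_on ?D (\<lambda>w. z_xx (fst w) (snd w))" "continuous_on ?D (\<lambda>w. z_xs (fst w) (snd w))"
    "continuous_on ?D (\<lambda>w. z_ss (fst w) (snd w))"
    unfolding z_fn_def z_t_def z_x_def z_s_def z_xx_def z_xs_def z_ss_def
    by (intro continuous_on_mult continuous_on_const pw U)+
  have grad: "continuous_on ?D (\<lambda>w. z_grad (fst w) (snd w))"
    unfolding z_grad_def
  proof (rule continuous_on_vec_lambda)
    fix i :: 2
    show "continuous_on ?D (\<lambda>w. if i = 1 then z_x (fst w) (snd w) else z_s (fst w) (snd w))"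
      by (cases "i = 1") (simp_all add: z)
  qed
  have hess: "continuous_on ?D (\<lambda>w. z_hess (fst w) (snd w))"
    unfolding z_hess_def
  proof (intro continuous_on_vec_lambda)
    fix i j :: 2
    show "continuous_on ?D (\<lambda>w. if i = 1 then if j = 1 then z_xx (fst w) (snd w) else z_xs (fst w) (snd w)
       else if j = 1 then z_xs (fst w) (snd w) else z_ss (fst w) (snd w))"
      by (cases "i = 1"; cases "j = 1") (simp_all add: z)
  qed
  have dt: "((\<lambda>u. z_fn \<xi> u) has_real_derivative z_t \<xi> t) (at t within {0..horizon p})" if "t \<in> {0..horizon p}" for \<xi> t
    unfolding z_fn_def z_t_def by (intro DERIV_cmult U_deriv_t that)
  have zT: "z_fn \<xi> (horizon p) = varpi p * (\<xi> $ 1) powr \<gamma> p" for \<xi>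
    by (simp add: z_fn_def U_fn_def g_terminal Y_terminal)
  show ?thesis
    unfolding classical_HJB_solution_def split_beta
    by (intro conjI exI[of _ z_t] exI[of _ z_grad] exI[of _ z_hess] allI impI
        z(1,2) grad hess dt z_gderiv z_grad_deriv z_hjb zT) auto
qed

end

theorem theorem5p1:
  fixes p :: spread_params
  assumes "0 < \<gamma> p" and "\<gamma> p < 1"
    and "0 < \<kappa> p" and "0 < \<sigma> p" and "0 < varpi p"
    and "0 \<le> rate p" and "rate p \<le> \<kappa> p" and "0 < \<kappa>\<^sub>1 p"
    and "0 < horizon p" and "horizon p < T0_bound p"
  shows "\<exists>Y. Y \<in> \<X> p \<and> solves_Y_pde p Y \<and>
           (\<forall>Y'. Y' \<in> \<X> p \<and> solves_Y_pde p Y' \<longrightarrow>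
              (\<forall>s. \<forall>t\<in>{0..horizon p}. Y' s t = Y s t)) \<and>
           (\<forall>(M :: 'a measure) W \<eta>.
              standard_brownian_motion M W \<and> solves_eta_sde p M W \<eta> \<longrightarrow>
              (\<forall>s. \<forall>t\<in>{0..horizon p}. Y s t = FK_map p M \<eta> Y s t)) \<and>
           classical_HJB_solution p
             (\<lambda>\<xi> t. varpi p * (\<xi> $ 1) powr \<gamma> p * U_fn p Y (\<xi> $ 2) t)"
proof -
  interpret spread_model p using assms by unfold_locales auto
  have "\<forall>Y'. Y' \<in> \<X> p \<and> solves_Y_pde p Y' \<longrightarrow> (\<forall>s. \<forall>t\<in>{0..horizon p}. Y' s t = Y s t)"
    using comparison Y_in_X Y_solves by (meson order_antisym)
  moreover have "classical_HJB_solution p (\<lambda>\<xi> t. varpi p * (\<xi> $ 1) powr \<gamma> p * U_fn p Y (\<xi> $ 2) t)"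
    using z_solves by (simp add: z_fn_def[abs_def])
  ultimately show ?thesis
    using Y_in_X Y_solves Y_fixed_point by blast
qed

end
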